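(* Let $x,y,z$ be non-negative integers. (i) For all non-negative integers $a,b$, $$M(H^{(5)}_{x,y,z}(a,b))=\frac{P'_{y,y+2a+1,b}\,P_{z+b,z+b,a}\,Q(a,b,x,y+z)}{P_{y+z+b,y+z+b,a}}\cdot\frac{V(2a+2b+3,y+z-1,y)}{V(2x+2a+2b+3,y+z-1,y)}\cdot\frac{T(x+b+1,y+z+2a,y)\,T(2a+b+2,y+b-1,b)\,T(z+1,y+b-1,b)}{T(b+1,y+z+2a,y)\,T(x+2a+b+2,y+b-1,b)\,T(x+z+1,y+b-1,b)}.$$ (ii) For every $k\ge 2$ and every sequence $\mathbf a=(a_1,\dots,a_{2k})$ of non-negative integers, write $\mathrm O=\mathrm O(\mathbf a)$, $\mathrm E=\mathrm E(\mathbf a)$, $e_i=e_i(\mathbf a)$, $o_i=o_i(\mathbf a)$, $\sigma_i=s_{2i-1}(\mathbf a)+s_{2k}(\mathbf a)$ and $T_i(u)=T(u,\,a_{2i-2}+o_i-1,\,o_i)$. Then $$M(H^{(5)}_{x,y,z}(a_1,\dots,a_{2k}))=2^{a_1}M(H^{(5)}_{x,y,z}(\mathrm O,\mathrm E))\,\frac{K'(0,a_1+1,a_2,\dots,a_{2k},y)\,Q(a_1,\dots,a_{2k-1},a_{2k}+z)}{P'_{y,y+2\mathrm O+1,\mathrm E}\,P_{z+\mathrm E,z+\mathrm E,\mathrm O}}$$ $$\times\prod_{i=2}^{k}\frac{T_i(x+z+e_i+1)\,T_i(y+e_i+1)}{T_i(x+y+e_i+1)\,T_i(z+e_i+1)}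\cdot\frac{T_i(x+y+\sigma_i+2)\,T_i(z+\sigma_i+2)}{T_i(x+z+\sigma_i+2)\,T_i(y+\sigma_i+2)}.$$
   Context: Geometry. Work on the triangular lattice with unit equilateral triangles and horizontal lattice lines; consecutive horizontal lattice lines are one level apart. East, west, NE, NW, SE, SW denote the six unit lattice steps. An up-pointing (down-pointing) triangle has a horizontal bottom (top) side. A lozenge is the union of two unit triangles sharing an edge; it is vertical if the shared edge is horizontal. A tiling of a region (finite union of unit triangles) is a covering by lozenges without gaps or overlaps. Lozenges may carry weights (weight 1 unless stated otherwise); the weight of a tiling is the product of the weights of its lozenges, and $M(R)$ is the sum of the weights of all tilings of $R$. Polygons are described by their boundary path, starting at the upper-left corner and going counterclockwise; $(\mathrm{SW},\mathrm{SE})^m$ means the two steps repeated $m$ times. Numbers $P,P'$. For $0\le a\le b$, $c\ge0$, take the polygon with boundary $(\mathrm{SW},\mathrm{SE})^{a}$, then $b-a$ steps SE, $c$ steps east, $a$ steps NE, $b$ steps NW, $c$ steps west. $P_{a,b,c}$ is its number of (unweighted) tilings; $P'_{a,b,c}$ is its weighted tiling number when each vertical lozenge whose two left sides both lie on the zigzag part $(\mathrm{SW},\mathrm{SE})^a$ has weight $\frac12$. Sequences. For a finite sequence $\mathbf t=(t_1,t_2,\dots)$ of non-negative integers: $\mathrm O(\mathbf t)=\sum_{i\text{ odd}}t_i$, $\mathrm E(\mathbf t)=\sum_{i\text{ even}}t_i$, $s_m(\mathbf t)=\sum_{i=1}^m t_i$, $o_m(\mathbf t)=\sum_{i\ge m}t_{2i-1}$,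 $e_m(\mathbf t)=\sum_{i\ge m}t_{2i}$. Numbers $Q$, $K'$. For $\mathbf t=(t_1,\dots,t_{2l})$, $Q(\mathbf t)$ is the number of tilings of the region obtained from the polygon with boundary $(\mathrm{SW},\mathrm{SE})^{\mathrm E(\mathbf t)}$, then $\mathrm E(\mathbf t)+\mathrm O(\mathbf t)$ steps east, $2\mathrm E(\mathbf t)$ steps NW, $\mathrm O(\mathbf t)$ steps west, as follows: divide the bottom side from left to right into segments of lengths $t_1,\dots,t_{2l}$, and for each $i$ remove the up-pointing triangle of side $t_{2i}$ whose bottom side is the $2i$-th segment (intersected with the polygon). For $\mathrm E(\mathbf t)\ge1$, $K'(\mathbf t)$ is the weighted tiling number of the region obtained by the same removals from the polygon with boundary $(\mathrm{SW},\mathrm{SE})^{\mathrm E(\mathbf t)-1}$, one step SW, then $\mathrm E(\mathbf t)+\mathrm O(\mathbf t)$ steps east, $2\mathrm E(\mathbf t)-1$ steps NW, $\mathrm O(\mathbf t)$ steps west, where each vertical lozenge whose two left sides both lie on the western zigzag has weight $\frac12$. Region $H^{(5)}_{x,y,z}(a_1,\dots,a_k)$. With $\mathrm O=\mathrm O(\mathbf a)$, $\mathrm E=\mathrm E(\mathbf a)$, take the polygon with boundary $(\mathrm{SW},\mathrm{SE})^{y+\mathrm O}$, one step SW (arriving at a point $W_0$), one step east, $(\mathrm{SW},\mathrm{SE})^{z+\mathrm E}$, then $x+\mathrm O$ steps east, $y+z+2\mathrm E$ steps NE, $y+z+2\mathrm O+1$ steps NW, $x+\mathrm E$ steps west. Let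 $L$ be the horizontal lattice line through $W_0$; starting at $W_0$ mark on $L$ from left to right consecutive segments of lengths $a_1+1,a_2,a_3,\dots,a_k$. Remove: for $i=1$, the part of the polygon above $L$ and to the left of the line going from the right endpoint of the first segment in direction NW (half of an up-pointing triangle); for odd $i\ge3$, the up-pointing triangle of side $a_i$ whose bottom side is the $i$-th segment; for even $i$, the down-pointing triangle of side $a_i$ whose top side is the $i$-th segment. Give weight $\frac12$ to each vertical lozenge whose two left sides both lie on the part of the western boundary above $L$; all other lozenges have weight 1. Products. $(u)_n=u(u+1)\cdots(u+n-1)$ for $n>0$, $(u)_0=1$, $(u)_n=\frac1{(u-1)(u-2)\cdots(u+n)}$ for $n<0$. $[u]_n=u(u+2)\cdots(u+2(n-1))$ for $n>0$, $[u]_0=1$, $[u]_n=\frac1{(u-2)(u-4)\cdots(u+2n)}$ for $n<0$. $T(u,n,m)=\prod_{i=0}^{m-1}(u+i)_{n-2i}$ and $V(u,n,m)=\prod_{i=0}^{m-1}[u+2i]_{n-2i}$ (empty products $=1$).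
   Formalization: In (ii), σ_i is taken as s_{2i-3}(a)+s_{2k}(a) instead of s_{2i-1}(a)+s_{2k}(a); the printed formula fails, e.g. for x=z=1, y=0, a=(0,1,1,0), where the tiling number is 20 but the printed right side is 98/5. *)

theory Defs
  imports Complex_Main "HOL-Library.Disjoint_Sets"
begin

section \<open>The triangular lattice\<close>

text \<open>The pair \<open>(i, j)\<close> stands for the lattice point \<open>i * east + j * northeast\<close>, so that
  \<open>j\<close> is the level and \<open>northwest = northeast - east\<close>.\<close>

type_synonym point = "int \<times> int"

datatype direction = East | West | NE | NW | SE | SW

fun move :: "direction \<Rightarrow> point \<Rightarrow> point" where
  "move East (i, j) = (i + 1, j)"
| "move West (i, j) = (i - 1, j)"
| "move NE (i, j) = (i, j + 1)"
| "move NW (i, j) = (i - 1, j + 1)"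
| "move SE (i, j) = (i + 1, j - 1)"
| "move SW (i, j) = (i, j - 1)"

fun walk :: "point \<Rightarrow> direction list \<Rightarrow> (point \<times> point) list" where
  "walk p [] = []"
| "walk p (d # ds) = (p, move d p) # walk (move d p) ds"

definition endpoint :: "direction list \<Rightarrow> point" where
  "endpoint ds = fold move ds (0, 0)"

definition edges :: "direction list \<Rightarrow> point set set" where
  "edges ds = (\<lambda>(p, q). {p, q}) ` set (walk (0, 0) ds)"

definition zigzag :: "nat \<Rightarrow> direction list" where
  "zigzag m = concat (replicate m [SW, SE])"

text \<open>Unit triangles; both \<open>Up i j\<close> and \<open>Down i j\<close> lie between the levels \<open>j\<close> and \<open>j + 1\<close>.\<close>

datatype triangle = Up int int | Down int int

fun vertices :: "triangle \<Rightarrow> point set" where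
  "vertices (Up i j) = {(i, j), (i + 1, j), (i, j + 1)}"
| "vertices (Down i j) = {(i + 1, j), (i, j + 1), (i + 1, j + 1)}"

definition triangles_in :: "point set \<Rightarrow> triangle set" where
  "triangles_in S = {t. vertices t \<subseteq> S}"


section \<open>Polygons\<close>

text \<open>Let \<open>p\<close>, \<open>q\<close> be the endpoints of a unit edge joining the levels \<open>j\<close> and \<open>j + 1\<close>. The number
  \<open>fst p + fst q\<close> is \<open>2 * i\<close> for the left side of \<open>Up i j\<close> and \<open>2 * i + 1\<close> for the common side of
  \<open>Up i j\<close> and \<open>Down i j\<close>. Hence the edge lies to the west of \<open>Up i j\<close> iff \<open>fst p + fst q \<le> 2 * i\<close>,
  and to the west of \<open>Down i j\<close> iff \<open>fst p + fst q \<le> 2 * i + 1\<close>.\<close>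

fun level :: "triangle \<Rightarrow> int" where
  "level (Up i j) = j"
| "level (Down i j) = j"

fun position :: "triangle \<Rightarrow> int" where
  "position (Up i j) = 2 * i"
| "position (Down i j) = 2 * i + 1"

fun crossing :: "triangle \<Rightarrow> point \<times> point \<Rightarrow> int" where
  "crossing t (p, q) =
     (if fst p + fst q \<le> position t then
        (if snd p = level t + 1 \<and> snd q = level t then 1
         else if snd p = level t \<and> snd q = level t + 1 then - 1
         else 0)
      else 0)"

text \<open>For a closed path starting at the origin, \<open>winding ds t\<close> is its winding number around the
  centre of \<open>t\<close>, computed as the signed number of crossings of the path with the westward horizontal
  ray. It is \<open>0\<close> outside, and \<open>1\<close> inside a counterclockwise path; stretches that are traversed in
  both directions (these occur when some side lengths vanish) enclose nothing.\<close>

definition winding :: "direction list \<Rightarrow> triangle \<Rightarrow> int" where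
  "winding ds t = sum_list (map (crossing t) (walk (0, 0) ds))"

definition polygon :: "direction list \<Rightarrow> triangle set" where
  "polygon ds = {t. winding ds t \<noteq> 0}"

text \<open>The up-pointing triangle of side \<open>n\<close> with bottom left corner \<open>p\<close>, and the down-pointing
  triangle of side \<open>n\<close> with top left corner \<open>p\<close>.\<close>

definition up_triangle :: "point \<Rightarrow> nat \<Rightarrow> triangle set" where
  "up_triangle p n =
     triangles_in {(i, j). fst p \<le> i \<and> snd p \<le> j \<and> i + j \<le> fst p + snd p + int n}"

definition down_triangle :: "point \<Rightarrow> nat \<Rightarrow> triangle set" where
  "down_triangle p n =
     triangles_in {(i, j). i \<le> fst p + int n \<and> j \<le> snd p \<and> fst p + snd p \<le> i + j}"

text \<open>Everything above the level of \<open>q\<close> and to the left of the line through \<open>q\<close> of direction NW.\<close>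

definition left_part :: "point \<Rightarrow> triangle set" where
  "left_part q = triangles_in {(i, j). snd q \<le> j \<and> i + j \<le> fst q + snd q}"


section \<open>Lozenge tilings\<close>

definition lozenge :: "triangle set \<Rightarrow> bool" where
  "lozenge l \<longleftrightarrow> (\<exists>s t. s \<noteq> t \<and> card (vertices s \<inter> vertices t) = 2 \<and> l = {s, t})"

definition tilings :: "triangle set \<Rightarrow> triangle set set set" where
  "tilings R = {T. partition_on R T \<and> (\<forall>l\<in>T. lozenge l)}"

definition weighted_count :: "(triangle set \<Rightarrow> real) \<Rightarrow> triangle set \<Rightarrow> real" where
  "weighted_count w R = (\<Sum>T\<in>tilings R. \<Prod>l\<in>T. w l)"

text \<open>The vertical lozenge whose horizontal diagonal has left endpoint \<open>(i, j)\<close> is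
  \<open>{Up i j, Down i (j - 1)}\<close>; its left sides join \<open>(i, j)\<close> to \<open>(i, j + 1)\<close> and to
  \<open>(i + 1, j - 1)\<close>.\<close>

definition half_weight :: "point set set \<Rightarrow> triangle set \<Rightarrow> real" where
  "half_weight F l =
     (if \<exists>i j. l = {Up i j, Down i (j - 1)} \<and>
               {(i, j), (i, j + 1)} \<in> F \<and> {(i, j), (i + 1, j - 1)} \<in> F
      then 1 / 2 else 1)"


section \<open>Sequences\<close>

text \<open>Sequences are lists, with entries numbered from \<open>1\<close>.\<close>

definition entry :: "nat list \<Rightarrow> nat \<Rightarrow> nat" where
  "entry t i = t ! (i - 1)"

definition odd_sum :: "nat list \<Rightarrow> nat" where
  "odd_sum t = (\<Sum>i | i \<in> {1..length t} \<and> odd i. entry t i)"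

definition even_sum :: "nat list \<Rightarrow> nat" where
  "even_sum t = (\<Sum>i | i \<in> {1..length t} \<and> even i. entry t i)"

definition s_sum :: "nat \<Rightarrow> nat list \<Rightarrow> nat" where
  "s_sum m t = (\<Sum>i = 1..m. entry t i)"

definition o_sum :: "nat \<Rightarrow> nat list \<Rightarrow> nat" where
  "o_sum m t = (\<Sum>i | m \<le> i \<and> 2 * i - 1 \<in> {1..length t}. entry t (2 * i - 1))"

definition e_sum :: "nat \<Rightarrow> nat list \<Rightarrow> nat" where
  "e_sum m t = (\<Sum>i | m \<le> i \<and> 2 * i \<in> {1..length t}. entry t (2 * i))"

text \<open>The source defines \<open>\<sigma>\<^sub>i\<close> with \<open>s_sum (2 * i - 1)\<close> in place of \<open>s_sum (2 * i - 3)\<close>. With that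
  index the product formula fails: for \<open>x = z = 1\<close>, \<open>y = 0\<close> and the sequence \<open>(0, 1, 1, 0)\<close> the
  weighted tiling number is \<open>20\<close>, while the right-hand side would be \<open>98/5\<close>.\<close>

definition sigma :: "nat list \<Rightarrow> nat \<Rightarrow> nat" where
  "sigma t i = s_sum (2 * i - 3) t + s_sum (length t) t"


section \<open>Regions and their tiling numbers\<close>

definition P_path :: "nat \<Rightarrow> nat \<Rightarrow> nat \<Rightarrow> direction list" where
  "P_path a b c = zigzag a @ replicate (b - a) SE @ replicate c East @ replicate a NE
     @ replicate b NW @ replicate c West"

definition P :: "nat \<Rightarrow> nat \<Rightarrow> nat \<Rightarrow> real" where
  "P a b c = real (card (tilings (polygon (P_path a b c))))"

definition P' :: "nat \<Rightarrow> nat \<Rightarrow> nat \<Rightarrow> real" where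
  "P' a b c = weighted_count (half_weight (edges (zigzag a))) (polygon (P_path a b c))"

definition shift_east :: "nat \<Rightarrow> point \<Rightarrow> point" where
  "shift_east n p = (fst p + int n, snd p)"

text \<open>The up-pointing triangles on the even-numbered segments, for segments of lengths \<open>t\<close> marked
  from \<open>p\<close> to the east.\<close>

definition dents :: "point \<Rightarrow> nat list \<Rightarrow> triangle set" where
  "dents p t =
     (\<Union>i\<in>{i. i \<in> {1..length t} \<and> even i}. up_triangle (shift_east (s_sum (i - 1) t) p) (entry t i))"

definition Q_region :: "nat list \<Rightarrow> triangle set" where
  "Q_region t =
     polygon (zigzag (even_sum t) @ replicate (even_sum t + odd_sum t) East
       @ replicate (2 * even_sum t) NW @ replicate (odd_sum t) West)
     - dents (endpoint (zigzag (even_sum t))) t"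

definition Q :: "nat list \<Rightarrow> real" where
  "Q t = real (card (tilings (Q_region t)))"

definition K_zigzag :: "nat list \<Rightarrow> direction list" where
  "K_zigzag t = zigzag (even_sum t - 1) @ [SW]"

definition K_region :: "nat list \<Rightarrow> triangle set" where
  "K_region t =
     polygon (K_zigzag t @ replicate (even_sum t + odd_sum t) East
       @ replicate (2 * even_sum t - 1) NW @ replicate (odd_sum t) West)
     - dents (endpoint (K_zigzag t)) t"

text \<open>For \<open>even_sum t \<ge> 1\<close> only.\<close>

definition K' :: "nat list \<Rightarrow> real" where
  "K' t = weighted_count (half_weight (edges (K_zigzag t))) (K_region t)"

definition H5_upper_zigzag :: "nat \<Rightarrow> nat list \<Rightarrow> direction list" where
  "H5_upper_zigzag y a = zigzag (y + odd_sum a) @ [SW]"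

definition H5_polygon :: "nat \<Rightarrow> nat \<Rightarrow> nat \<Rightarrow> nat list \<Rightarrow> triangle set" where
  "H5_polygon x y z a =
     polygon (H5_upper_zigzag y a @ [East] @ zigzag (z + even_sum a)
       @ replicate (x + odd_sum a) East
       @ replicate (y + z + 2 * even_sum a) NE
       @ replicate (y + z + 2 * odd_sum a + 1) NW
       @ replicate (x + even_sum a) West)"

text \<open>The set removed from the polygon, for a non-empty sequence \<open>a\<close>; \<open>W\<close> is the point where the
  marking of the horizontal line begins, and \<open>t\<close> lists the lengths of the marked segments.\<close>

definition H5_removed :: "nat \<Rightarrow> nat list \<Rightarrow> triangle set" where
  "H5_removed y a =
     (let W = endpoint (H5_upper_zigzag y a);
          t = (hd a + 1) # tl a
      in left_part (shift_east (entry t 1) W)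
         \<union> (\<Union>i\<in>{i. i \<in> {3..length t} \<and> odd i}.
               up_triangle (shift_east (s_sum (i - 1) t) W) (entry t i))
         \<union> (\<Union>i\<in>{i. i \<in> {1..length t} \<and> even i}.
               down_triangle (shift_east (s_sum (i - 1) t) W) (entry t i)))"

definition H5 :: "nat \<Rightarrow> nat \<Rightarrow> nat \<Rightarrow> nat list \<Rightarrow> triangle set" where
  "H5 x y z a = H5_polygon x y z a - H5_removed y a"

definition M_H5 :: "nat \<Rightarrow> nat \<Rightarrow> nat \<Rightarrow> nat list \<Rightarrow> real" where
  "M_H5 x y z a = weighted_count (half_weight (edges (H5_upper_zigzag y a))) (H5 x y z a)"


section \<open>Products\<close>

text \<open>\<open>rising u n\<close> and \<open>rising2 u n\<close> are the symbols \<open>(u)\<^sub>n\<close> and \<open>[u]\<^sub>n\<close>.\<close>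

definition rising :: "real \<Rightarrow> int \<Rightarrow> real" where
  "rising u n = (if n \<ge> 0 then pochhammer u (nat n)
                 else 1 / (\<Prod>i = 1..nat (- n). u - real i))"

definition rising2 :: "real \<Rightarrow> int \<Rightarrow> real" where
  "rising2 u n = (if n \<ge> 0 then (\<Prod>i<nat n. u + 2 * real i)
                  else 1 / (\<Prod>i = 1..nat (- n). u - 2 * real i))"

definition T :: "nat \<Rightarrow> int \<Rightarrow> nat \<Rightarrow> real" where
  "T u n m = (\<Prod>i<m. rising (real u + real i) (n - 2 * int i))"

definition V :: "nat \<Rightarrow> int \<Rightarrow> nat \<Rightarrow> real" where
  "V u n m = (\<Prod>i<m. rising2 (real u + 2 * real i) (n - 2 * int i))"

end

theory Submission
  imports Defs "Jordan_Normal_Form.Determinant"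
begin

text \<open>
  A lozenge tiling is determined by the positions of its vertical lozenges. Consider a trapezoid whose
  western side is a zigzag, whose other side has the direction northwest, and which has unit dents at
  some positions on its bottom line. From one row to the next, the vertical lozenges interlace. If the
  rows are removed one after the other, the sums over interlacing sequences can be evaluated, since a
  Vandermonde determinant in the squares of the positions can be written with polynomials that are
  central differences of each other (\<open>interlacing_sum_down\<close>, \<open>interlacing_sum_up\<close>). The weight \<open>1/2\<close> along
  the zigzag is what makes the sums telescope up to the boundary. Thus the tiling number is a constant times
  \<open>\<Prod>(t\<^sup>2 - s\<^sup>2)\<close>, where \<open>s < t\<close> run over the positions of the dents; in the unweighted case the product of the
  positions is an additional factor (\<open>strip_up\<close>, \<open>strip_low\<close>).

  All regions of the theorem reduce to such trapezoids, because a triangle can be removed from a region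
  by removing the up-pointing unit triangles of its bottom row: the lozenges in the rest are forced
  (\<open>mw_forced\<close>). For \<open>P\<close>, \<open>P'\<close>, \<open>Q\<close> and \<open>K'\<close> this gives product formulas. The region \<open>H5\<close> is cut along the
  horizontal line that carries the marked segments, and \<open>M_H5\<close> becomes a sum, over the set \<open>S\<close> of the
  positions at which vertical lozenges cross the line, of a product of two dented trapezoids
  (\<open>M_H5_formula\<close>). Each position on a marked segment is a dent of exactly one of the trapezoids. Hence
  their interactions with \<open>S\<close> multiply to a product over all these positions, and the sum over \<open>S\<close>
  depends on the sequence through its total length only (\<open>M_H5_factored\<close>).

  The second formula follows: in the quotient of \<open>M_H5\<close> for the sequence and for the pair of its odd and
  even sums the sum over \<open>S\<close> cancels. The remaining products are, up to the interaction of the segments with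
  the ends of the line, the products for \<open>K'\<close>, \<open>Q\<close>, \<open>P'\<close> and \<open>P\<close>, and these interactions telescope to the
  products \<open>T\<close> (\<open>facprod_oddpos\<close>, \<open>second_formula\<close>).

  For the first formula the sum over \<open>S\<close> has to be evaluated. By Andreief's identity it is a determinant of
  sums over one position, which have closed forms (\<open>racah1_formula\<close>), and the determinant is one of
  binomial coefficients (\<open>common_sum_formula\<close>). Then both sides of the formula change by the same rational
  factor when \<open>x\<close> is replaced by \<open>x + 1\<close> (\<open>M_H5_growth\<close>, \<open>variable_part_growth\<close>), and for \<open>x = 0\<close> only one
  set \<open>S\<close> is possible.
\<close>

section \<open>Weighted coverings of finite sets\<close>

text \<open>Tilings are partitions into blocks that satisfy a predicate \<open>E\<close>; here \<open>E\<close> is arbitrary, so that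
  tilings can be transported to another encoding of the triangles. The number \<open>msum E w R\<close> is the sum
  of the weights of all such partitions of \<open>R\<close>.\<close>

definition covers :: "('a set \<Rightarrow> bool) \<Rightarrow> 'a set \<Rightarrow> 'a set set set" where
  "covers E R = {C. partition_on R C \<and> (\<forall>l\<in>C. E l)}"

definition msum :: "('a set \<Rightarrow> bool) \<Rightarrow> ('a set \<Rightarrow> real) \<Rightarrow> 'a set \<Rightarrow> real" where
  "msum E w R = (\<Sum>C\<in>covers E R. \<Prod>l\<in>C. w l)"

lemma finite_covers: "finite R \<Longrightarrow> finite (covers E R)"
  by (rule finite_subset[of _ "Pow (Pow R)"]) (auto simp: covers_def partition_on_def)

lemma covers_subset: "C \<in> covers E R \<Longrightarrow> l \<in> C \<Longrightarrow> l \<subseteq> R"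
  by (auto simp: covers_def partition_on_def)

lemma covers_finite: "finite R \<Longrightarrow> C \<in> covers E R \<Longrightarrow> finite C"
  by (auto simp: covers_def intro: finite_elements)

lemma msum_empty [simp]: "msum E w {} = 1"
proof -
  have "covers E {} = {{}}" by (auto simp: covers_def partition_on_def)
  then show ?thesis by (simp add: msum_def)
qed

lemma covers_image:
  assumes "inj_on f R" and E: "\<And>l. l \<subseteq> R \<Longrightarrow> E' (f ` l) \<longleftrightarrow> E l" and C: "C \<in> covers E R"
  shows "(`) f ` C \<in> covers E' (f ` R)"
proof -
  have "partition_on (f ` R) ((`) f ` C)"
  proof (rule partition_onI)
    show "\<Union> ((`) f ` C) = f ` R" using C by (auto simp: covers_def partition_on_def)
    show "{} \<notin> (`) f ` C" using C by (auto simp: covers_def partition_on_def)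
  next
    fix p p' assume p: "p \<in> (`) f ` C" "p' \<in> (`) f ` C" "p \<noteq> p'"
    then obtain l l' where l: "l \<in> C" "l' \<in> C" "p = f ` l" "p' = f ` l'" by auto
    then have "l \<noteq> l'" using p(3) by auto
    then have "l \<inter> l' = {}" using C l(1,2) by (auto simp: covers_def partition_on_def disjoint_def)
    then show "disjnt p p'"
      using l covers_subset[OF C] inj_on_image_Int[OF assms(1), of l l'] by (auto simp: disjnt_def)
  qed
  moreover have "\<forall>l\<in>(`) f ` C. E' l" using C E covers_subset[OF C] by (auto simp: covers_def)
  ultimately show ?thesis by (simp add: covers_def)
qed

lemma msum_transport:
  assumes inj: "inj_on f R" and E: "\<And>l. l \<subseteq> R \<Longrightarrow> E' (f ` l) \<longleftrightarrow> E l"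
    and w: "\<And>l. l \<subseteq> R \<Longrightarrow> E l \<Longrightarrow> w' (f ` l) = w l"
  shows "msum E' w' (f ` R) = msum E w R"
proof -
  let ?g = "inv_into R f"
  have injg: "inj_on ?g (f ` R)" by (simp add: inj_on_inv_into)
  have fg: "f ` (?g ` l) = l" if "l \<subseteq> f ` R" for l using that by (simp add: image_image f_inv_into_f subset_iff cong: image_cong)
  have gf: "?g ` (f ` l) = l" if "l \<subseteq> R" for l using that inj by (simp add: image_image subset_iff cong: image_cong)
  have gR: "?g ` f ` R = R" using gf by auto
  have E2: "E (?g ` l) \<longleftrightarrow> E' l" if "l \<subseteq> f ` R" for l
  proof -
    have "?g ` l \<subseteq> R" using that gR by (metis image_mono)
    then show ?thesis using E[of "?g ` l"] fg[OF that] by simp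
  qed
  have fgC: "(`) f ` (`) ?g ` C = C" if "C \<in> covers E' (f ` R)" for C
    using covers_subset[OF that] fg by (force simp: image_image)
  have gfC: "(`) ?g ` (`) f ` C = C" if "C \<in> covers E R" for C
    using covers_subset[OF that] gf by (force simp: image_image)
  show ?thesis unfolding msum_def
  proof (rule sum.reindex_bij_witness[where i = "\<lambda>C. (`) f ` C" and j = "\<lambda>C. (`) ?g ` C"])
    fix C assume C: "C \<in> covers E' (f ` R)"
    show "(`) f ` (`) ?g ` C = C" by (rule fgC[OF C])
    show gC: "(`) ?g ` C \<in> covers E R" using covers_image[OF injg E2 C] gR by simp
    have "prod w ((`) ?g ` C) = prod (\<lambda>l. w (?g ` l)) C"
    proof (rule prod.reindex_cong[OF _ refl refl])
      show "inj_on ((`) ?g) C"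
        by (rule inj_onI) (metis covers_subset[OF C] fg)
    qed
    also have "\<dots> = prod w' C"
    proof (rule prod.cong[OF refl])
      fix l assume l: "l \<in> C"
      then have lR: "l \<subseteq> f ` R" by (rule covers_subset[OF C])
      have "?g ` l \<subseteq> R" using lR gR by (metis image_mono)
      moreover have "E (?g ` l)" using E2[OF lR] l C by (auto simp: covers_def)
      ultimately show "w (?g ` l) = w' l" using w[of "?g ` l"] fg[OF lR] by simp
    qed
    finally show "(\<Prod>l\<in>(`) ?g ` C. w l) = prod w' C" .
  next
    fix C assume C: "C \<in> covers E R"
    show "(`) ?g ` (`) f ` C = C" by (rule gfC[OF C])
    show "(`) f ` C \<in> covers E' (f ` R)" by (rule covers_image[OF inj E C])
  qed
qed

text \<open>A covering of \<open>A \<union> B\<close> consists of its blocks that meet both parts, of a covering of the rest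
  of \<open>A\<close>, and of a covering of the rest of \<open>B\<close>.\<close>

lemma msum_split:
  fixes A B :: "'a set" and E :: "'a set \<Rightarrow> bool"
  assumes fin: "finite (A \<union> B)" and AB: "A \<inter> B = {}"
  defines "X \<equiv> {l. E l \<and> l \<subseteq> A \<union> B \<and> l \<inter> A \<noteq> {} \<and> l \<inter> B \<noteq> {}}"
  shows "msum E w (A \<union> B) =
    (\<Sum>S\<in>{S. S \<subseteq> X \<and> disjoint S}. (\<Prod>l\<in>S. w l) * (msum E w (A - \<Union>S) * msum E w (B - \<Union>S)))"
proof -
  let ?I = "{S. S \<subseteq> X \<and> disjoint S}"
  have finA: "finite A" and finB: "finite B" using fin by auto
  have finX: "finite X" by (rule finite_subset[of _ "Pow (A \<union> B)"]) (auto simp: X_def finA finB)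
  have finI: "finite ?I" by (rule finite_subset[of _ "Pow X"]) (auto simp: finX)
  let ?D = "SIGMA S:?I. covers E (A - \<Union>S) \<times> covers E (B - \<Union>S)"
  have "(\<Sum>S\<in>?I. (\<Prod>l\<in>S. w l) * (msum E w (A - \<Union>S) * msum E w (B - \<Union>S)))
      = (\<Sum>S\<in>?I. \<Sum>(C1, C2)\<in>covers E (A - \<Union>S) \<times> covers E (B - \<Union>S).
           prod w S * (prod w C1 * prod w C2))"
    unfolding msum_def sum_product unfolding sum.cartesian_product
    by (simp add: sum_distrib_left case_prod_unfold)
  also have "\<dots> = (\<Sum>(S, C1, C2)\<in>?D. prod w S * (prod w C1 * prod w C2))"
    using finA finB by (subst sum.Sigma) (auto simp: finI finA finB intro!: finite_covers finite_cartesian_product)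
  also have "\<dots> = msum E w (A \<union> B)" unfolding msum_def
  proof (rule sym, rule sum.reindex_bij_witness[where i = "\<lambda>(S, C1, C2). S \<union> C1 \<union> C2"
        and j = "\<lambda>C. (C \<inter> X, {l\<in>C. l \<subseteq> A}, {l\<in>C. l \<subseteq> B})"])
    fix C assume C: "C \<in> covers E (A \<union> B)"
    have ne: "{} \<notin> C" and dj: "disjoint C" and un: "\<Union>C = A \<union> B" and CE: "\<forall>l\<in>C. E l"
      using C by (auto simp: covers_def partition_on_def)
    have cases: "l \<in> X \<or> l \<subseteq> A \<or> l \<subseteq> B" if "l \<in> C" for l
      using that un CE by (auto simp: X_def)
    have eq: "C \<inter> X \<union> {l\<in>C. l \<subseteq> A} \<union> {l\<in>C. l \<subseteq> B} = C" using cases by auto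
    show "(case (C \<inter> X, {l\<in>C. l \<subseteq> A}, {l\<in>C. l \<subseteq> B}) of (S, C1, C2) \<Rightarrow> S \<union> C1 \<union> C2) = C"
      using eq by simp
    have d1: "\<Union>{l\<in>C. l \<subseteq> A} = A - \<Union>(C \<inter> X)"
    proof (intro equalityI subsetI)
      fix v assume "v \<in> \<Union>{l\<in>C. l \<subseteq> A}"
      then obtain l where l: "l \<in> C" "l \<subseteq> A" "v \<in> l" by auto
      have "v \<notin> l'" if "l' \<in> C \<inter> X" for l'
      proof
        assume "v \<in> l'"
        then have "l' = l" using dj l that by (auto simp: disjoint_def)
        then show False using that l AB by (auto simp: X_def)
      qed
      then show "v \<in> A - \<Union>(C \<inter> X)" using l by auto
    next
      fix v assume v: "v \<in> A - \<Union>(C \<inter> X)"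
      then obtain l where l: "l \<in> C" "v \<in> l" using un by blast
      then have "l \<notin> X" using v by auto
      then have "l \<subseteq> A" using cases[OF l(1)] v l AB by auto
      then show "v \<in> \<Union>{l\<in>C. l \<subseteq> A}" using l by auto
    qed
    have d2: "\<Union>{l\<in>C. l \<subseteq> B} = B - \<Union>(C \<inter> X)"
    proof (intro equalityI subsetI)
      fix v assume "v \<in> \<Union>{l\<in>C. l \<subseteq> B}"
      then obtain l where l: "l \<in> C" "l \<subseteq> B" "v \<in> l" by auto
      have "v \<notin> l'" if "l' \<in> C \<inter> X" for l'
      proof
        assume "v \<in> l'"
        then have "l' = l" using dj l that by (auto simp: disjoint_def)
        then show False using that l AB by (auto simp: X_def)
      qed
      then show "v \<in> B - \<Union>(C \<inter> X)" using l by auto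
    next
      fix v assume v: "v \<in> B - \<Union>(C \<inter> X)"
      then obtain l where l: "l \<in> C" "v \<in> l" using un by blast
      then have "l \<notin> X" using v by auto
      then have "l \<subseteq> B" using cases[OF l(1)] v l AB by auto
      then show "v \<in> \<Union>{l\<in>C. l \<subseteq> B}" using l by auto
    qed
    show "(C \<inter> X, {l\<in>C. l \<subseteq> A}, {l\<in>C. l \<subseteq> B}) \<in> ?D"
      using d1 d2 ne dj CE by (auto simp: covers_def partition_on_def disjoint_def)
    have finC: "finite C" using covers_finite[OF fin C] .
    have "prod w C = prod w (C \<inter> X \<union> {l\<in>C. l \<subseteq> A} \<union> {l\<in>C. l \<subseteq> B})" by (simp only: eq)
    also have "\<dots> = prod w (C \<inter> X) * prod w {l\<in>C. l \<subseteq> A} * prod w {l\<in>C. l \<subseteq> B}"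
    proof -
      have "(C \<inter> X \<union> {l\<in>C. l \<subseteq> A}) \<inter> {l\<in>C. l \<subseteq> B} = {}"
      proof -
        have "\<not> l \<subseteq> B" if "l \<in> C" "l \<subseteq> A" for l
          using that ne AB by (cases "l = {}") auto
        then show ?thesis using AB by (auto simp: X_def)
      qed
      moreover have "C \<inter> X \<inter> {l\<in>C. l \<subseteq> A} = {}" using AB by (auto simp: X_def)
      ultimately show ?thesis using finC by (simp add: prod.union_disjoint)
    qed
    finally show "(case (C \<inter> X, {l\<in>C. l \<subseteq> A}, {l\<in>C. l \<subseteq> B}) of
        (S, C1, C2) \<Rightarrow> prod w S * (prod w C1 * prod w C2)) = prod w C" by (simp add: mult.assoc)
  next
    fix p assume p: "p \<in> ?D"
    obtain S C1 C2 where pe: "p = (S, C1, C2)" by (cases p)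
    have S: "S \<subseteq> X" "disjoint S" and C1: "C1 \<in> covers E (A - \<Union>S)" and C2: "C2 \<in> covers E (B - \<Union>S)"
      using p pe by auto
    have C1': "\<Union>C1 = A - \<Union>S" "{} \<notin> C1" "disjoint C1" "\<forall>l\<in>C1. E l"
      and C2': "\<Union>C2 = B - \<Union>S" "{} \<notin> C2" "disjoint C2" "\<forall>l\<in>C2. E l"
      using C1 C2 by (auto simp: covers_def partition_on_def)
    have SX: "\<Union>S \<subseteq> A \<union> B" using S by (auto simp: X_def)
    have n1: "l \<subseteq> A \<and> l \<inter> B = {} \<and> l \<notin> X" if "l \<in> C1" for l
    proof -
      have "l \<subseteq> A" using C1'(1) that by auto
      then show ?thesis using AB by (auto simp: X_def)
    qed
    have n2: "l \<subseteq> B \<and> l \<inter> A = {} \<and> l \<notin> X" if "l \<in> C2" for l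
    proof -
      have "l \<subseteq> B" using C2'(1) that by auto
      then show ?thesis using AB by (auto simp: X_def)
    qed
    have e1: "(S \<union> C1 \<union> C2) \<inter> X = S" using n1 n2 S by auto
    have e2: "{l \<in> S \<union> C1 \<union> C2. l \<subseteq> A} = C1"
    proof (intro equalityI subsetI)
      fix l assume l: "l \<in> {l \<in> S \<union> C1 \<union> C2. l \<subseteq> A}"
      have "l \<notin> S" using l S(1) AB by (auto simp: X_def)
      moreover have "l \<notin> C2" using l n2[of l] C2'(2) by (cases "l = {}") auto
      ultimately show "l \<in> C1" using l by auto
    qed (use n1 in auto)
    have e3: "{l \<in> S \<union> C1 \<union> C2. l \<subseteq> B} = C2"
    proof (intro equalityI subsetI)
      fix l assume l: "l \<in> {l \<in> S \<union> C1 \<union> C2. l \<subseteq> B}"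
      have "l \<notin> S" using l S(1) AB by (auto simp: X_def)
      moreover have "l \<notin> C1" using l n1[of l] C1'(2) by (cases "l = {}") auto
      ultimately show "l \<in> C2" using l by auto
    qed (use n2 in auto)
    show "(\<lambda>C. (C \<inter> X, {l\<in>C. l \<subseteq> A}, {l\<in>C. l \<subseteq> B})) (case p of (S, C1, C2) \<Rightarrow> S \<union> C1 \<union> C2) = p"
      using e1 e2 e3 pe by simp
    have "partition_on (A \<union> B) (S \<union> C1 \<union> C2)"
    proof (rule partition_onI)
      show "\<Union> (S \<union> C1 \<union> C2) = A \<union> B" using C1' C2' SX by auto
      show "{} \<notin> S \<union> C1 \<union> C2" using C1' C2' S by (auto simp: X_def)
    next
      fix q q' assume q: "q \<in> S \<union> C1 \<union> C2" "q' \<in> S \<union> C1 \<union> C2" "q \<noteq> q'"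
      have x1: "l \<inter> \<Union>S = {}" if "l \<in> C1" for l using C1'(1) that by auto
      have x2: "l \<inter> \<Union>S = {}" if "l \<in> C2" for l using C2'(1) that by auto
      have x3: "l \<inter> l' = {}" if "l \<in> C1" "l' \<in> C2" for l l' using n1[OF that(1)] n2[OF that(2)] by auto
      have "q \<inter> q' = {}"
      proof (cases "q \<in> S"; cases "q' \<in> S")
        assume "q \<in> S" "q' \<in> S" then show ?thesis using S(2) q(3) by (auto simp: disjoint_def)
      next
        assume "q \<in> S" "q' \<notin> S" then show ?thesis using q x1[of q'] x2[of q'] by auto
      next
        assume "q \<notin> S" "q' \<in> S" then show ?thesis using q x1[of q] x2[of q] by auto
      next
        assume "q \<notin> S" "q' \<notin> S"
        then consider "q \<in> C1" "q' \<in> C1" | "q \<in> C2" "q' \<in> C2"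
          | "q \<in> C1" "q' \<in> C2" | "q \<in> C2" "q' \<in> C1" using q by auto
        then show ?thesis
        proof cases
          case 1 then show ?thesis using C1'(3) q(3) by (simp add: disjoint_def)
        next
          case 2 then show ?thesis using C2'(3) q(3) by (simp add: disjoint_def)
        next
          case 3 then show ?thesis using x3 by simp
        next
          case 4 then show ?thesis using x3[of q' q] by auto
        qed
      qed
      then show "disjnt q q'" by (simp add: disjnt_def)
    qed
    then show "(case p of (S, C1, C2) \<Rightarrow> S \<union> C1 \<union> C2) \<in> covers E (A \<union> B)"
      using S C1' C2' pe by (auto simp: covers_def X_def)
  qed
  finally show ?thesis by simp
qed

lemma msum_disjoint_union:
  assumes "finite (A \<union> B)" "A \<inter> B = {}"
    and "\<And>l. E l \<Longrightarrow> l \<subseteq> A \<union> B \<Longrightarrow> l \<inter> A = {} \<or> l \<inter> B = {}"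
  shows "msum E w (A \<union> B) = msum E w A * msum E w B"
proof -
  have *: "{l. E l \<and> l \<subseteq> A \<union> B \<and> l \<inter> A \<noteq> {} \<and> l \<inter> B \<noteq> {}} = {}" using assms(3) by blast
  have "{S. S \<subseteq> ({} :: 'a set set) \<and> disjoint S} = {{}}" by (auto simp: disjoint_def)
  then show ?thesis using msum_split[OF assms(1,2), of E w] unfolding * by simp
qed

text \<open>An element that lies in only one admissible block forces this block.\<close>

lemma msum_forced:
  assumes fin: "finite R" and v: "v \<in> l0" "l0 \<subseteq> R" "E l0"
    and uniq: "\<And>l. E l \<Longrightarrow> l \<subseteq> R \<Longrightarrow> v \<in> l \<Longrightarrow> l = l0"
  shows "msum E w R = w l0 * msum E w (R - l0)"
  unfolding msum_def sum_distrib_left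
proof (rule sum.reindex_bij_witness[where i = "insert l0" and j = "\<lambda>C. C - {l0}"])
  fix C assume C: "C \<in> covers E R"
  then obtain l where l: "l \<in> C" "v \<in> l" using v by (fastforce simp: covers_def partition_on_def)
  have l0: "l0 \<in> C" using uniq[of l] l C covers_subset[OF C l(1)] by (auto simp: covers_def)
  show "insert l0 (C - {l0}) = C" using l0 by auto
  have dj: "l \<inter> l0 = {}" if "l \<in> C - {l0}" for l
    using C that l0 by (auto simp: covers_def partition_on_def disjoint_def)
  have "\<Union>(C - {l0}) = R - l0"
    using C l0 dj by (fastforce simp: covers_def partition_on_def)
  then show "C - {l0} \<in> covers E (R - l0)"
    using C by (auto simp: covers_def partition_on_def disjoint_def)
  show "w l0 * prod w (C - {l0}) = prod w C"
    using l0 covers_finite[OF fin C] by (simp add: prod.remove)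
next
  fix C assume C: "C \<in> covers E (R - l0)"
  have n: "l0 \<notin> C" using covers_subset[OF C, of l0] v by auto
  then show "insert l0 C - {l0} = C" by auto
  have "disjnt l l0" if "l \<in> C" for l using covers_subset[OF C that] by (auto simp: disjnt_def)
  then show "insert l0 C \<in> covers E R"
    using C v by (auto simp: covers_def partition_on_def disjoint_def disjnt_def)
qed

section \<open>The brick lattice\<close>

text \<open>A unit triangle is encoded by the cell \<open>(j, X)\<close>, where \<open>j\<close> is its level and \<open>X\<close> is twice the
  horizontal coordinate of its centre. The cell points up iff \<open>X + j\<close> is odd. The admissible
  blocks, called bonds, are the pairs of neighbours in a row, and the pairs that form a vertical
  lozenge.\<close>

definition bond :: "(int \<times> int) set \<Rightarrow> bool" where
  "bond l \<longleftrightarrow> (\<exists>j X. l = {(j, X), (j, X + 1)} \<or> odd (X + j) \<and> l = {(j - 1, X), (j, X)})"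

text \<open>Vertical lozenges centred in column \<open>0\<close> have weight \<open>1/2\<close>. In all regions below, column \<open>0\<close>
  is the first column next to a weighted zigzag.\<close>

definition bw :: "(int \<times> int) set \<Rightarrow> real" where
  "bw l = (if \<exists>j. l = {(j - 1, 0), (j, 0)} then 1 / 2 else 1)"

definition colw :: "int \<Rightarrow> real" where
  "colw X = (if X = 0 then 1 / 2 else 1)"

text \<open>The weighted number of coverings of a set of cells by bonds.\<close>

definition mw :: "(int \<times> int) set \<Rightarrow> real" where
  "mw = msum bond bw"

lemma bw_horizontal [simp]: "bw {(j, X), (j, X + 1)} = 1"
  by (auto simp: bw_def doubleton_eq_iff)

lemma bw_vertical [simp]: "bw {(j - 1, X), (j, X)} = colw X"
  by (auto simp: bw_def colw_def doubleton_eq_iff)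

lemma bond_cases [consumes 1, case_names horizontal vertical]:
  assumes "bond l"
  obtains j X where "l = {(j, X), (j, X + 1)}"
    | j X where "odd (X + j)" "l = {(j - 1, X), (j, X)}"
  using assms unfolding bond_def by blast

lemma bond_row:
  assumes "bond l" "l \<subseteq> {j} \<times> I"
  obtains X where "l = {(j, X), (j, X + 1)}" "X \<in> I" "X + 1 \<in> I"
  using assms(1)
proof (cases rule: bond_cases)
  case (horizontal i X)
  then show ?thesis using assms(2) that[of X] by simp
next
  case (vertical i X)
  then have "i - 1 = j" "i = j" using assms(2) by auto
  then show ?thesis by simp
qed

lemma mw_empty [simp]: "mw {} = 1"
  by (simp add: mw_def)

text \<open>Cutting above row \<open>j - 1\<close>: the sum runs over the columns of the vertical bonds that cross the
  cut.\<close>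

lemma mw_cut:
  assumes fin: "finite R"
  shows "mw R = (\<Sum>D\<in>Pow {X. (j, X) \<in> R \<and> (j - 1, X) \<in> R \<and> odd (X + j)}.
    (\<Prod>X\<in>D. colw X) * (mw ({v\<in>R. j \<le> fst v} - {j} \<times> D) * mw ({v\<in>R. fst v < j} - {j - 1} \<times> D)))"
proof -
  let ?A = "{v\<in>R. j \<le> fst v}" and ?B = "{v\<in>R. fst v < j}"
  let ?C = "{X. (j, X) \<in> R \<and> (j - 1, X) \<in> R \<and> odd (X + j)}"
  let ?g = "\<lambda>X. {(j - 1, X), (j, X)}"
  have R: "R = ?A \<union> ?B" by auto
  have X: "{l. bond l \<and> l \<subseteq> ?A \<union> ?B \<and> l \<inter> ?A \<noteq> {} \<and> l \<inter> ?B \<noteq> {}} = ?g ` ?C" (is "?L = _")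
  proof (intro equalityI subsetI)
    fix l assume "l \<in> ?L"
    then have l: "bond l" "l \<subseteq> R" "l \<inter> ?A \<noteq> {}" "l \<inter> ?B \<noteq> {}" by auto
    from l(1) show "l \<in> ?g ` ?C"
    proof (cases rule: bond_cases)
      case (horizontal i X)
      then show ?thesis using l(3,4) by auto
    next
      case (vertical i X)
      have "i = j" using l(3,4) unfolding vertical(2) by auto
      then have "X \<in> ?C" using vertical l(2) by simp
      then show ?thesis using vertical(2) \<open>i = j\<close> by blast
    qed
  next
    fix l assume "l \<in> ?g ` ?C"
    then obtain X where X: "X \<in> ?C" "l = ?g X" by blast
    then have "bond l" unfolding bond_def by blast
    then show "l \<in> ?L" using X by simp
  qed
  have inj: "inj ?g" by (auto simp: inj_on_def doubleton_eq_iff)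
  have dj: "disjoint (range ?g)" by (auto simp: disjoint_def)
  have un: "?A - \<Union>(?g ` D) = ?A - {j} \<times> D" "?B - \<Union>(?g ` D) = ?B - {j - 1} \<times> D" for D
    by auto
  have "mw R = (\<Sum>S\<in>{S. S \<subseteq> ?g ` ?C \<and> disjoint S}. (\<Prod>l\<in>S. bw l) * (mw (?A - \<Union>S) * mw (?B - \<Union>S)))"
    unfolding mw_def
    by (subst (1) R, subst msum_split) (use fin in \<open>auto simp: X simp del: Un_iff\<close>)
  also have "\<dots> = (\<Sum>D\<in>Pow ?C. (\<Prod>l\<in>?g ` D. bw l) * (mw (?A - \<Union>(?g ` D)) * mw (?B - \<Union>(?g ` D))))"
  proof (rule sum.reindex_cong[of "image ?g", OF _ _ refl])
    show "inj_on ((`) ?g) (Pow ?C)" by (rule inj_on_image_Pow[OF inj_on_subset[OF inj]]) simp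
    show "{S. S \<subseteq> ?g ` ?C \<and> disjoint S} = (`) ?g ` Pow ?C"
    proof -
      have "{S. S \<subseteq> ?g ` ?C \<and> disjoint S} = Pow (?g ` ?C)"
      proof (rule Set.set_eqI)
        fix S
        have "disjoint S" if "S \<subseteq> ?g ` ?C"
          using that by (intro pairwise_subset[OF dj] subset_trans[OF that] image_mono) simp
        then show "S \<in> {S. S \<subseteq> ?g ` ?C \<and> disjoint S} \<longleftrightarrow> S \<in> Pow (?g ` ?C)"
          by (simp only: mem_Collect_eq Pow_iff) blast
      qed
      then show ?thesis by (simp only: image_Pow_surj)
    qed
  qed
  also have "\<dots> = (\<Sum>D\<in>Pow ?C. (\<Prod>X\<in>D. colw X) * (mw (?A - {j} \<times> D) * mw (?B - {j - 1} \<times> D)))"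
    by (intro sum.cong refl)
      (simp only: un, subst prod.reindex[OF inj_on_subset[OF inj]], auto)
  finally show ?thesis .
qed

lemma mw_row_split:
  assumes "finite I" "x \<notin> I"
  shows "mw ({j} \<times> I) = mw ({j} \<times> {y\<in>I. y < x}) * mw ({j} \<times> {y\<in>I. x < y})"
proof -
  have e: "{j} \<times> I = {j} \<times> {y\<in>I. y < x} \<union> {j} \<times> {y\<in>I. x < y}"
    using assms(2) by (auto simp: set_eq_iff) (metis linorder_neqE)
  show ?thesis unfolding mw_def
  proof (subst e, rule msum_disjoint_union)
    show "finite ({j} \<times> {y\<in>I. y < x} \<union> {j} \<times> {y\<in>I. x < y})" using assms by auto
    show "{j} \<times> {y\<in>I. y < x} \<inter> {j} \<times> {y\<in>I. x < y} = {}" by auto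
    fix l assume b: "bond l" and "l \<subseteq> {j} \<times> {y\<in>I. y < x} \<union> {j} \<times> {y\<in>I. x < y}"
    then have s: "l \<subseteq> {j} \<times> I" using e by simp
    from b s obtain Y where l: "l = {(j, Y), (j, Y + 1)}" "Y \<in> I" "Y + 1 \<in> I"
      by (rule bond_row)
    then show "l \<inter> {j} \<times> {y\<in>I. y < x} = {} \<or> l \<inter> {j} \<times> {y\<in>I. x < y} = {}"
      by (cases "Y < x") (use assms in auto)
  qed
qed

lemma mw_row_even: "mw ({j} \<times> {l..<l + 2 * int k}) = 1"
proof (induction k arbitrary: l)
  case (Suc k)
  have "mw ({j} \<times> {l..<l + 2 * int (Suc k)})
      = bw {(j, l), (j, l + 1)} * mw ({j} \<times> {l..<l + 2 * int (Suc k)} - {(j, l), (j, l + 1)})"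
    unfolding mw_def
  proof (rule msum_forced[of _ "(j, l)"])
    fix b assume b: "bond b" "b \<subseteq> {j} \<times> {l..<l + 2 * int (Suc k)}" "(j, l) \<in> b"
    from b(1,2) obtain Y where "b = {(j, Y), (j, Y + 1)}" by (rule bond_row)
    then show "b = {(j, l), (j, l + 1)}" using b(2,3) by auto
  qed (auto simp: bond_def)
  also have "{j} \<times> {l..<l + 2 * int (Suc k)} - {(j, l), (j, l + 1)} = {j} \<times> {l + 2..<l + 2 + 2 * int k}"
    by auto
  finally show ?case using Suc by simp
qed simp

lemma mw_row_balance:
  assumes fin: "finite I" and ne: "(\<Sum>x\<in>I. if even x then 1 else - 1 :: int) \<noteq> 0"
  shows "mw ({j} \<times> I) = 0"
proof -
  have "covers bond ({j} \<times> I) = {}"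
  proof (rule ccontr)
    assume "covers bond ({j} \<times> I) \<noteq> {}"
    then obtain C where C: "C \<in> covers bond ({j} \<times> I)" by auto
    let ?s = "\<lambda>v :: int \<times> int. if even (snd v) then 1 else - 1 :: int"
    have un: "{j} \<times> I = \<Union>C" and dj: "disjoint C" using C by (auto simp: covers_def partition_on_def)
    have finC: "finite b" if "b \<in> C" for b
      using finite_subset[OF covers_subset[OF C that]] fin by auto
    have "(\<Sum>x\<in>I. if even x then 1 else - 1 :: int) = sum ?s ({j} \<times> I)"
      by (rule sum.reindex_bij_witness[of _ snd "Pair j"]) auto
    also have "\<dots> = sum (sum ?s) C"
      unfolding un
      by (rule sum.Union_disjoint[unfolded o_def])
        (use dj finC in \<open>auto simp: disjoint_def\<close>)
    also have "\<dots> = 0"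
    proof (rule sum.neutral, rule ballI)
      fix b assume bC: "b \<in> C"
      then have b: "bond b" "b \<subseteq> {j} \<times> I" using C covers_subset[OF C] by (auto simp: covers_def)
      from b obtain Y where "b = {(j, Y), (j, Y + 1)}" by (rule bond_row)
      then show "sum ?s b = 0" by auto
    qed
    finally show False using ne by simp
  qed
  then show ?thesis by (simp add: mw_def msum_def)
qed

lemma alternating_sum_interval:
  "(\<Sum>x\<in>{l..<l + int k}. if even x then 1 else - 1 :: int) = (if odd k then (if even l then 1 else - 1) else 0)"
proof (induction k)
  case (Suc k)
  have "{l..<l + int (Suc k)} = insert (l + int k) {l..<l + int k}" by auto
  then show ?case using Suc by simp
qed simp

lemma alternating_sum_removed:
  assumes D: "D \<subseteq> {l..<l + int k}" "\<And>x. x \<in> D \<Longrightarrow> even (x - l)"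
  shows "(\<Sum>x\<in>{l..<l + int k} - D. if even x then 1 else - 1 :: int)
    = (if even l then 1 else - 1) * ((if odd k then 1 else 0) - int (card D))"
proof -
  have fD: "finite D" using D(1) finite_subset by blast
  have "(\<Sum>x\<in>D. if even x then 1 else - 1 :: int) = (\<Sum>x\<in>D. if even l then 1 else - 1)"
    using D(2) by (intro sum.cong) auto
  then show ?thesis
    using sum_diff[OF _ D(1), of "\<lambda>x. if even x then 1 else - 1 :: int"] alternating_sum_interval[of l k]
    by (simp add: algebra_simps)
qed

text \<open>Between two consecutive removed up-pointing cells exactly one down-pointing cell has to be
  removed, and then the rest of the gap is covered in a unique way.\<close>

lemma mw_row_gap:
  assumes D: "D \<subseteq> {l..<r}" "\<And>x. x \<in> D \<Longrightarrow> even (x - l)" and r: "l \<le> r" "odd (r - l)"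
  shows "mw ({j} \<times> ({l..<r} - D)) = (if card D = 1 then 1 else 0)"
proof (cases "card D = 1")
  case True
  then obtain d where d: "D = {d}" by (rule card_1_singletonE)
  have dd: "l \<le> d" "d < r" "even (d - l)" using D d by auto
  have "mw ({j} \<times> ({l..<r} - D)) = mw ({j} \<times> {y\<in>{l..<r} - D. y < d}) * mw ({j} \<times> {y\<in>{l..<r} - D. d < y})"
    by (rule mw_row_split) (auto simp: d)
  also have "{y\<in>{l..<r} - D. y < d} = {l..<l + 2 * int (nat ((d - l) div 2))}" using dd d by auto
  also have "{y\<in>{l..<r} - D. d < y} = {d + 1..<d + 1 + 2 * int (nat ((r - d - 1) div 2))}"
  proof -
    have "even (r - d - 1)" using r dd by presburger
    then show ?thesis using dd d by auto
  qed
  finally show ?thesis using True by (simp only: mw_row_even) simp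
next
  case False
  have e: "r = l + int (nat (r - l))" using r by simp
  have o: "odd (nat (r - l))" using r by (simp add: even_nat_iff)
  have "mw ({j} \<times> ({l..<r} - D)) = 0"
    by (rule mw_row_balance)
      (use False o alternating_sum_removed[of D l "nat (r - l)"] D e in auto)
  then show ?thesis using False by simp
qed

lemma mw_row_tail:
  assumes D: "D \<subseteq> {l..<r}" "\<And>x. x \<in> D \<Longrightarrow> even (x - l)" and r: "l \<le> r" "even (r - l)"
  shows "mw ({j} \<times> ({l..<r} - D)) = (if D = {} then 1 else 0)"
proof (cases "D = {}")
  case True
  have "r = l + 2 * int (nat ((r - l) div 2))" using r by auto
  then show ?thesis using True mw_row_even[of j l "nat ((r - l) div 2)"] by simp
next
  case False
  have e: "r = l + int (nat (r - l))" using r by simp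
  have o: "even (nat (r - l))" using r by (simp add: even_nat_iff)
  have "finite D" using D(1) finite_subset by blast
  then have "mw ({j} \<times> ({l..<r} - D)) = 0"
    by (intro mw_row_balance)
      (use False o alternating_sum_removed[of D l "nat (r - l)"] D e in auto)
  then show ?thesis using False by simp
qed

text \<open>For columns \<open>u 0 < u 1 < \<dots>\<close> of removed up-pointing cells in a row that begins with the
  down-pointing cell in column \<open>c\<close>, \<open>gap c u i\<close> consists of the columns of the down-pointing cells
  between \<open>u (i - 1)\<close> and \<open>u i\<close>; for \<open>i = 0\<close> it begins at \<open>c\<close>.\<close>

definition gap :: "int \<Rightarrow> (nat \<Rightarrow> int) \<Rightarrow> nat \<Rightarrow> int set" where
  "gap c u i = {X. (if i = 0 then c else u (i - 1) + 1) \<le> X \<and> X < u i \<and> even (X - c)}"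

text \<open>The columns \<open>u 0 < \<dots> < u (m - 1)\<close> lie in \<open>{c..N}\<close> and have the parity opposite to \<open>c\<close>.\<close>

definition dent_seq :: "int \<Rightarrow> int \<Rightarrow> nat \<Rightarrow> (nat \<Rightarrow> int) \<Rightarrow> bool" where
  "dent_seq c N m u \<longleftrightarrow> (\<forall>i<m. c \<le> u i \<and> u i \<le> N \<and> odd (u i - c)) \<and> strict_mono_on {..<m} u"

lemma dent_seq_less: "dent_seq c N m u \<Longrightarrow> i < k \<Longrightarrow> k < m \<Longrightarrow> u i < u k"
  by (auto simp: dent_seq_def strict_mono_on_def)

lemma mw_row_prefix:
  assumes u: "dent_seq c N (Suc m) u" and D: "D \<subseteq> {c..N}" "\<And>x. x \<in> D \<Longrightarrow> even (x - c)"
  shows "mw ({j} \<times> ({c..<u m} - u ` {..<m} - D)) = (if \<forall>i\<le>m. card (D \<inter> gap c u i) = 1 then 1 else 0)"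
  using u
proof (induction m)
  case 0
  have "{c..<u 0} - u ` {..<0} - D = {c..<u 0} - D \<inter> gap c u 0"
    using D by (auto simp: gap_def)
  moreover have "mw ({j} \<times> ({c..<u 0} - D \<inter> gap c u 0)) = (if card (D \<inter> gap c u 0) = 1 then 1 else 0)"
    by (rule mw_row_gap) (use 0 in \<open>auto simp: gap_def dent_seq_def\<close>)
  ultimately show ?case by simp
next
  case (Suc m)
  note u = Suc.prems
  have u': "dent_seq c N (Suc m) u" using u by (auto simp: dent_seq_def strict_mono_on_def)
  have lt: "u i < u m" if "i < m" for i using dent_seq_less[OF u'] that by simp
  have um: "c \<le> u m" "u m < u (Suc m)" "odd (u m - c)" "odd (u (Suc m) - c)"
    using u dent_seq_less[OF u, of m "Suc m"] by (auto simp: dent_seq_def)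
  let ?I = "{c..<u (Suc m)} - u ` {..<Suc m} - D"
  have "mw ({j} \<times> ?I) = mw ({j} \<times> {y\<in>?I. y < u m}) * mw ({j} \<times> {y\<in>?I. u m < y})"
    by (rule mw_row_split) auto
  also have "{y\<in>?I. y < u m} = {c..<u m} - u ` {..<m} - D" using um by (auto simp: lessThan_Suc)
  also have "{y\<in>?I. u m < y} = {u m + 1..<u (Suc m)} - D \<inter> gap c u (Suc m)"
  proof -
    have "u k < u m" if "k < m" for k using lt that by simp
    then have nu: "y \<notin> u ` {..<Suc m}" if "u m < y" for y
      using that lt by (auto simp: less_Suc_eq) (metis order.asym)
    show ?thesis
    proof (rule Set.set_eqI)
      fix y show "y \<in> {y\<in>?I. u m < y} \<longleftrightarrow> y \<in> {u m + 1..<u (Suc m)} - D \<inter> gap c u (Suc m)"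
        using um nu[of y] D(2)[of y] by (auto simp: gap_def)
    qed
  qed
  also have "mw ({j} \<times> ({u m + 1..<u (Suc m)} - D \<inter> gap c u (Suc m)))
      = (if card (D \<inter> gap c u (Suc m)) = 1 then 1 else 0)"
  proof (rule mw_row_gap)
    fix x assume "x \<in> D \<inter> gap c u (Suc m)"
    then have "even (x - c)" by (auto simp: gap_def)
    then show "even (x - (u m + 1))" using um by presburger
  next
    show "odd (u (Suc m) - (u m + 1))" using um by presburger
  qed (use um in \<open>auto simp: gap_def\<close>)
  also have "mw ({j} \<times> ({c..<u m} - u ` {..<m} - D)) = (if \<forall>i\<le>m. card (D \<inter> gap c u i) = 1 then 1 else 0)"
    by (rule Suc.IH[OF u'])
  finally show ?case by (auto simp: le_Suc_eq)
qed

lemma mw_row: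
  assumes u: "dent_seq c N m u" and D: "D \<subseteq> {c..N}" "\<And>x. x \<in> D \<Longrightarrow> even (x - c)"
    and N: "odd (N - c)" "c \<le> N + 1"
  shows "mw ({j} \<times> ({c..N} - u ` {..<m} - D))
    = (if (\<forall>i<m. card (D \<inter> gap c u i) = 1) \<and> D \<subseteq> (\<Union>i<m. gap c u i) then 1 else 0)"
proof (cases m)
  case 0
  have "{c..N} - u ` {..<m} - D = {c..<N + 1} - D" using 0 by auto
  moreover have "mw ({j} \<times> ({c..<N + 1} - D)) = (if D = {} then 1 else 0)"
    by (rule mw_row_tail) (use D N in auto)
  ultimately show ?thesis using 0 by simp
next
  case (Suc k)
  have lt: "u i < u k" if "i < k" for i using dent_seq_less[OF u] that Suc by simp
  have uk: "c \<le> u k" "u k \<le> N" "odd (u k - c)" using u Suc by (auto simp: dent_seq_def)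
  let ?I = "{c..N} - u ` {..<m} - D"
  have nk: "u k \<notin> D" using D uk by auto
  have "mw ({j} \<times> ?I) = mw ({j} \<times> {y\<in>?I. y < u k}) * mw ({j} \<times> {y\<in>?I. u k < y})"
    by (rule mw_row_split) (auto simp: Suc)
  also have "{y\<in>?I. y < u k} = {c..<u k} - u ` {..<k} - D" using uk Suc by (auto simp: lessThan_Suc)
  also have "{y\<in>?I. u k < y} = {u k + 1..<N + 1} - {x\<in>D. u k < x}"
  proof -
    have nu: "y \<notin> u ` {..<Suc k}" if "u k < y" for y
      using that lt by (auto simp: less_Suc_eq) (metis order.asym)
    show ?thesis
    proof (rule Set.set_eqI)
      fix y show "y \<in> {y\<in>?I. u k < y} \<longleftrightarrow> y \<in> {u k + 1..<N + 1} - {x\<in>D. u k < x}"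
        using nu[of y] uk Suc by auto
    qed
  qed
  also have "mw ({j} \<times> ({u k + 1..<N + 1} - {x\<in>D. u k < x})) = (if {x\<in>D. u k < x} = {} then 1 else 0)"
  proof (rule mw_row_tail)
    fix x assume "x \<in> {x\<in>D. u k < x}"
    then have "even (x - c)" using D by auto
    then show "even (x - (u k + 1))" using uk by presburger
  next
    show "even (N + 1 - (u k + 1))" using uk N by presburger
  qed (use D uk in auto)
  also have "mw ({j} \<times> ({c..<u k} - u ` {..<k} - D)) = (if \<forall>i\<le>k. card (D \<inter> gap c u i) = 1 then 1 else 0)"
    by (rule mw_row_prefix) (use u D Suc in auto)
  also have "{x\<in>D. u k < x} = {} \<longleftrightarrow> D \<subseteq> (\<Union>i<m. gap c u i)"
  proof
    assume L: "{x\<in>D. u k < x} = {}"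
    show "D \<subseteq> (\<Union>i<m. gap c u i)"
    proof
      fix x assume x: "x \<in> D"
      have "\<not> u k < x" using x L by blast
      moreover have "x \<noteq> u k" using x nk by blast
      ultimately have xk: "x < u k" by simp
      define i where "i = (LEAST i. x < u i)"
      have i: "x < u i" "i \<le> k" unfolding i_def using xk by (auto intro: LeastI Least_le)
      have "u (i - 1) + 1 \<le> x" if "i \<noteq> 0"
      proof -
        have "\<not> x < u (i - 1)" using not_less_Least[of "i - 1" "\<lambda>i. x < u i"] that by (simp add: i_def)
        moreover have "x \<noteq> u (i - 1)" using D(2)[OF x] u Suc i(2) that by (auto simp: dent_seq_def)
        ultimately show ?thesis by simp
      qed
      then have "x \<in> gap c u i" using i x D by (auto simp: gap_def)
      then show "x \<in> (\<Union>i<m. gap c u i)" using i Suc by auto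
    qed
  next
    assume R: "D \<subseteq> (\<Union>i<m. gap c u i)"
    have "x < u k" if "x \<in> gap c u i" "i < m" for x i
      using that lt[of i] Suc by (cases "i = k") (auto simp: gap_def)
    then show "{x\<in>D. u k < x} = {}" using R by force
  qed
  finally show ?thesis using Suc by (auto simp: less_Suc_eq_le)
qed

text \<open>Subsets that meet each set of a disjoint family in exactly one point are given by choice
  functions.\<close>

lemma sum_transversals:
  fixes G :: "nat \<Rightarrow> int set" and h :: "int set \<Rightarrow> real"
  assumes fin: "finite C" and GC: "\<And>i. i < m \<Longrightarrow> G i \<subseteq> C"
    and dj: "\<And>i k. i < k \<Longrightarrow> k < m \<Longrightarrow> G i \<inter> G k = {}"
  shows "(\<Sum>D\<in>Pow C. (if (\<forall>i<m. card (D \<inter> G i) = 1) \<and> D \<subseteq> (\<Union>i<m. G i) then 1 else 0) * h D)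
    = (\<Sum>d\<in>PiE {..<m} G. h (d ` {..<m}))"
proof -
  let ?P = "\<lambda>D. (\<forall>i<m. card (D \<inter> G i) = 1) \<and> D \<subseteq> (\<Union>i<m. G i)"
  have dj': "G i \<inter> G k = {}" if "i \<noteq> k" "i < m" "k < m" for i k
    using that dj[of i k] dj[of k i] by (cases "i < k") auto
  have int: "d ` {..<m} \<inter> G i = {d i}" if "d \<in> PiE {..<m} G" "i < m" for d i
  proof -
    have m: "d k \<in> G k" if "k < m" for k using that \<open>d \<in> PiE {..<m} G\<close> by auto
    have "k = i" if "k < m" "d k \<in> G i" for k
      using dj'[of k i] m[of k] that \<open>i < m\<close> by blast
    then show ?thesis using m \<open>i < m\<close> by auto
  qed
  have "(\<Sum>D\<in>Pow C. (if ?P D then 1 else 0) * h D) = (\<Sum>D | D \<in> Pow C \<and> ?P D. h D)"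
    using fin by (intro sum.mono_neutral_cong_right) auto
  also have "\<dots> = (\<Sum>d\<in>PiE {..<m} G. h (d ` {..<m}))"
  proof (rule sum.reindex_bij_witness[where j = "\<lambda>D. \<lambda>i\<in>{..<m}. THE x. x \<in> D \<inter> G i" and i = "\<lambda>d. d ` {..<m}"])
    fix D assume "D \<in> {D. D \<in> Pow C \<and> ?P D}"
    then have D: "D \<subseteq> C" "\<And>i. i < m \<Longrightarrow> card (D \<inter> G i) = 1" "D \<subseteq> (\<Union>i<m. G i)" by auto
    let ?d = "\<lambda>i\<in>{..<m}. THE x. x \<in> D \<inter> G i"
    have d: "D \<inter> G i = {?d i}" if i: "i < m" for i
    proof -
      obtain x where "D \<inter> G i = {x}" using D(2)[OF i] card_1_singletonE by blast
      then have "(THE x. x \<in> D \<inter> G i) = x" by (simp only: singleton_iff the_eq_trivial)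
      then show ?thesis using i \<open>D \<inter> G i = {x}\<close> by (simp only: restrict_apply lessThan_iff if_True)
    qed
    show dD: "?d ` {..<m} = D"
    proof (intro equalityI subsetI)
      fix x assume "x \<in> ?d ` {..<m}"
      then obtain i where "i < m" "x = ?d i" by blast
      then show "x \<in> D" using d[of i] by blast
    next
      fix x assume "x \<in> D"
      then obtain i where i: "i < m" "x \<in> G i" using D(3) by blast
      then have "x = ?d i" using d[of i] \<open>x \<in> D\<close> by blast
      then show "x \<in> ?d ` {..<m}" using i by blast
    qed
    show "h (?d ` {..<m}) = h D" by (simp only: dD)
    show "?d \<in> PiE {..<m} G"
    proof (rule PiE_I)
      fix i assume "i \<in> {..<m}"
      then show "?d i \<in> G i" using d[of i] by blast
    qed auto
  next
    fix d assume d: "d \<in> PiE {..<m} G"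
    show "(\<lambda>i\<in>{..<m}. THE x. x \<in> d ` {..<m} \<inter> G i) = d"
      using d int[OF d] by (intro ext) (auto simp: PiE_def extensional_def)
    show "d ` {..<m} \<in> {D. D \<in> Pow C \<and> ?P D}"
      using d int[OF d] GC by (auto simp: PiE_def Pi_def)
  qed
  finally show ?thesis .
qed

lemma gap_disjoint: "dent_seq c N m u \<Longrightarrow> i < k \<Longrightarrow> k < m \<Longrightarrow> gap c u i \<inter> gap c u k = {}"
proof -
  assume u: "dent_seq c N m u" and ik: "i < k" "k < m"
  have "u i \<le> u (k - 1)"
  proof (cases "i = k - 1")
    case False
    then have "i < k - 1" "k - 1 < m" using ik by linarith+
    then show ?thesis using dent_seq_less[OF u] by force
  qed simp
  then show ?thesis using ik by (auto simp: gap_def)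
qed

lemma gap_subset: "dent_seq c N m u \<Longrightarrow> i < m \<Longrightarrow> gap c u i \<subseteq> {c..<N}"
  by (auto simp: gap_def dent_seq_def split: if_splits) (smt (verit) less_imp_diff_less)+

section \<open>Determinants and sums over interlacing sequences\<close>

text \<open>The determinant of a square matrix of size \<open>m\<close>, given by a function of the two indices, so that
  \<open>m\<close> can vary in inductions.\<close>

definition dt :: "nat \<Rightarrow> (nat \<Rightarrow> nat \<Rightarrow> real) \<Rightarrow> real" where
  "dt m f = det (mat m m (\<lambda>(i, k). f i k))"

text \<open>The Vandermonde product.\<close>

definition vdm :: "nat \<Rightarrow> (nat \<Rightarrow> real) \<Rightarrow> real" where
  "vdm m v = (\<Prod>i<m. \<Prod>k<i. v i - v k)"

lemma dt_expand: "dt m f = (\<Sum>p | p permutes {..<m}. signof p * (\<Prod>i<m. f i (p i)))"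
proof -
  have "dt m f = (\<Sum>p | p permutes {0..<m}. signof p * (\<Prod>i = 0..<m. mat m m (\<lambda>(i, k). f i k) $$ (i, p i)))"
    unfolding dt_def by (rule det_def') simp
  also have "\<dots> = (\<Sum>p | p permutes {0..<m}. signof p * (\<Prod>i = 0..<m. f i (p i)))"
    by (intro sum.cong refl arg_cong2[of _ _ _ _ "(*)"] prod.cong)
      (auto dest: permutes_in_image)
  finally show ?thesis by (simp add: lessThan_atLeast0)
qed

lemma dt_cong: "(\<And>i k. i < m \<Longrightarrow> k < m \<Longrightarrow> f i k = g i k) \<Longrightarrow> dt m f = dt m g"
  unfolding dt_def by (rule arg_cong[of _ _ det], rule eq_matI) auto

lemma dt_mult: "dt m (\<lambda>i k. \<Sum>l<m. f i l * g l k) = dt m f * dt m g"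
proof -
  have "mat m m (\<lambda>(i, k). \<Sum>l<m. f i l * g l k) = mat m m (\<lambda>(i, k). f i k) * mat m m (\<lambda>(i, k). g i k)"
    by (rule eq_matI) (auto simp: scalar_prod_def lessThan_atLeast0)
  then show ?thesis unfolding dt_def by (simp only:) (rule det_mult[where n = m], auto)
qed

lemma dt_upper:
  assumes "\<And>i k. k < i \<Longrightarrow> i < m \<Longrightarrow> f i k = 0"
  shows "dt m f = (\<Prod>i<m. f i i)"
proof -
  have "upper_triangular (mat m m (\<lambda>(i, k). f i k))" using assms by (auto simp: upper_triangular_def)
  then have "dt m f = prod_list (diag_mat (mat m m (\<lambda>(i, k). f i k)))"
    unfolding dt_def by (rule det_upper_triangular[where n = m]) simp
  also have "\<dots> = (\<Prod>i<m. f i i)"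
    by (simp add: diag_mat_def prod.list_conv_set_nth lessThan_atLeast0 prod.distinct_set_conv_list[symmetric])
  finally show ?thesis .
qed

lemma dt_lower:
  assumes "\<And>i k. i < k \<Longrightarrow> k < m \<Longrightarrow> f i k = 0"
  shows "dt m f = (\<Prod>i<m. f i i)"
proof -
  have "dt m f = prod_list (diag_mat (mat m m (\<lambda>(i, k). f i k)))"
    unfolding dt_def by (rule det_lower_triangular[where n = m]) (use assms in auto)
  also have "\<dots> = (\<Prod>i<m. f i i)"
    by (simp add: diag_mat_def prod.list_conv_set_nth lessThan_atLeast0 prod.distinct_set_conv_list[symmetric])
  finally show ?thesis .
qed

lemma dt_scale_rows: "dt m (\<lambda>i k. c i * f i k) = (\<Prod>i<m. c i) * dt m f"
  by (simp add: dt_expand prod.distrib sum_distrib_left mult_ac)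

lemma dt_scale_cols: "dt m (\<lambda>i k. c k * f i k) = (\<Prod>i<m. c i) * dt m f"
proof -
  have "(\<Prod>i<m. c (p i)) = (\<Prod>i<m. c i)" if "p permutes {..<m}" for p
    using prod.permute[OF that, of c] by (simp add: o_def)
  then show ?thesis
    by (simp add: dt_expand prod.distrib sum_distrib_left mult_ac)
qed

lemma dt_sum_rows:
  assumes "\<And>i. i < m \<Longrightarrow> finite (G i)"
  shows "(\<Sum>d\<in>PiE {..<m} G. dt m (\<lambda>i k. f i (d i) k)) = dt m (\<lambda>i k. \<Sum>x\<in>G i. f i x k)"
  unfolding dt_expand
  by (subst sum.swap, subst prod_sum_PiE) (use assms in \<open>auto simp: sum_distrib_left\<close>)

lemma dt_monic:
  assumes "\<And>k. k < m \<Longrightarrow> degree (p k) = k" "\<And>k. k < m \<Longrightarrow> coeff (p k) k = 1"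
  shows "dt m (\<lambda>i k. poly (p k) (v i)) = dt m (\<lambda>i k. v i ^ k)"
proof -
  have "poly (p k) x = (\<Sum>l<m. x ^ l * coeff (p k) l)" if "k < m" for k x
  proof -
    have "poly (p k) x = (\<Sum>l\<le>k. coeff (p k) l * x ^ l)" using assms(1)[OF that] by (simp add: poly_altdef)
    also have "\<dots> = (\<Sum>l<m. coeff (p k) l * x ^ l)"
      using that assms(1)[OF that] by (intro sum.mono_neutral_left) (auto simp: coeff_eq_0)
    finally show ?thesis by (simp add: mult_ac)
  qed
  then have "dt m (\<lambda>i k. poly (p k) (v i)) = dt m (\<lambda>i k. \<Sum>l<m. v i ^ l * coeff (p k) l)"
    by (intro dt_cong) simp
  also have "\<dots> = dt m (\<lambda>i k. v i ^ k) * dt m (\<lambda>l k. coeff (p k) l)" by (rule dt_mult)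
  also have "dt m (\<lambda>l k. coeff (p k) l) = 1"
    using assms by (subst dt_upper) (auto simp: coeff_eq_0)
  finally show ?thesis by simp
qed

lemma newton_poly:
  fixes a :: "nat \<Rightarrow> real"
  shows "degree (\<Prod>l<k. [:- a l, 1:]) = k \<and> coeff (\<Prod>l<k. [:- a l, 1:]) k = 1"
proof (induction k)
  case (Suc k)
  then have "(\<Prod>l<k. [:- a l, 1:]) \<noteq> 0" by auto
  then have d: "degree ([:- a k, 1:] * (\<Prod>l<k. [:- a l, 1:])) = Suc k"
    using Suc by (subst degree_mult_eq) auto
  have "lead_coeff ([:- a k, 1:] * (\<Prod>l<k. [:- a l, 1:])) = 1"
    unfolding lead_coeff_mult using Suc by simp
  then have "coeff ([:- a k, 1:] * (\<Prod>l<k. [:- a l, 1:])) (Suc k) = 1"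
    unfolding d .
  then show ?case using d by (simp only: prod.lessThan_Suc mult.commute)
qed simp

lemma dt_newton: "dt m (\<lambda>i k. \<Prod>l<k. v i - a l) = vdm m v"
proof -
  have e: "dt m (\<lambda>i k. \<Prod>l<k. v i - b l) = dt m (\<lambda>i k. v i ^ k)" for b
    using dt_monic[of m "\<lambda>k. \<Prod>l<k. [:- b l, 1:]" v] newton_poly[of b]
    by (simp add: poly_prod algebra_simps)
  \<comment> \<open>With the nodes \<open>v l\<close> themselves the matrix is triangular.\<close>
  have "dt m (\<lambda>i k. \<Prod>l<k. v i - v l) = vdm m v"
    unfolding vdm_def by (rule dt_lower) auto
  then show ?thesis using e[of a] e[of v] by simp
qed

lemma dt_row_differences:
  "dt m (\<lambda>i k. f i k - (if i = 0 then 0 else f (i - 1) k)) = dt m f"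
proof -
  let ?L = "\<lambda>i l. if l = i then 1 else if Suc l = i then - 1 else 0 :: real"
  have "(\<Sum>l<m. ?L i l * f l k) = f i k - (if i = 0 then 0 else f (i - 1) k)" if "i < m" for i k
  proof -
    have "(\<Sum>l<m. ?L i l * f l k) = (\<Sum>l<m. (if l = i then f l k else 0) + (if i \<noteq> 0 \<and> l = i - 1 then - f l k else 0))"
      by (intro sum.cong) auto
    also have "\<dots> = f i k + (if i \<noteq> 0 then - f (i - 1) k else 0)"
      using that by (simp add: sum.distrib)
    finally show ?thesis by simp
  qed
  then have "dt m (\<lambda>i k. f i k - (if i = 0 then 0 else f (i - 1) k)) = dt m (\<lambda>i k. \<Sum>l<m. ?L i l * f l k)"
    by (intro dt_cong) simp
  also have "\<dots> = dt m ?L * dt m f" by (rule dt_mult)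
  also have "dt m ?L = 1" by (subst dt_lower) auto
  finally show ?thesis by simp
qed

lemma dt_first_column:
  assumes "f 0 0 = 1" "\<And>i. i < m \<Longrightarrow> f (Suc i) 0 = 0"
  shows "dt (Suc m) f = dt m (\<lambda>i k. f (Suc i) (Suc k))"
proof -
  let ?A = "mat (Suc m) (Suc m) (\<lambda>(i, k). f i k)"
  have "det ?A = (\<Sum>i<Suc m. ?A $$ (i, 0) * cofactor ?A i 0)"
    by (rule laplace_expansion_column) auto
  also have "\<dots> = cofactor ?A 0 0" using assms by (subst sum.lessThan_Suc_shift) simp
  also have "\<dots> = det (mat_delete ?A 0 0)" by (simp add: cofactor_def)
  also have "mat_delete ?A 0 0 = mat m m (\<lambda>(i, k). f (Suc i) (Suc k))"
    by (rule eq_matI) (auto simp: mat_delete_def)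
  finally show ?thesis by (simp add: dt_def)
qed

text \<open>Two families of polynomials, even and odd, that are exchanged by the central difference
  operator: \<open>evp k x\<close> is the product of the \<open>2 k\<close> numbers \<open>x - 2 k + 1, x - 2 k + 3, \<dots>, x + 2 k - 1\<close>,
  and \<open>odp k x\<close> is the product of the \<open>2 k + 1\<close> numbers \<open>x - 2 k, x - 2 k + 2, \<dots>, x + 2 k\<close>.\<close>

definition evp :: "nat \<Rightarrow> real \<Rightarrow> real" where
  "evp k x = (\<Prod>l<k. x\<^sup>2 - (2 * real l + 1)\<^sup>2)"

definition odp :: "nat \<Rightarrow> real \<Rightarrow> real" where
  "odp k x = x * (\<Prod>l<k. x\<^sup>2 - (2 * real l + 2)\<^sup>2)"

lemma odp_shift: "odp k (x + 1) = (x + 1 + 2 * k) * evp k x" "odp k (x - 1) = (x - 1 - 2 * k) * evp k x"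
proof (induction k)
  case (Suc k)
  {
    case 1
    have "odp (Suc k) (x + 1) = odp k (x + 1) * ((x + 1)\<^sup>2 - (2 * real k + 2)\<^sup>2)" by (simp add: odp_def)
    also have "\<dots> = ((x + 1 + 2 * k) * evp k x) * ((x + 1)\<^sup>2 - (2 * real k + 2)\<^sup>2)" using Suc by simp
    also have "\<dots> = (x + 1 + 2 * Suc k) * (evp k x * (x\<^sup>2 - (2 * real k + 1)\<^sup>2))"
      by (simp add: power2_eq_square algebra_simps)
    finally show ?case by (simp add: evp_def)
  next
    case 2
    have "odp (Suc k) (x - 1) = odp k (x - 1) * ((x - 1)\<^sup>2 - (2 * real k + 2)\<^sup>2)" by (simp add: odp_def)
    also have "\<dots> = ((x - 1 - 2 * k) * evp k x) * ((x - 1)\<^sup>2 - (2 * real k + 2)\<^sup>2)" using Suc by simp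
    also have "\<dots> = (x - 1 - 2 * Suc k) * (evp k x * (x\<^sup>2 - (2 * real k + 1)\<^sup>2))"
      by (simp add: power2_eq_square algebra_simps)
    finally show ?case by (simp add: evp_def)
  }
qed (simp_all add: odp_def evp_def)

lemma evp_shift:
  "evp (Suc k) (x + 1) = (x + 2 + 2 * k) * odp k x" "evp (Suc k) (x - 1) = (x - 2 - 2 * k) * odp k x"
proof (induction k)
  case 0
  { case 1 show ?case by (simp add: odp_def evp_def power2_eq_square algebra_simps) }
  { case 2 show ?case by (simp add: odp_def evp_def power2_eq_square algebra_simps) }
next
  case (Suc k)
  {
    case 1
    have "evp (Suc (Suc k)) (x + 1) = evp (Suc k) (x + 1) * ((x + 1)\<^sup>2 - (2 * real k + 3)\<^sup>2)"
      by (simp add: evp_def algebra_simps)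
    also have "\<dots> = ((x + 2 + 2 * k) * odp k x) * ((x + 1)\<^sup>2 - (2 * real k + 3)\<^sup>2)" using Suc by simp
    also have "\<dots> = (x + 2 + 2 * Suc k) * (odp k x * (x\<^sup>2 - (2 * real k + 2)\<^sup>2))"
      by (simp add: power2_eq_square algebra_simps)
    finally show ?case by (simp add: odp_def)
  next
    case 2
    have "evp (Suc (Suc k)) (x - 1) = evp (Suc k) (x - 1) * ((x - 1)\<^sup>2 - (2 * real k + 3)\<^sup>2)"
      by (simp add: evp_def algebra_simps)
    also have "\<dots> = ((x - 2 - 2 * k) * odp k x) * ((x - 1)\<^sup>2 - (2 * real k + 3)\<^sup>2)" using Suc by simp
    also have "\<dots> = (x - 2 - 2 * Suc k) * (odp k x * (x\<^sup>2 - (2 * real k + 2)\<^sup>2))"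
      by (simp add: power2_eq_square algebra_simps)
    finally show ?case by (simp add: odp_def)
  }
qed

lemma odp_difference: "odp k (x + 1) - odp k (x - 1) = 2 * (2 * k + 1) * evp k x"
  by (simp only: odp_shift) (simp add: algebra_simps)

lemma evp_difference: "evp (Suc k) (x + 1) - evp (Suc k) (x - 1) = 4 * (k + 1) * odp k x"
  by (simp only: evp_shift) (simp add: algebra_simps)

lemma odp_minus: "odp k (- x) = - odp k x"
  by (simp add: odp_def)

lemma odp_0 [simp]: "odp k 0 = 0"
  by (simp add: odp_def)

lemma vdm_evp: "dt m (\<lambda>i k. evp k (x i)) = vdm m (\<lambda>i. (x i)\<^sup>2)"
  unfolding evp_def by (rule dt_newton)

lemma vdm_odp: "dt m (\<lambda>i k. odp k (x i)) = (\<Prod>i<m. x i) * vdm m (\<lambda>i. (x i)\<^sup>2)"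
  unfolding odp_def by (simp only: dt_scale_rows dt_newton)

lemma gap_set_Suc:
  "{X :: int. a \<le> X \<and> X < a + 1 + 2 * int (Suc n) \<and> even (X - a)}
    = insert (a + 2 * int (Suc n)) {X. a \<le> X \<and> X < a + 1 + 2 * int n \<and> even (X - a)}"
proof -
  have "X = a + 2 * int (Suc n) \<or> X < a + 1 + 2 * int n"
    if "X < a + 1 + 2 * int (Suc n)" "even (X - a)" for X
    using that by presburger
  then show ?thesis by auto
qed

lemma finite_gap_set: "finite {X :: int. a \<le> X \<and> X < b \<and> even (X - a)}"
  by (rule finite_subset[of _ "{a..b}"]) auto

lemma gap_set_0: "{X :: int. a \<le> X \<and> X < a + 1 + 2 * int 0 \<and> even (X - a)} = {a}"
  by auto

lemma sum_central_differences:
  fixes g :: "real \<Rightarrow> real"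
  assumes "a \<le> b" "odd (b - a)"
  shows "(\<Sum>X\<in>{X. a \<le> X \<and> X < b \<and> even (X - a)}. g (of_int X + 1) - g (of_int X - 1))
    = g (of_int b) - g (of_int a - 1)"
proof -
  have *: "(\<Sum>X\<in>{X. a \<le> X \<and> X < a + 1 + 2 * int n \<and> even (X - a)}. g (of_int X + 1) - g (of_int X - 1))
    = g (of_int (a + 1 + 2 * int n)) - g (of_int a - 1)" for n
  proof (induction n)
    case 0
    show ?case by (subst gap_set_0) (simp add: algebra_simps)
  next
    case (Suc n)
    show ?case
      by (subst gap_set_Suc, subst sum.insert, rule finite_gap_set) (use Suc in \<open>auto simp: algebra_simps\<close>)
  qed
  have b: "b = a + 1 + 2 * int (nat ((b - a - 1) div 2))"
  proof -
    obtain t where t: "b - a = 2 * t + 1" using assms(2) by (rule oddE)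
    then show ?thesis using assms(1) by simp
  qed
  show ?thesis by (subst (1 2) b) (rule *)
qed

text \<open>For an odd function \<open>g\<close> the weight \<open>1/2\<close> of column \<open>0\<close> replaces the first summand
  \<open>g 1 - g (- 1) = 2 * g 1\<close> by \<open>g 1\<close>. This is why the weighted regions have product formulas.\<close>

lemma sum_central_differences_0:
  fixes g :: "real \<Rightarrow> real"
  assumes odd: "\<And>x. g (- x) = - g x" and b: "0 \<le> b" "odd b"
  shows "(\<Sum>X\<in>{X. 0 \<le> X \<and> X < b \<and> even X}. colw X * (g (of_int X + 1) - g (of_int X - 1))) = g (of_int b)"
proof -
  have *: "(\<Sum>X\<in>{X. 0 \<le> X \<and> X < 0 + 1 + 2 * int n \<and> even (X - 0)}. colw X * (g (of_int X + 1) - g (of_int X - 1)))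
    = g (of_int (0 + 1 + 2 * int n))" for n
  proof (induction n)
    case 0
    show ?case using odd[of 1] by (subst gap_set_0) (simp add: colw_def)
  next
    case (Suc n)
    show ?case
      by (subst gap_set_Suc, subst sum.insert, rule finite_gap_set) (use Suc in \<open>auto simp: colw_def algebra_simps\<close>)
  qed
  have n: "b = 0 + 1 + 2 * int (nat ((b - 1) div 2))"
  proof -
    obtain t where t: "b = 2 * t + 1" using b(2) by (rule oddE)
    then show ?thesis using b(1) by simp
  qed
  show ?thesis by (subst (1 2) n) (rule *[unfolded diff_0_right])
qed

lemma finite_gap: "finite (gap c u i)"
  by (rule finite_subset[of _ "{(if i = 0 then c else u (i - 1) + 1)..u i}"]) (auto simp: gap_def)

text \<open>The following two sums run over the sequences \<open>d\<close> that interlace with \<open>u\<close>. The Vandermonde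
  products become determinants with the entries \<open>evp k\<close> and \<open>odp k\<close>. As these are central differences
  of each other, up to constants, summing a row over a gap turns it into a difference of two
  consecutive rows of the other determinant.\<close>

lemma interlacing_sum_down:
  assumes u: "dent_seq c N m u" and c: "c \<in> {0, 1}"
  shows "(\<Sum>d\<in>PiE {..<m} (gap c u). (\<Prod>i<m. colw (d i)) * vdm m (\<lambda>i. (of_int (d i))\<^sup>2))
    = (\<Prod>k<m. 1 / (2 * (2 * real k + 1))) * ((\<Prod>i<m. of_int (u i)) * vdm m (\<lambda>i. (of_int (u i))\<^sup>2))"
proof -
  have inner: "(\<Sum>x\<in>gap c u i. colw x * evp k (of_int x))
      = 1 / (2 * (2 * real k + 1)) * (odp k (of_int (u i)) - (if i = 0 then 0 else odp k (of_int (u (i - 1)))))"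
    if i: "i < m" for i k
  proof -
    have ui: "c \<le> u i" "odd (u i - c)" using u i by (auto simp: dent_seq_def)
    have "2 * (2 * real k + 1) * (\<Sum>x\<in>gap c u i. colw x * evp k (of_int x))
        = (\<Sum>x\<in>gap c u i. colw x * (odp k (of_int x + 1) - odp k (of_int x - 1)))"
      unfolding sum_distrib_left odp_difference by (simp add: mult_ac)
    also have "\<dots> = odp k (of_int (u i)) - (if i = 0 then 0 else odp k (of_int (u (i - 1))))"
    proof (cases "i = 0 \<and> c = 0")
      case True
      then have "gap c u i = {X. 0 \<le> X \<and> X < u i \<and> even X}" by (auto simp: gap_def)
      then show ?thesis
        using True ui sum_central_differences_0[of "odp k" "u i", OF odp_minus] by simp
    next
      case False
      define a where "a = (if i = 0 then c else u (i - 1) + 1)"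
      have p: "a \<le> u i \<and> odd (u i - a) \<and> (even (X - a) \<longleftrightarrow> even (X - c)) \<and> 1 \<le> a" for X
      proof (cases i)
        case 0
        then show ?thesis using False ui c by (auto simp: a_def)
      next
        case (Suc i')
        have "u i' < u i" "odd (u i' - c)" "c \<le> u i'"
          using Suc i u dent_seq_less[OF u, of i' i] by (auto simp: dent_seq_def)
        then have "odd (u i - (u i' + 1))" "even (X - (u i' + 1)) \<longleftrightarrow> even (X - c)"
          using ui by presburger+
        then show ?thesis using Suc c \<open>u i' < u i\<close> \<open>c \<le> u i'\<close> by (auto simp: a_def)
      qed
      have g: "gap c u i = {X. a \<le> X \<and> X < u i \<and> even (X - a)}"
        unfolding gap_def a_def[symmetric] using p by blast
      have "(\<Sum>x\<in>gap c u i. colw x * (odp k (of_int x + 1) - odp k (of_int x - 1)))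
          = (\<Sum>x\<in>gap c u i. odp k (of_int x + 1) - odp k (of_int x - 1))"
      proof (rule sum.cong[OF refl])
        fix x assume "x \<in> gap c u i"
        then have "1 \<le> x" using p[of x] unfolding g by simp
        then show "colw x * (odp k (of_int x + 1) - odp k (of_int x - 1))
            = odp k (of_int x + 1) - odp k (of_int x - 1)" by (simp add: colw_def)
      qed
      also have "\<dots> = odp k (of_int (u i)) - odp k (of_int a - 1)"
        unfolding g by (rule sum_central_differences) (use p in auto)
      finally show ?thesis using False c by (auto simp: a_def)
    qed
    finally show ?thesis by (simp add: field_simps)
  qed
  have "(\<Sum>d\<in>PiE {..<m} (gap c u). (\<Prod>i<m. colw (d i)) * vdm m (\<lambda>i. (of_int (d i))\<^sup>2))
      = (\<Sum>d\<in>PiE {..<m} (gap c u). dt m (\<lambda>i k. colw (d i) * evp k (of_int (d i))))"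
    by (simp only: dt_scale_rows vdm_evp)
  also have "\<dots> = dt m (\<lambda>i k. \<Sum>x\<in>gap c u i. colw x * evp k (of_int x))"
    by (rule dt_sum_rows) (rule finite_gap)
  also have "\<dots> = dt m (\<lambda>i k. 1 / (2 * (2 * real k + 1)) *
      (odp k (of_int (u i)) - (if i = 0 then 0 else odp k (of_int (u (i - 1))))))"
    using inner by (intro dt_cong) simp
  also have "\<dots> = (\<Prod>k<m. 1 / (2 * (2 * real k + 1))) * dt m (\<lambda>i k. odp k (of_int (u i)))"
    unfolding dt_scale_cols[where c = "\<lambda>k. 1 / (2 * (2 * real k + 1))"]
    by (simp only: dt_row_differences[of m "\<lambda>i k. odp k (of_int (u i))"])
  finally show ?thesis by (simp only: vdm_odp)
qed

lemma interlacing_sum_up: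
  assumes u: "dent_seq c N (Suc m) u"
  shows "(\<Sum>d\<in>PiE {..<m} (\<lambda>i. gap c u (Suc i)). (\<Prod>i<m. of_int (d i)) * vdm m (\<lambda>i. (of_int (d i))\<^sup>2))
    = (\<Prod>k<m. 1 / (4 * (real k + 1))) * vdm (Suc m) (\<lambda>i. (of_int (u i))\<^sup>2)"
proof -
  let ?E = "\<lambda>i k. evp k (of_int (u i))"
  have inner: "(\<Sum>x\<in>gap c u (Suc i). odp k (of_int x))
      = 1 / (4 * (real k + 1)) * (?E (Suc i) (Suc k) - ?E i (Suc k))"
    if i: "i < m" for i k
  proof -
    have p: "u i < u (Suc i)" "odd (u i - c)" "odd (u (Suc i) - c)"
      using i u dent_seq_less[OF u, of i "Suc i"] by (auto simp: dent_seq_def)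
    then have q: "odd (u (Suc i) - (u i + 1))" "even (X - (u i + 1)) \<longleftrightarrow> even (X - c)" for X
      by presburger+
    have g: "gap c u (Suc i) = {X. u i + 1 \<le> X \<and> X < u (Suc i) \<and> even (X - (u i + 1))}"
      unfolding gap_def q by simp
    have "4 * (real k + 1) * (\<Sum>x\<in>gap c u (Suc i). odp k (of_int x))
        = (\<Sum>x\<in>gap c u (Suc i). evp (Suc k) (of_int x + 1) - evp (Suc k) (of_int x - 1))"
      unfolding sum_distrib_left evp_difference by simp
    also have "\<dots> = ?E (Suc i) (Suc k) - evp (Suc k) (of_int (u i + 1) - 1)"
      unfolding g by (rule sum_central_differences) (use p q in auto)
    finally show ?thesis by (simp add: field_simps)
  qed
  have "(\<Sum>d\<in>PiE {..<m} (\<lambda>i. gap c u (Suc i)). (\<Prod>i<m. of_int (d i)) * vdm m (\<lambda>i. (of_int (d i))\<^sup>2))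
      = (\<Sum>d\<in>PiE {..<m} (\<lambda>i. gap c u (Suc i)). dt m (\<lambda>i k. odp k (of_int (d i))))"
    by (simp only: vdm_odp)
  also have "\<dots> = dt m (\<lambda>i k. \<Sum>x\<in>gap c u (Suc i). odp k (of_int x))"
    by (rule dt_sum_rows) (rule finite_gap)
  also have "\<dots> = dt m (\<lambda>i k. 1 / (4 * (real k + 1)) * (?E (Suc i) (Suc k) - ?E i (Suc k)))"
    using inner by (intro dt_cong) simp
  also have "\<dots> = (\<Prod>k<m. 1 / (4 * (real k + 1))) * dt m (\<lambda>i k. ?E (Suc i) (Suc k) - ?E i (Suc k))"
    by (rule dt_scale_cols)
  also have "dt m (\<lambda>i k. ?E (Suc i) (Suc k) - ?E i (Suc k))
      = dt (Suc m) (\<lambda>i k. ?E i k - (if i = 0 then 0 else ?E (i - 1) k))"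
    by (subst dt_first_column) (auto simp: evp_def)
  also have "\<dots> = dt (Suc m) ?E" by (rule dt_row_differences)
  finally show ?thesis by (simp only: vdm_evp)
qed

section \<open>Strips with dents on the bottom row\<close>

text \<open>\<open>strip c j R N\<close> has \<open>R\<close> rows, numbered from \<open>j\<close>. Its left boundary is the zigzag along column
  \<open>c\<close>; its right boundary is a line of direction northwest, and \<open>N\<close> is the last column of the
  bottom row. \<open>sw c j R N D\<close> is its weighted tiling number after the removal of the cells of the
  bottom row in the columns \<open>D\<close>.\<close>

definition strip :: "int \<Rightarrow> int \<Rightarrow> nat \<Rightarrow> int \<Rightarrow> (int \<times> int) set" where
  "strip c j R N = {v. j \<le> fst v \<and> fst v < j + int R \<and> c \<le> snd v \<and> snd v \<le> N - (fst v - j)}"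

definition sw :: "int \<Rightarrow> int \<Rightarrow> nat \<Rightarrow> int \<Rightarrow> int set \<Rightarrow> real" where
  "sw c j R N D = mw (strip c j R N - {j} \<times> D)"

lemma finite_strip: "finite (strip c j R N)"
  by (rule finite_subset[of _ "{j..j + int R} \<times> {c..N}"]) (auto simp: strip_def)

lemma sw_rec:
  assumes "odd (N + j)" "\<And>x. x \<in> D \<Longrightarrow> odd (x + j)" "0 < R"
  shows "sw c j (Suc R) N D = (\<Sum>D'\<in>Pow {X. c \<le> X \<and> X < N \<and> even (X + j)}.
    (\<Prod>X\<in>D'. colw X) * sw c (j + 1) R (N - 1) D' * mw ({j} \<times> ({c..N} - D - D')))"
proof -
  let ?R = "strip c j (Suc R) N - {j} \<times> D"
  have fin: "finite ?R" using finite_strip by blast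
  have *: "{X. (j + 1, X) \<in> ?R \<and> (j + 1 - 1, X) \<in> ?R \<and> odd (X + (j + 1))} = {X. c \<le> X \<and> X < N \<and> even (X + j)}"
    using assms by (auto simp: strip_def)
  have A: "{v\<in>?R. j + 1 \<le> fst v} - {j + 1} \<times> D' = strip c (j + 1) R (N - 1) - {j + 1} \<times> D'" for D'
    by (auto simp: strip_def)
  have B: "{v\<in>?R. fst v < j + 1} - {j + 1 - 1} \<times> D' = {j} \<times> ({c..N} - D - D')" for D'
    using assms by (auto simp: strip_def)
  show ?thesis
    unfolding sw_def by (subst mw_cut[OF fin, of "j + 1"]) (simp only: * A B mult.assoc)
qed

lemma dent_seqD: "dent_seq c N m u \<Longrightarrow> i < m \<Longrightarrow> c \<le> u i \<and> u i \<le> N \<and> odd (u i - c)"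
  by (simp add: dent_seq_def)

lemma gap_choice:
  assumes u: "dent_seq c N m u" and d: "d \<in> PiE {..<m} (gap c u)"
  shows "dent_seq (c - 1) (N - 1) m d"
proof -
  have di: "d i \<in> gap c u i" if "i < m" for i using d that by auto
  have "d i < d k" if "i < k" "k < m" for i k
  proof -
    have "u i \<le> u (k - 1)"
    proof (cases "i = k - 1")
      case False
      then have "i < k - 1" "k - 1 < m" using that by linarith+
      then show ?thesis using dent_seq_less[OF u] by force
    qed simp
    then show ?thesis using di[of i] di[of k] that by (auto simp: gap_def)
  qed
  moreover have "c - 1 \<le> d i \<and> d i \<le> N - 1 \<and> odd (d i - (c - 1))" if "i < m" for i
  proof -
    have "c \<le> d i"
    proof (cases i)
      case (Suc i')
      then show ?thesis using di[OF that] dent_seqD[OF u, of i'] that by (simp add: gap_def)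
    qed (use di[OF that] in \<open>simp add: gap_def\<close>)
    then show ?thesis using di[OF that] u that by (auto simp: gap_def dent_seq_def)
  qed
  ultimately show ?thesis by (auto simp: dent_seq_def strict_mono_on_def)
qed

lemma dent_seq_inj: "dent_seq c N m u \<Longrightarrow> inj_on u {..<m}"
  by (auto simp: dent_seq_def intro: strict_mono_on_imp_inj_on)

text \<open>If the bottom row begins with a down-pointing cell, then each gap to the left of a dent contains
  exactly one vertical lozenge that crosses into the next row, where it leaves a dent.\<close>

lemma sw_down:
  assumes c: "even (c + j)" "odd (N + j)" "c \<le> N + 1" and u: "dent_seq c N m u" and R: "0 < R"
  shows "sw c j (Suc R) N (u ` {..<m}) =
    (\<Sum>d\<in>PiE {..<m} (gap c u). (\<Prod>i<m. colw (d i)) * sw c (j + 1) R (N - 1) (d ` {..<m}))"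
proof -
  let ?C = "{X. c \<le> X \<and> X < N \<and> even (X + j)}"
  have par: "even (x + j) \<longleftrightarrow> even (x - c)" for x using c(1) by presburger
  have fC: "finite ?C" by (rule finite_subset[of _ "{c..N}"]) auto
  have uo: "odd (x + j)" if "x \<in> u ` {..<m}" for x
    using that dent_seqD[OF u] par[of x] by blast
  have row: "mw ({j} \<times> ({c..N} - u ` {..<m} - D))
      = (if (\<forall>i<m. card (D \<inter> gap c u i) = 1) \<and> D \<subseteq> (\<Union>i<m. gap c u i) then 1 else 0)" if "D \<subseteq> ?C" for D
    by (rule mw_row[OF u]) (use that c in \<open>auto simp: par\<close>)
  have GC: "gap c u i \<subseteq> ?C" if "i < m" for i
  proof
    fix x assume x: "x \<in> gap c u i"
    then have "x \<in> {c..<N}" using gap_subset[OF u that] by blast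
    then show "x \<in> ?C" using x par[of x] by (simp add: gap_def)
  qed
  have "sw c j (Suc R) N (u ` {..<m}) = (\<Sum>D\<in>Pow ?C.
      (\<Prod>X\<in>D. colw X) * sw c (j + 1) R (N - 1) D * mw ({j} \<times> ({c..N} - u ` {..<m} - D)))"
    by (rule sw_rec[OF c(2) uo R])
  also have "\<dots> = (\<Sum>D\<in>Pow ?C. (if (\<forall>i<m. card (D \<inter> gap c u i) = 1) \<and> D \<subseteq> (\<Union>i<m. gap c u i) then 1 else 0)
      * ((\<Prod>X\<in>D. colw X) * sw c (j + 1) R (N - 1) D))"
    by (intro sum.cong refl) (simp only: row Pow_iff mult.commute)
  also have "\<dots> = (\<Sum>d\<in>PiE {..<m} (gap c u).
      (\<Prod>X\<in>d ` {..<m}. colw X) * sw c (j + 1) R (N - 1) (d ` {..<m}))"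
    by (rule sum_transversals[OF fC GC gap_disjoint[OF u]])
  also have "\<dots> = (\<Sum>d\<in>PiE {..<m} (gap c u). (\<Prod>i<m. colw (d i)) * sw c (j + 1) R (N - 1) (d ` {..<m}))"
  proof (rule sum.cong[OF refl])
    fix d assume d: "d \<in> PiE {..<m} (gap c u)"
    show "(\<Prod>X\<in>d ` {..<m}. colw X) * sw c (j + 1) R (N - 1) (d ` {..<m})
        = (\<Prod>i<m. colw (d i)) * sw c (j + 1) R (N - 1) (d ` {..<m})"
      by (subst prod.reindex[OF dent_seq_inj[OF gap_choice[OF u d]]]) simp
  qed
  finally show ?thesis .
qed

text \<open>A row that begins with the up-pointing cell in column \<open>c\<close> is treated as a row that begins
  with a removed down-pointing cell in column \<open>c - 1\<close>.\<close>

lemma mw_row_up: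
  assumes u: "dent_seq (c - 1) N m u" and D: "D \<subseteq> {c..N}" "\<And>x. x \<in> D \<Longrightarrow> odd (x - c)"
    and N: "even (N - c)" "c \<le> N"
  shows "mw ({j} \<times> ({c..N} - u ` {..<m} - D))
    = (if 0 < m \<and> (\<forall>i<m - 1. card (D \<inter> gap (c - 1) u (Suc i)) = 1) \<and> D \<subseteq> (\<Union>i<m - 1. gap (c - 1) u (Suc i))
       then 1 else 0)"
proof -
  let ?D = "insert (c - 1) D" and ?g = "gap (c - 1) u"
  have fD: "finite D" using D(1) finite_subset by blast
  have "{c..N} - u ` {..<m} - D = {c - 1..N} - u ` {..<m} - ?D" by auto
  moreover have "mw ({j} \<times> ({c - 1..N} - u ` {..<m} - ?D))
      = (if (\<forall>i<m. card (?D \<inter> ?g i) = 1) \<and> ?D \<subseteq> (\<Union>i<m. ?g i) then 1 else 0)"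
    by (rule mw_row[OF u]) (use D N in auto)
  moreover have "((\<forall>i<m. card (?D \<inter> ?g i) = 1) \<and> ?D \<subseteq> (\<Union>i<m. ?g i))
    \<longleftrightarrow> 0 < m \<and> (\<forall>i<m - 1. card (D \<inter> ?g (Suc i)) = 1) \<and> D \<subseteq> (\<Union>i<m - 1. ?g (Suc i))" (is "?L \<longleftrightarrow> ?R")
  proof (cases m)
    case (Suc k)
    have "c - 1 \<le> u 0" "u 0 \<noteq> c - 1" using dent_seqD[OF u, of 0] Suc by auto
    then have u0: "c \<le> u 0" by simp
    have g0: "c - 1 \<in> ?g 0" using u0 by (simp add: gap_def)
    have gS: "c - 1 \<notin> ?g (Suc i)" if "i < k" for i
      using gap_disjoint[OF u, of 0 "Suc i"] g0 that Suc by auto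
    have cD: "c - 1 \<notin> D" using D(1) by auto
    have c0: "card (?D \<inter> ?g 0) = 1 \<longleftrightarrow> D \<inter> ?g 0 = {}"
      using g0 cD fD by (simp add: Int_insert_left)
    have cS: "?D \<inter> ?g (Suc i) = D \<inter> ?g (Suc i)" if "i < k" for i using gS[OF that] by auto
    have all: "(\<forall>i<Suc k. card (?D \<inter> ?g i) = 1) \<longleftrightarrow>
        D \<inter> ?g 0 = {} \<and> (\<forall>i<k. card (D \<inter> ?g (Suc i)) = 1)"
      using c0 cS by (simp add: All_less_Suc2)
    have un: "(\<Union>i<Suc k. ?g i) = ?g 0 \<union> (\<Union>i<k. ?g (Suc i))"
      by (simp add: lessThan_Suc_eq_insert_0)
    have dj: "?g 0 \<inter> (\<Union>i<k. ?g (Suc i)) = {}"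
      using gap_disjoint[OF u, of 0] Suc by blast
    show ?thesis unfolding Suc all un using g0 dj by auto
  qed simp
  ultimately show ?thesis by simp
qed

text \<open>The row that begins with an up-pointing cell has no gap before its first dent, so that the number
  of dents decreases by one.\<close>

lemma sw_up:
  assumes c: "odd (c + j)" "odd (N + j)" "c \<le> N" and u: "dent_seq (c - 1) N m u" and R: "0 < R"
  shows "sw c j (Suc R) N (u ` {..<m}) = (if m = 0 then 0 else
    (\<Sum>d\<in>PiE {..<m - 1} (\<lambda>i. gap (c - 1) u (Suc i)).
       (\<Prod>i<m - 1. colw (d i)) * sw c (j + 1) R (N - 1) (d ` {..<m - 1})))"
    and "m \<noteq> 0 \<Longrightarrow> d \<in> PiE {..<m - 1} (\<lambda>i. gap (c - 1) u (Suc i)) \<Longrightarrow> dent_seq c (N - 1) (m - 1) d"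
proof -
  let ?C = "{X. c \<le> X \<and> X < N \<and> even (X + j)}" and ?g = "gap (c - 1) u" and ?k = "m - 1"
  have par: "even (x + j) \<longleftrightarrow> even (x - (c - 1))" for x using c(1) by presburger
  have fC: "finite ?C" by (rule finite_subset[of _ "{c..N}"]) auto
  have uo: "odd (x + j)" if "x \<in> u ` {..<m}" for x
    using that dent_seqD[OF u] par[of x] by blast
  have row: "mw ({j} \<times> ({c..N} - u ` {..<m} - D))
      = (if 0 < m \<and> (\<forall>i<?k. card (D \<inter> ?g (Suc i)) = 1) \<and> D \<subseteq> (\<Union>i<?k. ?g (Suc i)) then 1 else 0)"
    if "D \<subseteq> ?C" for D
    by (rule mw_row_up[OF u]) (use that c in \<open>auto simp: par\<close>)
  have di: "c \<le> d i \<and> d i < N \<and> even (d i - (c - 1)) \<and> u i < d i \<and> d i < u (Suc i)"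
    if "d \<in> PiE {..<?k} (\<lambda>i. ?g (Suc i))" "i < ?k" for d i
  proof -
    have "d i \<in> ?g (Suc i)" using that by auto
    moreover have "c - 1 \<le> u i" "u (Suc i) \<le> N" using u that(2) by (auto simp: dent_seq_def)
    ultimately show ?thesis by (auto simp: gap_def)
  qed
  have ds: "dent_seq c (N - 1) ?k d" if d: "d \<in> PiE {..<?k} (\<lambda>i. ?g (Suc i))" for d
  proof -
    have "d i < d k" if "i < k" "k < ?k" for i k
    proof -
      have "u (Suc i) \<le> u k"
      proof (cases "Suc i = k")
        case False
        then have "Suc i < k" "k < m" using that by linarith+
        then show ?thesis using dent_seq_less[OF u] by force
      qed simp
      then show ?thesis using di[OF d, of i] di[OF d, of k] that by simp
    qed
    moreover have "odd (d i - c)" if "i < ?k" for i using di[OF d that] by presburger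
    ultimately show ?thesis using di[OF d] by (fastforce simp: dent_seq_def strict_mono_on_def)
  qed
  then show "m \<noteq> 0 \<Longrightarrow> d \<in> PiE {..<m - 1} (\<lambda>i. gap (c - 1) u (Suc i)) \<Longrightarrow> dent_seq c (N - 1) (m - 1) d"
    by simp
  have GC: "?g (Suc i) \<subseteq> ?C" if "i < ?k" for i
  proof
    fix x assume x: "x \<in> ?g (Suc i)"
    have "c - 1 \<le> u i" "u (Suc i) \<le> N" using u that by (auto simp: dent_seq_def)
    then show "x \<in> ?C" using x par[of x] by (auto simp: gap_def)
  qed
  have rec: "sw c j (Suc R) N (u ` {..<m}) = (\<Sum>D\<in>Pow ?C.
      (\<Prod>X\<in>D. colw X) * sw c (j + 1) R (N - 1) D * mw ({j} \<times> ({c..N} - u ` {..<m} - D)))"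
    by (rule sw_rec[OF c(2) uo R])
  show "sw c j (Suc R) N (u ` {..<m}) = (if m = 0 then 0 else
    (\<Sum>d\<in>PiE {..<m - 1} (\<lambda>i. gap (c - 1) u (Suc i)).
       (\<Prod>i<m - 1. colw (d i)) * sw c (j + 1) R (N - 1) (d ` {..<m - 1})))"
  proof (cases "m = 0")
    case True
    then show ?thesis unfolding rec using row by (simp add: row)
  next
    case False
    have "sw c j (Suc R) N (u ` {..<m}) = (\<Sum>D\<in>Pow ?C.
        (if (\<forall>i<?k. card (D \<inter> ?g (Suc i)) = 1) \<and> D \<subseteq> (\<Union>i<?k. ?g (Suc i)) then 1 else 0)
        * ((\<Prod>X\<in>D. colw X) * sw c (j + 1) R (N - 1) D))"
      unfolding rec using False by (intro sum.cong refl) (simp only: row Pow_iff mult.commute, simp)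
    also have "\<dots> = (\<Sum>d\<in>PiE {..<?k} (\<lambda>i. ?g (Suc i)).
        (\<Prod>X\<in>d ` {..<?k}. colw X) * sw c (j + 1) R (N - 1) (d ` {..<?k}))"
      by (rule sum_transversals[OF fC GC gap_disjoint[OF u]]) auto
    also have "\<dots> = (\<Sum>d\<in>PiE {..<?k} (\<lambda>i. ?g (Suc i)).
        (\<Prod>i<?k. colw (d i)) * sw c (j + 1) R (N - 1) (d ` {..<?k}))"
    proof (rule sum.cong[OF refl])
      fix d assume d: "d \<in> PiE {..<?k} (\<lambda>i. ?g (Suc i))"
      show "(\<Prod>X\<in>d ` {..<?k}. colw X) * sw c (j + 1) R (N - 1) (d ` {..<?k})
          = (\<Prod>i<?k. colw (d i)) * sw c (j + 1) R (N - 1) (d ` {..<?k})"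
        by (subst prod.reindex[OF dent_seq_inj[OF ds[OF d]]]) simp
    qed
    finally show ?thesis using False by simp
  qed
qed

lemma sw_up_1:
  assumes c: "odd (c + j)" "odd (N + j)" "c \<le> N" and u: "dent_seq (c - 1) N m u"
  shows "sw c j 1 N (u ` {..<m}) = (if m = 1 then 1 else 0)"
proof -
  have "strip c j 1 N - {j} \<times> u ` {..<m} = {j} \<times> ({c..N} - u ` {..<m} - {})" by (auto simp: strip_def)
  then have "sw c j 1 N (u ` {..<m}) = mw ({j} \<times> ({c..N} - u ` {..<m} - {}))" by (simp only: sw_def)
  also have "\<dots> = (if 0 < m \<and> (\<forall>i<m - 1. card ({} \<inter> gap (c - 1) u (Suc i)) = 1)
      \<and> {} \<subseteq> (\<Union>i<m - 1. gap (c - 1) u (Suc i)) then 1 else 0)"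
    by (rule mw_row_up[OF u]) (use c in auto)
  also have "\<dots> = (if m = 1 then 1 else 0)"
  proof -
    have "0 < m \<and> (\<forall>i. \<not> i < m - 1) \<longleftrightarrow> m = 1"
    proof (cases "m \<le> 1")
      case False
      then have "0 < m - 1" by simp
      then have *: "\<not> (\<forall>i. \<not> i < m - 1)" by blast
      show ?thesis using False by (simp only: *) simp
    qed (auto simp: le_Suc_eq)
    then show ?thesis by simp
  qed
  finally show ?thesis .
qed

text \<open>The constants that accumulate when the rows of a strip are removed one after the other: \<open>kdown\<close>
  and \<open>kup\<close> come from the sums over interlacing sequences.\<close>

definition kdown :: "nat \<Rightarrow> real" where
  "kdown m = (\<Prod>k<m. 1 / (2 * (2 * real k + 1)))"

definition kup :: "nat \<Rightarrow> real" where
  "kup m = (\<Prod>k<m. 1 / (4 * (real k + 1)))"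

primrec kstrip :: "nat \<Rightarrow> real" where
  "kstrip 0 = 1"
| "kstrip (Suc m) = kstrip m * kdown (Suc m) * kup (Suc m)"

lemma sw_formula_down_step:
  assumes c: "c \<in> {0, 1}" and par: "even (c + j)" "odd (N + j)" and N: "c + 2 * int m + 1 \<le> N"
    and u: "dent_seq c N l u"
    and up: "\<And>j N l u. odd (c + j) \<Longrightarrow> odd (N + j) \<Longrightarrow> c + 2 * int m \<le> N \<Longrightarrow> dent_seq (c - 1) N l u \<Longrightarrow>
      sw c j (Suc (2 * m)) N (u ` {..<l})
      = (if l = Suc m then kstrip m * vdm (Suc m) (\<lambda>i. (of_int (u i))\<^sup>2) else 0)"
  shows "sw c j (Suc (Suc (2 * m))) N (u ` {..<l}) = (if l = Suc m then kstrip m * kdown (Suc m) *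
      ((\<Prod>i<Suc m. of_int (u i)) * vdm (Suc m) (\<lambda>i. (of_int (u i))\<^sup>2)) else 0)"
proof -
  let ?P = "PiE {..<l} (gap c u)"
  have IH: "sw c (j + 1) (Suc (2 * m)) (N - 1) (d ` {..<l})
      = (if l = Suc m then kstrip m * vdm l (\<lambda>i. (of_int (d i))\<^sup>2) else 0)" if "d \<in> ?P" for d
    using up[OF _ _ _ gap_choice[OF u that], of "j + 1"] par N by auto
  have "sw c j (Suc (Suc (2 * m))) N (u ` {..<l})
      = (\<Sum>d\<in>?P. (\<Prod>i<l. colw (d i)) * sw c (j + 1) (Suc (2 * m)) (N - 1) (d ` {..<l}))"
    using par N u by (intro sw_down) auto
  also have "\<dots> = (\<Sum>d\<in>?P. (if l = Suc m then kstrip m else 0) * ((\<Prod>i<l. colw (d i)) * vdm l (\<lambda>i. (of_int (d i))\<^sup>2)))"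
    using IH by (intro sum.cong) auto
  also have "\<dots> = (if l = Suc m then kstrip m else 0) * (kdown l * ((\<Prod>i<l. of_int (u i)) * vdm l (\<lambda>i. (of_int (u i))\<^sup>2)))"
    unfolding sum_distrib_left[symmetric] interlacing_sum_down[OF u c] kdown_def ..
  finally show ?thesis by simp
qed

lemma sw_formula_up_step:
  assumes c: "c \<in> {0, 1}" and par: "odd (c + j)" "odd (N + j)" and N: "c + 2 * int (Suc m) \<le> N"
    and u: "dent_seq (c - 1) N l u"
    and down: "\<And>j N l u. even (c + j) \<Longrightarrow> odd (N + j) \<Longrightarrow> c + 2 * int m + 1 \<le> N \<Longrightarrow> dent_seq c N l u \<Longrightarrow>
      sw c j (Suc (Suc (2 * m))) N (u ` {..<l}) = (if l = Suc m then kstrip m * kdown (Suc m) *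
      ((\<Prod>i<Suc m. of_int (u i)) * vdm (Suc m) (\<lambda>i. (of_int (u i))\<^sup>2)) else 0)"
  shows "sw c j (Suc (2 * Suc m)) N (u ` {..<l})
      = (if l = Suc (Suc m) then kstrip (Suc m) * vdm (Suc (Suc m)) (\<lambda>i. (of_int (u i))\<^sup>2) else 0)"
proof (cases l)
  case 0
  then show ?thesis using par N u sw_up(1)[of c j N l u "2 * Suc m"] by simp
next
  case (Suc k)
  let ?P = "PiE {..<k} (\<lambda>i. gap (c - 1) u (Suc i))"
  have ds: "dent_seq c (N - 1) k d" if "d \<in> ?P" for d
    using sw_up(2)[OF par _ u, of 1 d] N that Suc by simp
  have IH: "sw c (j + 1) (Suc (Suc (2 * m))) (N - 1) (d ` {..<k})
      = (if k = Suc m then kstrip m * kdown (Suc m) * ((\<Prod>i<k. of_int (d i)) * vdm k (\<lambda>i. (of_int (d i))\<^sup>2)) else 0)"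
    if "d \<in> ?P" for d
    using down[OF _ _ _ ds[OF that], of "j + 1"] par N by auto
  have cw: "colw (d i) = 1" if "d \<in> ?P" "i < k" for d i
  proof -
    have "d i \<in> gap (c - 1) u (Suc i)" using that by auto
    moreover have "c - 1 \<le> u i" "odd (u i - (c - 1))" using dent_seqD[OF u, of i] that Suc by auto
    moreover have "u i \<noteq> c - 1" using \<open>odd (u i - (c - 1))\<close> by auto
    ultimately show ?thesis using c by (auto simp: gap_def colw_def)
  qed
  have "sw c j (Suc (2 * Suc m)) N (u ` {..<l})
      = (\<Sum>d\<in>?P. (\<Prod>i<k. colw (d i)) * sw c (j + 1) (2 * Suc m) (N - 1) (d ` {..<k}))"
    using par N u Suc by (subst sw_up(1)) auto
  also have "\<dots> = (\<Sum>d\<in>?P. (if k = Suc m then kstrip m * kdown (Suc m) else 0) *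
      ((\<Prod>i<k. of_int (d i)) * vdm k (\<lambda>i. (of_int (d i))\<^sup>2)))"
    using cw IH by (intro sum.cong) auto
  also have "\<dots> = (if k = Suc m then kstrip m * kdown (Suc m) else 0) * (kup k * vdm (Suc k) (\<lambda>i. (of_int (u i))\<^sup>2))"
    using u unfolding sum_distrib_left[symmetric] Suc interlacing_sum_up[OF u[unfolded Suc]] kup_def by simp
  finally show ?thesis using Suc by simp
qed

lemma sw_formula_up:
  assumes c: "c \<in> {0, 1}"
  shows "odd (c + j) \<Longrightarrow> odd (N + j) \<Longrightarrow> c + 2 * int m \<le> N \<Longrightarrow> dent_seq (c - 1) N l u \<Longrightarrow>
    sw c j (Suc (2 * m)) N (u ` {..<l})
    = (if l = Suc m then kstrip m * vdm (Suc m) (\<lambda>i. (of_int (u i))\<^sup>2) else 0)"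
proof (induction m arbitrary: j N l u)
  case 0
  then show ?case using sw_up_1[of c j N l u] by (auto simp: vdm_def)
next
  case (Suc m)
  show ?case
    by (rule sw_formula_up_step[OF c Suc.prems]) (rule sw_formula_down_step[OF c _ _ _ _ Suc.IH])
qed

lemmas sw_formula_down = sw_formula_down_step[OF _ _ _ _ _ sw_formula_up]

section \<open>Product formulas for dented strips\<close>

text \<open>Dents are recorded by their positions \<open>p\<close>, which stand for the columns \<open>2 p\<close>.\<close>

definition pcols :: "nat set \<Rightarrow> int set" where
  "pcols D = (\<lambda>p. 2 * int p) ` D"

text \<open>The Vandermonde product of the squares of the positions; in \<open>Dlt1\<close> the positions themselves occur
  as additional factors.\<close>

definition Dlt :: "nat set \<Rightarrow> real" where
  "Dlt D = (\<Prod>t\<in>D. \<Prod>s\<in>{s\<in>D. s < t}. (real t)\<^sup>2 - (real s)\<^sup>2)"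

definition Dlt1 :: "nat set \<Rightarrow> real" where
  "Dlt1 D = (\<Prod>t\<in>D. real t) * Dlt D"

text \<open>The constants in the product formulas for weighted strips with \<open>2 m + 1\<close> rows and for unweighted
  strips with \<open>2 m\<close> rows. The powers of \<open>2\<close> and \<open>4\<close> come from the passage from columns to positions.\<close>

definition ucoef :: "nat \<Rightarrow> real" where
  "ucoef m = kstrip m * (\<Prod>i<Suc m. \<Prod>k<i. 4)"

definition lcoef :: "nat \<Rightarrow> real" where
  "lcoef m = (case m of 0 \<Rightarrow> 1 | Suc k \<Rightarrow> kstrip k * kdown m) * 2 ^ m * (\<Prod>i<m. \<Prod>k<i. 4)"

lemma kdown_pos: "0 < kdown m" and kup_pos: "0 < kup m"
  unfolding kdown_def kup_def by (auto intro!: prod_pos simp: add_pos_nonneg add_nonneg_pos)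

lemma kstrip_pos: "0 < kstrip m"
  by (induction m) (simp_all add: kdown_pos kup_pos)

lemma ucoef_pos: "0 < ucoef m"
  by (auto simp: ucoef_def kstrip_pos intro!: mult_pos_pos prod_pos)

lemma lcoef_pos: "0 < lcoef m"
  unfolding lcoef_def by (intro mult_pos_pos prod_pos) (auto simp: kstrip_pos kdown_pos split: nat.split)

lemma sorted_enumeration:
  fixes D :: "nat set"
  assumes "finite D"
  obtains e where "strict_mono_on {..<card D} e" "e ` {..<card D} = D"
proof
  let ?l = "sorted_list_of_set D"
  have l: "length ?l = card D" by simp
  show "strict_mono_on {..<card D} ((!) ?l)"
    using strict_sorted_list_of_set[of D] l by (auto simp: strict_mono_on_def sorted_wrt_iff_nth_less)
  show "(!) ?l ` {..<card D} = D"
    using set_sorted_list_of_set[OF assms] l by (metis nth_image atLeast0LessThan order_refl take_all)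
qed

lemma Dlt_enumeration:
  assumes e: "strict_mono_on {..<m} e"
  shows "Dlt (e ` {..<m}) = vdm m (\<lambda>i. (real (e i))\<^sup>2)"
proof -
  have inj: "inj_on e {..<m}" using e by (rule strict_mono_on_imp_inj_on)
  have lt: "e k < e i \<longleftrightarrow> k < i" if "k < m" "i < m" for k i
    using e that by (metis lessThan_iff linorder_neqE_nat order.asym strict_mono_on_def)
  have "(\<Prod>s\<in>{s \<in> e ` {..<m}. s < e i}. (real (e i))\<^sup>2 - (real s)\<^sup>2) = (\<Prod>k<i. (real (e i))\<^sup>2 - (real (e k))\<^sup>2)"
    if i: "i < m" for i
  proof (rule prod.reindex_cong[of e])
    show "inj_on e {..<i}" using inj i by (auto intro: inj_on_subset)
    show "{s \<in> e ` {..<m}. s < e i} = e ` {..<i}" using lt i by auto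
  qed simp
  then show ?thesis unfolding Dlt_def vdm_def by (subst prod.reindex[OF inj]) simp
qed

lemma vdm_scale: "vdm m (\<lambda>i. 4 * v i) = (\<Prod>i<m. \<Prod>k<i. 4) * vdm m v"
  unfolding vdm_def by (simp only: right_diff_distrib[symmetric] prod.distrib)

lemma strip_up:
  assumes D: "D \<subseteq> {0..n}" and j: "odd j" and mn: "m \<le> n"
  shows "sw 0 j (Suc (2 * m)) (2 * int n) (pcols D) = (if card D = Suc m then ucoef m * Dlt D else 0)"
proof -
  have fD: "finite D" using D finite_subset by blast
  obtain e where e: "strict_mono_on {..<card D} e" "e ` {..<card D} = D"
    by (rule sorted_enumeration[OF fD])
  let ?u = "\<lambda>i. 2 * int (e i)"
  have eD: "e i \<in> D" if "i < card D" for i using e(2) that by blast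
  have u: "dent_seq (0 - 1) (2 * int n) (card D) ?u"
    using e(1) D eD by (fastforce simp: dent_seq_def strict_mono_on_def)
  have "?u ` {..<card D} = pcols (e ` {..<card D})" by (simp only: pcols_def image_image)
  then have img: "?u ` {..<card D} = pcols D" using e(2) by simp
  have sq: "(of_int (2 * int (e i)))\<^sup>2 = 4 * (real (e i))\<^sup>2" for i by (simp add: power2_eq_square)
  have "sw 0 j (Suc (2 * m)) (2 * int n) (?u ` {..<card D})
      = (if card D = Suc m then kstrip m * vdm (Suc m) (\<lambda>i. (of_int (?u i))\<^sup>2) else 0)"
    by (rule sw_formula_up[OF _ _ _ _ u]) (use j mn in auto)
  then show ?thesis
    using Dlt_enumeration[OF e(1)] e(2) unfolding img sq vdm_scale by (auto simp: ucoef_def)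
qed

lemma strip_low:
  assumes D: "D \<subseteq> {1..n}" and j: "odd j" and mn: "card D \<le> n"
  shows "sw 1 j (2 * card D) (2 * int n) (pcols D) = lcoef (card D) * Dlt1 D"
proof -
  have fD: "finite D" using D finite_subset by blast
  obtain e where e: "strict_mono_on {..<card D} e" "e ` {..<card D} = D"
    by (rule sorted_enumeration[OF fD])
  show ?thesis
  proof (cases "card D")
    case 0
    then have "D = {}" using fD by simp
    moreover have "strip 1 j 0 (2 * int n) = {}" by (auto simp: strip_def)
    ultimately show ?thesis by (simp add: sw_def lcoef_def Dlt1_def Dlt_def pcols_def)
  next
    case (Suc m)
    let ?u = "\<lambda>i. 2 * int (e i)"
    have eD: "e i \<in> D" if "i < card D" for i using e(2) that by blast
    have "1 \<le> ?u i \<and> ?u i \<le> 2 * int n \<and> odd (?u i - 1)" if "i < card D" for i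
      using D eD[OF that] by auto
    then have u: "dent_seq 1 (2 * int n) (card D) ?u"
      using e(1) by (auto simp: dent_seq_def strict_mono_on_def)
    have "?u ` {..<card D} = pcols (e ` {..<card D})" by (simp only: pcols_def image_image)
  then have img: "?u ` {..<card D} = pcols D" using e(2) by simp
    have sq: "(of_int (2 * int (e i)))\<^sup>2 = 4 * (real (e i))\<^sup>2" for i by (simp add: power2_eq_square)
    have lin: "(\<Prod>i<Suc m. of_int (2 * int (e i))) = 2 ^ Suc m * (\<Prod>t\<in>D. real t)"
    proof -
      have "inj_on e {..<card D}" using e(1) by (rule strict_mono_on_imp_inj_on)
      then have "(\<Prod>t\<in>D. real t) = (\<Prod>i<Suc m. real (e i))"
        using Suc by (subst e(2)[symmetric], subst prod.reindex) auto
      then show ?thesis by (simp add: prod.distrib)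
    qed
    have "sw 1 j (Suc (Suc (2 * m))) (2 * int n) (?u ` {..<card D})
        = (if card D = Suc m then kstrip m * kdown (Suc m) *
            ((\<Prod>i<Suc m. of_int (?u i)) * vdm (Suc m) (\<lambda>i. (of_int (?u i))\<^sup>2)) else 0)"
      by (rule sw_formula_down[OF _ _ _ _ u]) (use j mn Suc in auto)
    then show ?thesis
      using Dlt_enumeration[OF e(1)] e(2) Suc unfolding img sq vdm_scale lin
      by (simp add: lcoef_def Dlt1_def)
  qed
qed

section \<open>Forced lozenges\<close>

text \<open>Let \<open>U\<close> be a part of \<open>S\<close> that lies above the line at the bottom of row \<open>j\<close>, is closed under
  vertical bonds above this line, and contains the neighbours in \<open>S\<close> of its down-pointing cells. If the
  up-pointing cells of \<open>U\<close> in row \<open>j\<close> are removed, then every covering of what is left of \<open>S\<close> covers the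
  other cells of \<open>U\<close> by vertical bonds. In this way the triangles in the definitions of the regions are traded for unit dents.\<close>

lemma mw_forced:
  assumes fin: "finite S" and US: "U \<subseteq> S" and EU: "E \<inter> U = {}"
    and j: "\<And>v. v \<in> U \<Longrightarrow> j \<le> fst v"
    and above: "\<And>i X. (i, X) \<in> U \<Longrightarrow> even (X + i) \<Longrightarrow> (i + 1, X) \<in> U"
    and right: "\<And>i X. (i, X) \<in> U \<Longrightarrow> even (X + i) \<Longrightarrow> (i, X + 1) \<in> U"
    and left: "\<And>i X. (i, X) \<in> U \<Longrightarrow> even (X + i) \<Longrightarrow> (i, X - 1) \<in> U \<or> (i, X - 1) \<notin> S"
    and below: "\<And>i X. (i, X) \<in> U \<Longrightarrow> odd (X + i) \<Longrightarrow> i \<noteq> j \<Longrightarrow> (i - 1, X) \<in> U"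
  shows "mw (S - {v\<in>U. fst v = j \<and> odd (snd v + fst v)} - E)
    = (\<Prod>v\<in>{v\<in>U. even (snd v + fst v)}. colw (snd v)) * mw (S - U - E)"
proof -
  let ?F = "{v\<in>U. even (snd v + fst v)}"
  let ?s = "\<lambda>v :: int \<times> int. (fst v + 1, snd v)"
  let ?R = "\<lambda>H. S - (U - (H \<union> ?s ` H)) - E"
  have fU: "finite U" using fin US finite_subset by blast
  have main: "mw (?R H) = (\<Prod>v\<in>H. colw (snd v)) * mw (S - U - E)" if "H \<subseteq> ?F" for H
    using that
  proof (induction "card H" arbitrary: H)
    case 0
    then have "H = {}" using fU by (metis (no_types, lifting) card_0_eq finite_subset mem_Collect_eq subsetI)
    then show ?case by simp
  next
    case (Suc n)
    have fH: "finite H" using Suc.prems by (auto intro: finite_subset[OF _ fU])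
    have "H \<noteq> {}" using Suc.hyps(2) by auto
    \<comment> \<open>The neighbours of a lowest cell of \<open>H\<close> are no longer available.\<close>
    define v where "v = arg_min_on fst H"
    have vH: "v \<in> H" and low: "\<And>w. w \<in> H \<Longrightarrow> fst v \<le> fst w"
      unfolding v_def using fH \<open>H \<noteq> {}\<close> by (auto intro: arg_min_if_finite arg_min_least)
    obtain i X where v: "v = (i, X)" by (cases v)
    have vU: "(i, X) \<in> U" "even (X + i)" using vH Suc.prems v by auto
    have up: "(i + 1, X) \<in> U" by (rule above[OF vU])
    have nx: "w \<notin> H \<union> ?s ` H" if "w = (i, X + 1) \<or> w = (i, X - 1)" for w
    proof
      assume "w \<in> H \<union> ?s ` H"
      then show False
      proof
        assume "w \<in> H"
        then have "even (snd w + fst w)" using Suc.prems by auto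
        then show False using that vU(2) by auto
      next
        assume "w \<in> ?s ` H"
        then obtain w' where "w' \<in> H" "w = ?s w'" by auto
        then show False using low[of w'] that v by auto
      qed
    qed
    have r1: "(i, X + 1) \<notin> ?R H" using right[OF vU] nx[of "(i, X + 1)"] by auto
    have r2: "(i, X - 1) \<notin> ?R H" using left[OF vU] nx[of "(i, X - 1)"] by auto
    have inR: "{(i, X), (i + 1, X)} \<subseteq> ?R H"
    proof -
      have "(i, X) \<in> H \<union> ?s ` H" "(i + 1, X) \<in> H \<union> ?s ` H" using vH v by force+
      moreover have "(i, X) \<in> S" "(i + 1, X) \<in> S" "(i, X) \<notin> E" "(i + 1, X) \<notin> E"
        using vU up US EU by blast+
      ultimately show ?thesis by simp
    qed
    have "mw (?R H) = bw {(i, X), (i + 1, X)} * mw (?R H - {(i, X), (i + 1, X)})"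
      unfolding mw_def
    proof (rule msum_forced[of _ "(i, X)"])
      show "finite (?R H)" using fin by auto
      show "bond {(i, X), (i + 1, X)}"
        unfolding bond_def using vU(2) by (intro exI[of _ "i + 1"] exI[of _ X]) auto
      fix l assume l: "bond l" "l \<subseteq> ?R H" "(i, X) \<in> l"
      from l(1) show "l = {(i, X), (i + 1, X)}"
      proof (cases rule: bond_cases)
        case (horizontal i' Y)
        then have "i' = i \<and> (Y = X \<or> Y = X - 1)" using l(3) by auto
        then show ?thesis using horizontal l(2) r1 r2 by auto
      next
        case (vertical i' Y)
        then have "Y = X \<and> (i' = i \<or> i' = i + 1)" using l(3) by auto
        then have "Y = X \<and> i' = i + 1" using vertical(1) vU(2) by auto
        then show ?thesis using vertical(2) by simp
      qed
    qed (use inR in auto)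
    also have "bw {(i, X), (i + 1, X)} = colw X" using bw_vertical[of "i + 1" X] by simp
    also have "?R H - {(i, X), (i + 1, X)} = ?R (H - {v})"
    proof -
      have par: "w \<in> H \<Longrightarrow> even (snd w + fst w)" for w using Suc.prems by auto
      have n1: "(i + 1, X) \<notin> H" using par[of "(i + 1, X)"] vU(2) by auto
      have n2: "(i, X) \<notin> ?s ` H"
      proof
        assume "(i, X) \<in> ?s ` H"
        then obtain w where "w \<in> H" "(i, X) = ?s w" by auto
        then show False using low[of w] v by simp
      qed
      have s: "?s ` (H - {v}) = ?s ` H - {(i + 1, X)}" using v by (auto simp: prod_eq_iff)
      have "(H - {v}) \<union> ?s ` (H - {v}) = (H \<union> ?s ` H) - {(i, X), (i + 1, X)}"
        using n1 n2 unfolding s v by auto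
      then show ?thesis using vU up by auto
    qed
    also have "mw (?R (H - {v})) = (\<Prod>v\<in>H - {v}. colw (snd v)) * mw (S - U - E)"
      using Suc.hyps Suc.prems vH fH by (intro Suc.hyps(1)) auto
    finally show ?case using vH fH v by (simp add: prod.remove[of H v])
  qed
  have "U - (?F \<union> ?s ` ?F) = {v\<in>U. fst v = j \<and> odd (snd v + fst v)}"
  proof (rule Set.set_eqI)
    fix v :: "int \<times> int"
    obtain i X where v: "v = (i, X)" by (cases v)
    have "v \<in> ?s ` ?F \<longleftrightarrow> (i - 1, X) \<in> U \<and> odd (X + i)"
    proof
      assume "(i - 1, X) \<in> U \<and> odd (X + i)"
      then have "(i - 1, X) \<in> ?F" "v = ?s (i - 1, X)" using v by auto
      then show "v \<in> ?s ` ?F" by blast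
    qed (auto simp: v)
    moreover have "(i - 1, X) \<notin> U" if "i = j" using j[of "(i - 1, X)"] that by auto
    ultimately show "v \<in> U - (?F \<union> ?s ` ?F) \<longleftrightarrow> v \<in> {v\<in>U. fst v = j \<and> odd (snd v + fst v)}"
      using below[of i X] v by auto
  qed
  then show ?thesis using main[of ?F] by simp
qed

section \<open>From triangles to cells\<close>

text \<open>The coordinates of a triangle in the brick lattice.\<close>

fun cell :: "triangle \<Rightarrow> int \<times> int" where
  "cell (Up i j) = (j, 2 * i + j + 1)"
| "cell (Down i j) = (j, 2 * i + j + 2)"

lemma inj_cell: "inj cell"
proof (rule injI)
  fix s t assume "cell s = cell t"
  then show "s = t" by (cases s; cases t) (auto, presburger+)
qed

lemma surj_cell: "\<exists>t. cell t = v"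
proof -
  obtain j X where v: "v = (j, X)" by (cases v)
  show ?thesis
  proof (cases "odd (X + j)")
    case True
    then have "2 * ((X - j - 1) div 2) + j + 1 = X" by presburger
    then show ?thesis using v by (intro exI[of _ "Up ((X - j - 1) div 2) j"]) simp
  next
    case False
    then have "2 * ((X - j - 2) div 2) + j + 2 = X" by presburger
    then show ?thesis using v by (intro exI[of _ "Down ((X - j - 2) div 2) j"]) simp
  qed
qed

lemma cell_image_Collect:
  assumes "\<And>t. t \<in> A \<longleftrightarrow> p (cell t)"
  shows "cell ` A = {v. p v}"
proof (intro equalityI subsetI)
  fix v assume "v \<in> {v. p v}"
  then show "v \<in> cell ` A" using surj_cell[of v] assms by blast
qed (use assms in auto)

lemma card_2_subset:
  assumes "card A = 2"
  obtains p q where "p \<in> A" "q \<in> A" "p \<noteq> q"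
  using assms by (auto simp: card_2_iff)

lemma up_up: "card (vertices (Up i j) \<inter> vertices (Up i' j')) = 2 \<Longrightarrow> Up i j = Up i' j'"
  by (erule card_2_subset) auto

lemma down_down: "card (vertices (Down i j) \<inter> vertices (Down i' j')) = 2 \<Longrightarrow> Down i j = Down i' j'"
  by (erule card_2_subset) auto

lemma up_down: "card (vertices (Up i j) \<inter> vertices (Down i' j')) = 2 \<longleftrightarrow>
  (i' = i \<and> j' = j) \<or> (i' = i - 1 \<and> j' = j) \<or> (i' = i \<and> j' = j - 1)"
proof
  assume "card (vertices (Up i j) \<inter> vertices (Down i' j')) = 2"
  then show "(i' = i \<and> j' = j) \<or> (i' = i - 1 \<and> j' = j) \<or> (i' = i \<and> j' = j - 1)"
    by (rule card_2_subset) auto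
next
  assume "(i' = i \<and> j' = j) \<or> (i' = i - 1 \<and> j' = j) \<or> (i' = i \<and> j' = j - 1)"
  then consider "i' = i \<and> j' = j" | "i' = i - 1 \<and> j' = j" | "i' = i \<and> j' = j - 1" by blast
  then show "card (vertices (Up i j) \<inter> vertices (Down i' j')) = 2"
  proof cases
    case 1
    then have "vertices (Up i j) \<inter> vertices (Down i' j') = {(i + 1, j), (i, j + 1)}" by auto
    then show ?thesis by simp
  next
    case 2
    then have "vertices (Up i j) \<inter> vertices (Down i' j') = {(i, j), (i, j + 1)}" by auto
    then show ?thesis by simp
  next
    case 3
    then have "vertices (Up i j) \<inter> vertices (Down i' j') = {(i, j), (i + 1, j)}" by auto
    then show ?thesis by simp
  qed
qed

lemma lozenge_iff: "lozenge l \<longleftrightarrow>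
  (\<exists>i j. l = {Up i j, Down i j} \<or> l = {Up i j, Down (i - 1) j} \<or> l = {Up i j, Down i (j - 1)})"
proof
  assume "lozenge l"
  then obtain s t where st: "s \<noteq> t" "card (vertices s \<inter> vertices t) = 2" "l = {s, t}"
    by (auto simp: lozenge_def)
  have *: "\<exists>i j. l = {Up i j, Down i j} \<or> l = {Up i j, Down (i - 1) j} \<or> l = {Up i j, Down i (j - 1)}"
    if "card (vertices (Up i j) \<inter> vertices (Down i' j')) = 2" "l = {Up i j, Down i' j'}" for i j i' j'
    using that(1)[unfolded up_down] that(2) by blast
  show "\<exists>i j. l = {Up i j, Down i j} \<or> l = {Up i j, Down (i - 1) j} \<or> l = {Up i j, Down i (j - 1)}"
  proof (cases s; cases t)
    fix i j i' j' assume "s = Up i j" "t = Up i' j'"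
    then show ?thesis using st up_up[of i j i' j'] by simp
  next
    fix i j i' j' assume "s = Down i j" "t = Down i' j'"
    then show ?thesis using st down_down[of i j i' j'] by simp
  next
    fix i j i' j' assume "s = Up i j" "t = Down i' j'"
    then show ?thesis using st * by blast
  next
    fix i j i' j' assume "s = Down i' j'" "t = Up i j"
    then show ?thesis using st * by (metis Int_commute insert_commute)
  qed
next
  assume "\<exists>i j. l = {Up i j, Down i j} \<or> l = {Up i j, Down (i - 1) j} \<or> l = {Up i j, Down i (j - 1)}"
  then obtain i j i' j' where "l = {Up i j, Down i' j'}"
    "(i' = i \<and> j' = j) \<or> (i' = i - 1 \<and> j' = j) \<or> (i' = i \<and> j' = j - 1)" by blast
  then show "lozenge l" unfolding lozenge_def using up_down[of i j i' j'] by blast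
qed

lemma bond_cell: "bond (cell ` l) \<longleftrightarrow> lozenge l"
proof
  assume "lozenge l"
  then obtain i j where l: "l = {Up i j, Down i j} \<or> l = {Up i j, Down (i - 1) j} \<or> l = {Up i j, Down i (j - 1)}"
    unfolding lozenge_iff by blast
  have "cell ` {Up i j, Down i j} = {(j, 2 * i + j + 1), (j, (2 * i + j + 1) + 1)}"
    "cell ` {Up i j, Down (i - 1) j} = {(j, 2 * i + j), (j, (2 * i + j) + 1)}"
    "cell ` {Up i j, Down i (j - 1)} = {(j - 1, 2 * i + j + 1), (j, 2 * i + j + 1)}"
    by auto
  then consider "cell ` l = {(j, 2 * i + j + 1), (j, (2 * i + j + 1) + 1)}"
    | "cell ` l = {(j, 2 * i + j), (j, (2 * i + j) + 1)}"
    | "cell ` l = {(j - 1, 2 * i + j + 1), (j, 2 * i + j + 1)}"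
    using l by metis
  then show "bond (cell ` l)"
  proof cases
    case 3
    moreover have "odd (2 * i + j + 1 + j)" by simp
    ultimately show ?thesis unfolding bond_def by blast
  qed (unfold bond_def, blast+)
next
  assume "bond (cell ` l)"
  moreover have l: "l = {s, t}" if "cell ` l = {cell s, cell t}" for s t
    using that inj_cell inj_image_eq_iff[of cell l "{s, t}"] by simp
  ultimately show "lozenge l"
  proof (cases rule: bond_cases)
    case (horizontal j X)
    show ?thesis
    proof (cases "odd (X + j)")
      case True
      define i where "i = (X - j - 1) div 2"
      have "X = 2 * i + j + 1" using True unfolding i_def by presburger
      then have "l = {Up i j, Down i j}" using horizontal by (intro l) (auto simp: doubleton_eq_iff)
      then show ?thesis unfolding lozenge_iff by blast
    next
      case False
      define i where "i = (X - j) div 2"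
      have "X = 2 * i + j" using False unfolding i_def by presburger
      then have "l = {Up i j, Down (i - 1) j}" using horizontal by (intro l) (auto simp: doubleton_eq_iff)
      then show ?thesis unfolding lozenge_iff by blast
    qed
  next
    case (vertical j X)
    define i where "i = (X - j - 1) div 2"
    have "X = 2 * i + j + 1" using vertical(1) unfolding i_def by presburger
    then have "l = {Up i j, Down i (j - 1)}" using vertical(2) by (intro l) (auto simp: doubleton_eq_iff)
    then show ?thesis unfolding lozenge_iff by blast
  qed
qed

lemma weighted_count_cells:
  assumes "\<And>l. l \<subseteq> R \<Longrightarrow> lozenge l \<Longrightarrow> w l = bw (cell ` l)"
  shows "weighted_count w R = mw (cell ` R)"
proof -
  have "weighted_count w R = msum lozenge w R"
    by (simp add: weighted_count_def msum_def tilings_def covers_def)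
  also have "\<dots> = mw (cell ` R)"
    unfolding mw_def
    by (rule msum_transport[symmetric])
      (use inj_cell bond_cell assms in \<open>auto intro: inj_on_subset\<close>)
  finally show ?thesis .
qed

text \<open>In an unweighted region the shift by one row and one column moves the first column next to
  the zigzag from \<open>0\<close> to \<open>1\<close>, where all bonds have weight \<open>1\<close>.\<close>

lemma bond_shift: "bond ((\<lambda>v. (fst v + 1, snd v + 1)) ` l) \<longleftrightarrow> bond l"
proof -
  let ?f = "\<lambda>v :: int \<times> int. (fst v + 1, snd v + 1)"
  have fwd: "bond (?f ` l)" if "bond l" for l
    using that
  proof (cases rule: bond_cases)
    case (horizontal j X)
    then have "?f ` l = {(j + 1, X + 1), (j + 1, X + 1 + 1)}" by simp
    then show ?thesis unfolding bond_def by blast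
  next
    case (vertical j X)
    then have "?f ` l = {(j + 1 - 1, X + 1), (j + 1, X + 1)}" "odd (X + 1 + (j + 1))" by auto
    then show ?thesis unfolding bond_def by blast
  qed
  let ?g = "\<lambda>v :: int \<times> int. (fst v - 1, snd v - 1)"
  have bwd: "bond (?g ` l)" if "bond l" for l
    using that
  proof (cases rule: bond_cases)
    case (horizontal j X)
    then have "?g ` l = {(j - 1, X - 1), (j - 1, X - 1 + 1)}" by simp
    then show ?thesis unfolding bond_def by blast
  next
    case (vertical j X)
    then have "?g ` l = {(j - 1 - 1, X - 1), (j - 1, X - 1)}" "odd (X - 1 + (j - 1))" by auto
    then show ?thesis unfolding bond_def by blast
  qed
  have "?g ` ?f ` l = l" by (force simp: image_image)
  then show ?thesis using fwd[of l] bwd[of "?f ` l"] by auto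
qed

lemma card_tilings_cells:
  assumes "\<And>v. v \<in> cell ` R \<Longrightarrow> 0 \<le> snd v"
  shows "real (card (tilings R)) = mw ((\<lambda>v. (fst v + 1, snd v + 1)) ` cell ` R)"
proof -
  let ?f = "\<lambda>v :: int \<times> int. (fst v + 1, snd v + 1)"
  have "real (card (tilings R)) = msum lozenge (\<lambda>_. 1) R"
    by (simp add: msum_def tilings_def covers_def)
  also have "\<dots> = mw ((?f \<circ> cell) ` R)"
    unfolding mw_def
  proof (rule msum_transport[symmetric])
    show "inj_on (?f \<circ> cell) R"
      using inj_cell by (auto intro!: comp_inj_on inj_on_subset[OF inj_cell] simp: inj_on_def prod_eq_iff)
    fix l show "bond ((?f \<circ> cell) ` l) \<longleftrightarrow> lozenge l"
      by (simp only: image_comp[symmetric] bond_shift bond_cell)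
    assume l: "l \<subseteq> R"
    have "(j, 0) \<notin> (?f \<circ> cell) ` l" for j
    proof
      assume "(j, 0) \<in> (?f \<circ> cell) ` l"
      then obtain t where "t \<in> l" "snd (cell t) + 1 = 0" by auto
      then show False using assms[of "cell t"] l by auto
    qed
    then have "(?f \<circ> cell) ` l \<noteq> {(j - 1, 0), (j, 0)}" for j by blast
    then show "bw ((?f \<circ> cell) ` l) = 1" by (simp only: bw_def) simp
  qed
  finally show ?thesis by (simp only: image_comp)
qed

section \<open>Polygons as sets of cells\<close>

text \<open>The crossing and winding numbers of the definition of polygons, expressed by cells. The path of
  \<open>cwind\<close> begins at an arbitrary point, so that it can be cut into pieces.\<close>

fun ccross :: "int \<times> int \<Rightarrow> point \<times> point \<Rightarrow> int" where
  "ccross (j, X) (p, q) =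
     (if fst p + fst q + j + 1 \<le> X then
        (if snd p = j + 1 \<and> snd q = j then 1 else if snd p = j \<and> snd q = j + 1 then - 1 else 0)
      else 0)"

definition cwind :: "int \<times> int \<Rightarrow> point \<Rightarrow> direction list \<Rightarrow> int" where
  "cwind v p ds = sum_list (map (ccross v) (walk p ds))"

lemma crossing_cell: "crossing t e = ccross (cell t) e"
  by (cases e; cases t) auto

lemma polygon_cells: "cell ` polygon ds = {v. cwind v (0, 0) ds \<noteq> 0}"
proof -
  show ?thesis
    by (rule cell_image_Collect) (simp add: polygon_def winding_def cwind_def crossing_cell[abs_def])
qed

lemma cwind_Nil [simp]: "cwind v p [] = 0"
  by (simp add: cwind_def)

lemma cwind_Cons [simp]: "cwind v p (d # ds) = ccross v (p, move d p) + cwind v (move d p) ds"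
  by (simp add: cwind_def)

lemma cwind_append [simp]: "cwind v p (ds @ es) = cwind v p ds + cwind v (fold move ds p) es"
  by (induction ds arbitrary: p) auto

lemma move_funpow [simp]:
  "(move East ^^ n) (a, b) = (a + int n, b)"
  "(move West ^^ n) (a, b) = (a - int n, b)"
  "(move NE ^^ n) (a, b) = (a, b + int n)"
  "(move NW ^^ n) (a, b) = (a - int n, b + int n)"
  "(move SE ^^ n) (a, b) = (a + int n, b - int n)"
  by (induction n) auto

lemma cwind_replicate [simp]:
  "cwind (j, X) (a, b) (replicate n East) = 0"
  "cwind (j, X) (a, b) (replicate n West) = 0"
  "cwind (j, X) (a, b) (replicate n NE) = (if b \<le> j \<and> j < b + int n \<and> 2 * a + j + 1 \<le> X then - 1 else 0)"
  "cwind (j, X) (a, b) (replicate n NW) = (if b \<le> j \<and> j < b + int n \<and> 2 * a + 2 * b - j \<le> X then - 1 else 0)"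
  "cwind (j, X) (a, b) (replicate n SE) = (if b - int n \<le> j \<and> j < b \<and> 2 * a + 2 * b - j \<le> X then 1 else 0)"
  by (induction n arbitrary: a b) auto

lemma zigzag_0 [simp]: "zigzag 0 = []"
  by (simp add: zigzag_def)

lemma zigzag_Suc: "zigzag (Suc m) = SW # SE # zigzag m"
  by (simp add: zigzag_def)

lemma fold_zigzag [simp]: "fold move (zigzag m) (a, b) = (a + int m, b - 2 * int m)"
  by (induction m arbitrary: a b) (auto simp: zigzag_Suc)

lemma cwind_zigzag [simp]:
  "cwind (j, X) (a, b) (zigzag m) = (if b - 2 * int m \<le> j \<and> j < b \<and> 2 * a + b \<le> X then 1 else 0)"
  by (induction m arbitrary: a b) (auto simp: zigzag_Suc)

text \<open>\<open>shadow j p q\<close> is the up-pointing triangle whose bottom row consists of the columns \<open>2 p, \<dots>, 2 q\<close> of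
  row \<open>j\<close>. The set \<open>left_shadow j q\<close> is bounded by the same line to the east and is unbounded to the
  west.\<close>

definition shadow :: "int \<Rightarrow> int \<Rightarrow> int \<Rightarrow> (int \<times> int) set" where
  "shadow j p q = {v. j \<le> fst v \<and> 2 * p + (fst v - j) \<le> snd v \<and> snd v \<le> 2 * q - (fst v - j)}"

definition left_shadow :: "int \<Rightarrow> int \<Rightarrow> (int \<times> int) set" where
  "left_shadow j q = {v. j \<le> fst v \<and> snd v \<le> 2 * q - (fst v - j)}"

lemma up_triangle_cells:
  "cell ` up_triangle (a, b) n = {v. b \<le> fst v \<and> 2 * a + fst v + 1 \<le> snd v \<and> snd v + fst v + 1 \<le> 2 * (a + b + int n)}"
proof (rule cell_image_Collect)
  fix t
  show "t \<in> up_triangle (a, b) n \<longleftrightarrow> b \<le> fst (cell t) \<and> 2 * a + fst (cell t) + 1 \<le> snd (cell t)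
      \<and> snd (cell t) + fst (cell t) + 1 \<le> 2 * (a + b + int n)"
    by (cases t) (auto simp: up_triangle_def triangles_in_def)
qed

lemma down_triangle_cells:
  "cell ` down_triangle (a, b) n = {v. fst v < b \<and> snd v \<le> 2 * (a + int n) + fst v \<and> 2 * (a + b) \<le> snd v + fst v}"
proof (rule cell_image_Collect)
  fix t
  show "t \<in> down_triangle (a, b) n \<longleftrightarrow> fst (cell t) < b \<and> snd (cell t) \<le> 2 * (a + int n) + fst (cell t)
      \<and> 2 * (a + b) \<le> snd (cell t) + fst (cell t)"
    by (cases t) (auto simp: down_triangle_def triangles_in_def)
qed

lemma left_part_cells:
  "cell ` left_part (a, b) = {v. b \<le> fst v \<and> snd v + fst v + 1 \<le> 2 * (a + b)}"
proof (rule cell_image_Collect)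
  fix t
  show "t \<in> left_part (a, b) \<longleftrightarrow> b \<le> fst (cell t) \<and> snd (cell t) + fst (cell t) + 1 \<le> 2 * (a + b)"
    by (cases t) (auto simp: left_part_def triangles_in_def)
qed

lemma cell_image_Diff: "cell ` (A - B) = cell ` A - cell ` B"
  by (rule image_set_diff[OF inj_cell])

lemma walk_zigzag:
  "set (walk (a, b) (zigzag m)) =
    (\<Union>k\<in>{..<m}. {((a + int k, b - 2 * int k), (a + int k, b - 2 * int k - 1)),
       ((a + int k, b - 2 * int k - 1), (a + int k + 1, b - 2 * int k - 2))})"
  (is "_ = (\<Union>k\<in>{..<m}. ?S a b k)")
proof (induction m arbitrary: a b)
  case (Suc m)
  have "?S (a + 1) (b - 2) k = ?S a b (Suc k)" for k by (simp add: algebra_simps)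
  then show ?case
    unfolding lessThan_Suc_eq_insert_0 zigzag_Suc by (simp add: Suc insert_commute)
qed simp

lemma walk_append: "walk p (ds @ es) = walk p ds @ walk (fold move ds p) es"
  by (induction ds arbitrary: p) auto

text \<open>The vertical lozenges with both left sides on the zigzag are those centred in column \<open>0\<close>, down to
  the row of the step SW that follows the zigzag.\<close>

lemma half_weight_zigzag:
  assumes F: "F = edges (zigzag m) \<or> F = edges (zigzag m @ [SW])"
    and l: "lozenge l"
    and rows: "\<And>v. v \<in> cell ` l \<Longrightarrow> fst v < 0 \<and> (snd v = 0 \<longrightarrow> - (2 * int m + 1) \<le> fst v)"
  shows "half_weight F l = bw (cell ` l)"
proof -
  have se: "{(i, j), (i + 1, j - 1)} \<in> F \<longleftrightarrow> (\<exists>k<m. i = int k \<and> j = - 2 * int k - 1)" for i j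
    using F by (auto simp: edges_def walk_append walk_zigzag doubleton_eq_iff image_iff)
  have sw: "(\<exists>k<m. i = int k \<and> j = - 2 * int k - 1) \<Longrightarrow> {(i, j), (i, j + 1)} \<in> F" for i j
    using F by (fastforce simp: edges_def walk_append walk_zigzag doubleton_eq_iff image_iff)
  have 1: "half_weight F l = (if \<exists>i j. l = {Up i j, Down i (j - 1)} \<and> (\<exists>k<m. i = int k \<and> j = - 2 * int k - 1) then 1 / 2 else 1)"
    unfolding half_weight_def using se sw by metis
  have "(\<exists>i j. l = {Up i j, Down i (j - 1)} \<and> (\<exists>k<m. i = int k \<and> j = - 2 * int k - 1))
      \<longleftrightarrow> (\<exists>j. cell ` l = {(j - 1, 0), (j, 0)})" (is "?L \<longleftrightarrow> ?R")
  proof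
    assume ?L
    then obtain k where "l = {Up (int k) (- 2 * int k - 1), Down (int k) (- 2 * int k - 1 - 1)}" by blast
    then have "cell ` l = {(- 2 * int k - 1 - 1, 0), (- 2 * int k - 1, 0)}" by auto
    then show ?R by blast
  next
    assume ?R
    then obtain j where j: "cell ` l = {(j - 1, 0), (j, 0)}" by blast
    from l obtain i j' where "l = {Up i j', Down i j'} \<or> l = {Up i j', Down (i - 1) j'} \<or> l = {Up i j', Down i (j' - 1)}"
      unfolding lozenge_iff by blast
    then have "l = {Up i j', Down i (j' - 1)} \<and> j' = j \<and> 2 * i + j' + 1 = 0"
      using j by (auto simp: doubleton_eq_iff)
    moreover have "j < 0" "- (2 * int m + 1) \<le> j - 1"
      using rows[of "(j, 0)"] rows[of "(j - 1, 0)"] j by auto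
    ultimately have "l = {Up i j', Down i (j' - 1)}" "nat i < m" "i = int (nat i)" "j' = - 2 * int (nat i) - 1"
      by auto
    then show ?L by blast
  qed
  then show ?thesis unfolding 1 bw_def by simp
qed

section \<open>Strips without the triangles above their dents\<close>

text \<open>The hypotheses on \<open>U\<close> in the lemma on forced lozenges.\<close>

definition forced_set :: "(int \<times> int) set \<Rightarrow> int \<Rightarrow> (int \<times> int) set \<Rightarrow> bool" where
  "forced_set S j U \<longleftrightarrow> U \<subseteq> S \<and> (\<forall>i X. (i, X) \<in> U \<longrightarrow> j \<le> i \<and>
     (even (X + i) \<longrightarrow> (i + 1, X) \<in> U \<and> (i, X + 1) \<in> U \<and> ((i, X - 1) \<in> U \<or> (i, X - 1) \<notin> S)) \<and>
     (odd (X + i) \<longrightarrow> i \<noteq> j \<longrightarrow> (i - 1, X) \<in> U))"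

lemma forced_setI:
  assumes "U \<subseteq> S" "\<And>i X. (i, X) \<in> U \<Longrightarrow> j \<le> i"
    and "\<And>i X. (i, X) \<in> U \<Longrightarrow> even (X + i) \<Longrightarrow>
      (i + 1, X) \<in> U \<and> (i, X + 1) \<in> U \<and> ((i, X - 1) \<in> U \<or> (i, X - 1) \<notin> S)"
    and "\<And>i X. (i, X) \<in> U \<Longrightarrow> odd (X + i) \<Longrightarrow> i \<noteq> j \<Longrightarrow> (i - 1, X) \<in> U"
  shows "forced_set S j U"
  using assms unfolding forced_set_def by simp

lemma forced_setD:
  assumes "forced_set S j U"
  shows "U \<subseteq> S" "(i, X) \<in> U \<Longrightarrow> j \<le> i"
    and "(i, X) \<in> U \<Longrightarrow> even (X + i) \<Longrightarrow>
      (i + 1, X) \<in> U \<and> (i, X + 1) \<in> U \<and> ((i, X - 1) \<in> U \<or> (i, X - 1) \<notin> S)"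
    and "(i, X) \<in> U \<Longrightarrow> odd (X + i) \<Longrightarrow> i \<noteq> j \<Longrightarrow> (i - 1, X) \<in> U"
  using assms unfolding forced_set_def by simp_all

lemma forced_set_UN:
  assumes "\<And>i. i \<in> I \<Longrightarrow> forced_set S j (U i)"
  shows "forced_set S j (\<Union>i\<in>I. U i)"
proof (rule forced_setI)
  show "(\<Union>i\<in>I. U i) \<subseteq> S" using forced_setD(1)[OF assms] by blast
  fix i X assume "(i, X) \<in> (\<Union>i\<in>I. U i)"
  then obtain a where a: "a \<in> I" "(i, X) \<in> U a" by blast
  show "j \<le> i" using forced_setD(2)[OF assms a(2)] a(1) .
  { assume "even (X + i)"
    then show "(i + 1, X) \<in> (\<Union>i\<in>I. U i) \<and> (i, X + 1) \<in> (\<Union>i\<in>I. U i)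
        \<and> ((i, X - 1) \<in> (\<Union>i\<in>I. U i) \<or> (i, X - 1) \<notin> S)"
      using forced_setD(3)[OF assms[OF a(1)] a(2)] a(1) by blast }
  { assume "odd (X + i)" "i \<noteq> j"
    then show "(i - 1, X) \<in> (\<Union>i\<in>I. U i)"
      using forced_setD(4)[OF assms[OF a(1)] a(2)] a(1) by blast }
qed

lemma forced_set_Un:
  assumes "forced_set S j U" "forced_set S j U'"
  shows "forced_set S j (U \<union> U')"
proof -
  have "forced_set S j (\<Union>b\<in>UNIV. if b then U else U')"
    by (rule forced_set_UN) (use assms in simp)
  then show ?thesis by (simp add: UNIV_bool Un_commute)
qed

lemma forced_shadow:
  assumes "odd j" "c \<le> 2 * p" "q \<le> n" "q - p < int R"
  shows "forced_set (strip c j R (2 * n)) j (shadow j p q)"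
proof -
  have "shadow j p q \<subseteq> strip c j R (2 * n)" using assms by (auto simp: shadow_def strip_def)
  moreover have "(i + 1, X) \<in> shadow j p q \<and> (i, X + 1) \<in> shadow j p q \<and> (i, X - 1) \<in> shadow j p q"
    if "(i, X) \<in> shadow j p q" "even (X + i)" for i X
  proof -
    have "2 * p + (i - j) \<noteq> X" "X \<noteq> 2 * q - (i - j)" using assms(1) that(2) by presburger+
    then show ?thesis using that(1) by (auto simp: shadow_def)
  qed
  moreover have "(i - 1, X) \<in> shadow j p q" if "(i, X) \<in> shadow j p q" "i \<noteq> j" for i X
    using that by (auto simp: shadow_def)
  moreover have "j \<le> i" if "(i, X) \<in> shadow j p q" for i X using that by (simp add: shadow_def)
  ultimately show ?thesis by (intro forced_setI) simp_all
qed

lemma forced_left_shadow: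
  assumes "odd j" "q \<le> n" "2 * q < int R"
  shows "forced_set (strip 0 j R (2 * n)) j (left_shadow j q \<inter> {v. 0 \<le> snd v})"
proof -
  let ?U = "left_shadow j q \<inter> {v. 0 \<le> snd v}" and ?S = "strip 0 j R (2 * n)"
  have "?U \<subseteq> ?S" using assms by (auto simp: left_shadow_def strip_def)
  moreover have "(i + 1, X) \<in> ?U \<and> (i, X + 1) \<in> ?U \<and> ((i, X - 1) \<in> ?U \<or> (i, X - 1) \<notin> ?S)"
    if "(i, X) \<in> ?U" "even (X + i)" for i X
  proof -
    have "X \<noteq> 2 * q - (i - j)" using assms(1) that(2) by presburger
    then show ?thesis using that(1) by (auto simp: left_shadow_def strip_def)
  qed
  moreover have "(i - 1, X) \<in> ?U" if "(i, X) \<in> ?U" "i \<noteq> j" for i X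
    using that by (auto simp: left_shadow_def)
  moreover have "j \<le> i" if "(i, X) \<in> ?U" for i X using that by (simp add: left_shadow_def)
  ultimately show ?thesis by (intro forced_setI) simp_all
qed

lemma mw_forced_set:
  assumes fin: "finite S" and U: "forced_set S j U" and E: "E \<inter> U = {}"
  shows "mw (S - {v\<in>U. fst v = j \<and> odd (snd v + fst v)} - E)
    = (\<Prod>v\<in>{v\<in>U. even (snd v + fst v)}. colw (snd v)) * mw (S - U - E)"
proof (rule mw_forced[OF fin])
  show "U \<subseteq> S" by (rule forced_setD(1)[OF U])
  show "j \<le> fst v" if "v \<in> U" for v
    using that by (cases v) (simp add: forced_setD(2)[OF U])
  fix i X assume X: "(i, X) \<in> U"
  { assume "even (X + i)"
    with forced_setD(3)[OF U X] show "(i + 1, X) \<in> U" "(i, X + 1) \<in> U" "(i, X - 1) \<in> U \<or> (i, X - 1) \<notin> S"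
      by simp_all }
  { assume "odd (X + i)" "i \<noteq> j"
    then show "(i - 1, X) \<in> U" by (rule forced_setD(4)[OF U X]) }
qed (rule E)

text \<open>\<open>blocks I p l\<close> consists of the positions \<open>p i, \<dots>, p i + l i - 1\<close> for the indices \<open>i\<close> in \<open>I\<close>, and
  \<open>shadows j I p l\<close> of the triangles above them.\<close>

definition blocks :: "nat set \<Rightarrow> (nat \<Rightarrow> nat) \<Rightarrow> (nat \<Rightarrow> nat) \<Rightarrow> nat set" where
  "blocks I p l = (\<Union>i\<in>I. {p i..<p i + l i})"

definition shadows :: "int \<Rightarrow> nat set \<Rightarrow> (nat \<Rightarrow> nat) \<Rightarrow> (nat \<Rightarrow> nat) \<Rightarrow> (int \<times> int) set" where
  "shadows j I p l = (\<Union>i\<in>I. shadow j (int (p i)) (int (p i) + int (l i) - 1))"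

lemma pcols_Un: "pcols (A \<union> B) = pcols A \<union> pcols B"
  by (auto simp: pcols_def)

lemma pcols_iff: "2 * int p \<in> pcols A \<longleftrightarrow> p \<in> A"
  by (auto simp: pcols_def)

lemma shadows_base:
  assumes "odd j"
  shows "{v \<in> shadows j I p l. fst v = j \<and> odd (snd v + fst v)} = {j} \<times> pcols (blocks I p l)"
proof (intro equalityI subsetI)
  fix v assume "v \<in> {v \<in> shadows j I p l. fst v = j \<and> odd (snd v + fst v)}"
  then obtain i X where v: "v = (j, X)" "i \<in> I" "2 * int (p i) \<le> X" "X \<le> 2 * (int (p i) + int (l i) - 1)" "odd (X + j)"
    by (cases v) (auto simp: shadows_def shadow_def)
  then have "even X" using assms by auto
  then obtain t where t: "X = 2 * t" by (rule evenE)
  have x: "X = 2 * int (nat t)" "p i \<le> nat t" "nat t < p i + l i" using v t by auto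
  then have "nat t \<in> blocks I p l" using v(2) by (auto simp: blocks_def)
  then show "v \<in> {j} \<times> pcols (blocks I p l)" unfolding v(1) x(1) by (simp only: mem_Sigma_iff pcols_iff) simp
next
  fix v assume "v \<in> {j} \<times> pcols (blocks I p l)"
  then obtain i r where "i \<in> I" "v = (j, 2 * int r)" "p i \<le> r" "r < p i + l i"
    by (auto simp: pcols_def blocks_def)
  then show "v \<in> {v \<in> shadows j I p l. fst v = j \<and> odd (snd v + fst v)}"
    using assms by (auto simp: shadows_def shadow_def intro!: bexI[of _ i])
qed

lemma left_shadow_base:
  assumes "odd j"
  shows "{v \<in> left_shadow j (int b) \<inter> {v. 0 \<le> snd v}. fst v = j \<and> odd (snd v + fst v)} = {j} \<times> pcols {0..b}"
proof (intro equalityI subsetI)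
  fix v assume "v \<in> {v \<in> left_shadow j (int b) \<inter> {v. 0 \<le> snd v}. fst v = j \<and> odd (snd v + fst v)}"
  then obtain X where v: "v = (j, X)" "0 \<le> X" "X \<le> 2 * int b" "odd (X + j)"
    by (cases v) (auto simp: left_shadow_def)
  then have "even X" using assms by auto
  then obtain t where t: "X = 2 * t" by (rule evenE)
  have x: "X = 2 * int (nat t)" "nat t \<in> {0..b}" using v t by auto
  then show "v \<in> {j} \<times> pcols {0..b}" unfolding v(1) x(1) by (simp only: mem_Sigma_iff pcols_iff) simp
next
  fix v assume "v \<in> {j} \<times> pcols {0..b}"
  then show "v \<in> {v \<in> left_shadow j (int b) \<inter> {v. 0 \<le> snd v}. fst v = j \<and> odd (snd v + fst v)}"
    using assms by (auto simp: pcols_def left_shadow_def)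
qed

lemma forced_shadows:
  assumes "odd j" "c \<in> {0, 1}" and I: "\<And>i. i \<in> I \<Longrightarrow> c \<le> int (p i) \<and> p i + l i \<le> n + 1 \<and> l i \<le> R"
  shows "forced_set (strip c j R (2 * int n)) j (shadows j I p l)"
  unfolding shadows_def
proof (rule forced_set_UN)
  fix i assume i: "i \<in> I"
  show "forced_set (strip c j R (2 * int n)) j (shadow j (int (p i)) (int (p i) + int (l i) - 1))"
    by (rule forced_shadow) (use assms I[OF i] in auto)
qed

text \<open>The removal of a triangle amounts to the removal of the up-pointing cells in its bottom row.\<close>

lemma mw_shadows:
  assumes j: "odd j" and c: "c \<in> {0, 1}"
    and I: "\<And>i. i \<in> I \<Longrightarrow> c \<le> int (p i) \<and> p i + l i \<le> n + 1 \<and> l i \<le> R"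
    and E: "E \<inter> blocks I p l = {}"
  shows "mw (strip c j R (2 * int n) - shadows j I p l - {j} \<times> pcols E)
    = sw c j R (2 * int n) (pcols (E \<union> blocks I p l))"
proof -
  let ?S = "strip c j R (2 * int n)" and ?U = "shadows j I p l"
  have base: "{v\<in>?U. fst v = j \<and> odd (snd v + fst v)} = {j} \<times> pcols (blocks I p l)"
    by (rule shadows_base[OF j])
  have dj: "({j} \<times> pcols E) \<inter> ?U = {}"
  proof (rule ccontr)
    assume "({j} \<times> pcols E) \<inter> ?U \<noteq> {}"
    then obtain e where e: "e \<in> E" "(j, 2 * int e) \<in> ?U" by (auto simp: pcols_def)
    then have "(j, 2 * int e) \<in> {j} \<times> pcols (blocks I p l)" using j unfolding base[symmetric] by auto
    then show False using e E by (auto simp: pcols_iff)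
  qed
  have "mw (?S - {j} \<times> pcols (blocks I p l) - {j} \<times> pcols E)
      = (\<Prod>v\<in>{v\<in>?U. even (snd v + fst v)}. colw (snd v)) * mw (?S - ?U - {j} \<times> pcols E)"
    using mw_forced_set[OF finite_strip forced_shadows[OF j c I] dj] unfolding base .
  also have "(\<Prod>v\<in>{v\<in>?U. even (snd v + fst v)}. colw (snd v)) = 1"
  proof (rule prod.neutral, rule ballI)
    fix v assume v: "v \<in> {v\<in>?U. even (snd v + fst v)}"
    then obtain i where i: "i \<in> I" "v \<in> shadow j (int (p i)) (int (p i) + int (l i) - 1)"
      by (auto simp: shadows_def)
    have "snd v \<noteq> 0"
    proof
      assume 0: "snd v = 0"
      then have "fst v = j" using i I[OF i(1)] by (auto simp: shadow_def)
      then show False using v j 0 by auto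
    qed
    then show "colw (snd v) = 1" by (simp add: colw_def)
  qed
  also have "?S - {j} \<times> pcols (blocks I p l) - {j} \<times> pcols E = ?S - {j} \<times> pcols (E \<union> blocks I p l)"
    by (auto simp: pcols_Un)
  finally show ?thesis by (simp add: sw_def)
qed

text \<open>The forced lozenges above the first \<open>b + 1\<close> positions contain \<open>b\<close> lozenges of weight \<open>1/2\<close>.\<close>

lemma mw_left_shadow:
  assumes j: "odd j"
    and I: "\<And>i. i \<in> I \<Longrightarrow> b < p i \<and> p i + l i \<le> n + 1 \<and> l i \<le> R"
    and b: "b \<le> n" "2 * b < R"
    and E: "E \<inter> (blocks I p l \<union> {0..b}) = {}"
  shows "mw (strip 0 j R (2 * int n) - (left_shadow j (int b) \<inter> {v. 0 \<le> snd v} \<union> shadows j I p l) - {j} \<times> pcols E)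
    = 2 ^ b * sw 0 j R (2 * int n) (pcols (E \<union> (blocks I p l \<union> {0..b})))"
proof -
  let ?L = "left_shadow j (int b) \<inter> {v. 0 \<le> snd v}"
  let ?S = "strip 0 j R (2 * int n)" and ?U = "?L \<union> shadows j I p l"
  have base: "{v\<in>?U. fst v = j \<and> odd (snd v + fst v)} = {j} \<times> pcols (blocks I p l \<union> {0..b})"
  proof -
    have "{v\<in>?U. fst v = j \<and> odd (snd v + fst v)}
        = {v\<in>?L. fst v = j \<and> odd (snd v + fst v)} \<union> {v\<in>shadows j I p l. fst v = j \<and> odd (snd v + fst v)}"
      unfolding Collect_disj_eq[symmetric] by (simp only: Un_iff conj_disj_distribR)
    also have "\<dots> = {j} \<times> (pcols {0..b} \<union> pcols (blocks I p l))"
      by (simp only: shadows_base[OF j] left_shadow_base[OF j] Sigma_Un_distrib2)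
    finally show ?thesis by (simp only: pcols_Un Un_commute)
  qed
  have fs: "forced_set ?S j ?U"
    by (intro forced_set_Un forced_left_shadow forced_shadows) (use j b I in \<open>auto simp: less_imp_le\<close>)
  have dj: "({j} \<times> pcols E) \<inter> ?U = {}"
  proof (rule ccontr)
    assume "({j} \<times> pcols E) \<inter> ?U \<noteq> {}"
    then obtain e where e: "e \<in> E" "(j, 2 * int e) \<in> ?U" by (auto simp: pcols_def)
    then have "(j, 2 * int e) \<in> {j} \<times> pcols (blocks I p l \<union> {0..b})" using j unfolding base[symmetric] by simp
    then have "e \<in> blocks I p l \<union> {0..b}" by (simp only: mem_Sigma_iff pcols_iff)
    then show False using e E by blast
  qed
  let ?W = "{v\<in>?U. even (snd v + fst v)}" and ?Z = "(\<lambda>i. (j + 2 * int i + 1, 0)) ` {..<b}"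
  have "mw (?S - {j} \<times> pcols (blocks I p l \<union> {0..b}) - {j} \<times> pcols E)
      = (\<Prod>v\<in>?W. colw (snd v)) * mw (?S - ?U - {j} \<times> pcols E)"
    using mw_forced_set[OF finite_strip fs dj] unfolding base .
  also have "(\<Prod>v\<in>?W. colw (snd v)) = (\<Prod>v\<in>?Z. colw (snd v))"
  proof (rule prod.mono_neutral_right)
    have "?U \<subseteq> ?S" using fs by (auto simp: forced_set_def)
    then show "finite ?W" using finite_strip[of 0 j R "2 * int n"] by (auto intro: finite_subset)
    show "?Z \<subseteq> ?W" using j by (auto simp: left_shadow_def)
    show "\<forall>v\<in>?W - ?Z. colw (snd v) = 1"
    proof
      fix v assume v: "v \<in> ?W - ?Z"
      have "snd v \<noteq> 0"
      proof
        assume 0: "snd v = 0"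
        have "v \<notin> shadows j I p l" using 0 I by (fastforce simp: shadows_def shadow_def)
        then have w: "j \<le> fst v" "0 \<le> 2 * int b - (fst v - j)" "even (fst v)"
          using v 0 by (auto simp: left_shadow_def)
        then have "odd (fst v - j)" using j by simp
        then obtain t where t: "fst v - j = 2 * t + 1" by (rule oddE)
        then have "v = (j + 2 * int (nat t) + 1, 0)" "nat t < b" using w 0 by (auto simp: prod_eq_iff)
        then show False using v by blast
      qed
      then show "colw (snd v) = 1" by (simp add: colw_def)
    qed
  qed
  also have "(\<Prod>v\<in>?Z. colw (snd v)) = (1 / 2) ^ b"
    by (subst prod.reindex) (auto simp: inj_on_def colw_def)
  also have "?S - {j} \<times> pcols (blocks I p l \<union> {0..b}) - {j} \<times> pcols E
      = ?S - {j} \<times> pcols (E \<union> (blocks I p l \<union> {0..b}))"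
    by (auto simp: pcols_Un)
  finally show ?thesis by (simp add: sw_def power_divide)
qed

lemma mw_reflect: "mw ((\<lambda>v. (h - fst v, snd v)) ` R) = mw R" if "odd h"
proof -
  let ?f = "\<lambda>v :: int \<times> int. (h - fst v, snd v)"
  have fwd: "bond (?f ` l)" if "bond l" for l
    using that
  proof (cases rule: bond_cases)
    case (horizontal j X)
    then have "?f ` l = {(h - j, X), (h - j, X + 1)}" by simp
    then show ?thesis unfolding bond_def by blast
  next
    case (vertical j X)
    then have "?f ` l = {(h - j + 1 - 1, X), (h - j + 1, X)}" "odd (X + (h - j + 1))"
      using \<open>odd h\<close> by auto
    then show ?thesis unfolding bond_def by blast
  qed
  have inv: "?f ` ?f ` l = l" for l by (simp add: image_image)
  have wfwd: "bw (?f ` l) = 1 / 2" if "bw l = 1 / 2" for l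
  proof -
    have "\<exists>j. l = {(j - 1, 0), (j, 0)}"
      using that unfolding bw_def by (rule contrapos_pp) simp
    then obtain j where "l = {(j - 1, 0), (j, 0)}" by blast
    then have "?f ` l = {(h - j + 1 - 1, 0), (h - j + 1, 0)}" by auto
    then have "\<exists>j. ?f ` l = {(j - 1, 0), (j, 0)}" by blast
    then show ?thesis unfolding bw_def by (rule if_P)
  qed
  have w: "bw (?f ` l) = bw l" for l
  proof (cases "bw l = 1 / 2")
    case False
    then have "bw l = 1" by (auto simp: bw_def split: if_splits)
    moreover have "bw (?f ` l) \<noteq> 1 / 2" using wfwd[of "?f ` l"] inv[of l] False by auto
    then have "bw (?f ` l) = 1" by (auto simp: bw_def split: if_splits)
    ultimately show ?thesis by simp
  qed (simp add: wfwd)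
  show ?thesis unfolding mw_def
  proof (rule msum_transport)
    show "inj_on ?f R" by (auto simp: inj_on_def prod_eq_iff)
    show "bond (?f ` l) \<longleftrightarrow> bond l" for l using fwd[of l] fwd[of "?f ` l"] inv[of l] by auto
  qed (rule w)
qed

section \<open>Positions of the marked segments\<close>

text \<open>\<open>oddpos t\<close> and \<open>evenpos t\<close> are the positions, numbered from \<open>1\<close>, of the unit segments that
  make up the odd-numbered and the even-numbered segments.\<close>

definition oddpos :: "nat list \<Rightarrow> nat set" where
  "oddpos t = blocks {i\<in>{1..length t}. odd i} (\<lambda>i. s_sum (i - 1) t + 1) (entry t)"

definition evenpos :: "nat list \<Rightarrow> nat set" where
  "evenpos t = blocks {i\<in>{1..length t}. even i} (\<lambda>i. s_sum (i - 1) t + 1) (entry t)"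

lemma s_sum_Suc: "s_sum (Suc i) t = s_sum i t + entry t (Suc i)"
  by (simp add: s_sum_def)

lemma s_sum_0 [simp]: "s_sum 0 t = 0"
  by (simp add: s_sum_def)

lemma s_sum_pred: "0 < i \<Longrightarrow> s_sum i t = s_sum (i - 1) t + entry t i"
  by (cases i) (auto simp: s_sum_Suc)

lemma s_sum_mono: "i \<le> k \<Longrightarrow> s_sum i t \<le> s_sum k t"
  unfolding s_sum_def by (rule sum_mono2) auto

lemma odd_even_sum: "odd_sum t + even_sum t = s_sum (length t) t"
proof -
  have "odd_sum t + even_sum t
      = sum (entry t) ({i \<in> {1..length t}. odd i} \<union> {i \<in> {1..length t}. even i})"
    unfolding odd_sum_def even_sum_def by (rule sum.union_disjoint[symmetric]) auto
  also have "{i \<in> {1..length t}. odd i} \<union> {i \<in> {1..length t}. even i} = {1..length t}" by auto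
  finally show ?thesis by (simp add: s_sum_def)
qed

lemma blocks_disjoint:
  assumes "0 < i" "i < k"
  shows "{s_sum (i - 1) t + 1..<s_sum (i - 1) t + 1 + entry t i} \<inter> {s_sum (k - 1) t + 1..<s_sum (k - 1) t + 1 + entry t k} = {}"
proof -
  have "s_sum (i - 1) t + entry t i = s_sum i t" using assms s_sum_pred[of i t] by simp
  moreover have "s_sum i t \<le> s_sum (k - 1) t" using assms by (intro s_sum_mono) simp
  ultimately show ?thesis by auto
qed

lemma card_blocks:
  assumes "finite I" "0 \<notin> I"
  shows "card (blocks I (\<lambda>i. s_sum (i - 1) t + 1) (entry t)) = sum (entry t) I"
proof -
  have "card (blocks I (\<lambda>i. s_sum (i - 1) t + 1) (entry t))
      = (\<Sum>i\<in>I. card {s_sum (i - 1) t + 1..<s_sum (i - 1) t + 1 + entry t i})"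
    unfolding blocks_def
  proof (rule card_UN_disjoint[OF assms(1)])
    show "\<forall>i\<in>I. \<forall>k\<in>I. i \<noteq> k \<longrightarrow>
      {s_sum (i - 1) t + 1..<s_sum (i - 1) t + 1 + entry t i} \<inter> {s_sum (k - 1) t + 1..<s_sum (k - 1) t + 1 + entry t k} = {}"
    proof (intro ballI impI)
      fix i k assume ik: "i \<in> I" "k \<in> I" "i \<noteq> k"
      then have "0 < i" "0 < k" using assms(2) by (auto intro: gr0I)
      then show "{s_sum (i - 1) t + 1..<s_sum (i - 1) t + 1 + entry t i}
          \<inter> {s_sum (k - 1) t + 1..<s_sum (k - 1) t + 1 + entry t k} = {}"
        using blocks_disjoint[of i k t] blocks_disjoint[of k i t] ik(3)
        by (cases "i < k") (auto simp: Int_commute)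
    qed
  qed simp
  then show ?thesis by simp
qed

lemma card_oddpos: "card (oddpos t) = odd_sum t"
  unfolding oddpos_def odd_sum_def by (rule card_blocks) auto

lemma card_evenpos: "card (evenpos t) = even_sum t"
  unfolding evenpos_def even_sum_def by (rule card_blocks) auto

lemma blocks_Un: "blocks (I \<union> J) p l = blocks I p l \<union> blocks J p l"
  by (auto simp: blocks_def)

lemma blocks_cong: "(\<And>i. i \<in> I \<Longrightarrow> p i = p' i \<and> l i = l' i) \<Longrightarrow> blocks I p l = blocks I p' l'"
  by (simp add: blocks_def)

lemma blocks_upto: "blocks {1..k} (\<lambda>i. s_sum (i - 1) t + 1) (entry t) = {1..s_sum k t}"
proof (induction k)
  case (Suc k)
  have "{1..Suc k} = {1..k} \<union> {Suc k}" by auto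
  then show ?case by (simp only: blocks_Un Suc) (auto simp: blocks_def s_sum_Suc)
qed (simp add: blocks_def)

lemma oddpos_Un_evenpos: "oddpos t \<union> evenpos t = {1..s_sum (length t) t}"
proof -
  have "{i\<in>{1..length t}. odd i} \<union> {i\<in>{1..length t}. even i} = {1..length t}" by auto
  then show ?thesis unfolding oddpos_def evenpos_def blocks_Un[symmetric] by (simp only: blocks_upto)
qed

lemma oddpos_Int_evenpos: "oddpos t \<inter> evenpos t = {}"
proof -
  have fin: "finite (oddpos t)" "finite (evenpos t)" by (auto simp: oddpos_def evenpos_def blocks_def)
  have "card (oddpos t \<union> evenpos t) + card (oddpos t \<inter> evenpos t) = card (oddpos t) + card (evenpos t)"
    using card_Un_Int[OF fin] by simp
  then have "card (oddpos t \<inter> evenpos t) = 0"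
    by (simp add: oddpos_Un_evenpos card_oddpos card_evenpos odd_even_sum)
  then show ?thesis using fin by simp
qed

lemma finite_oddpos [simp]: "finite (oddpos t)" and finite_evenpos [simp]: "finite (evenpos t)"
  by (auto simp: oddpos_def evenpos_def blocks_def)

lemma entry_le_odd_sum: "i \<in> {1..length t} \<Longrightarrow> odd i \<Longrightarrow> entry t i \<le> odd_sum t"
  unfolding odd_sum_def by (rule member_le_sum) auto

lemma entry_le_even_sum: "i \<in> {1..length t} \<Longrightarrow> even i \<Longrightarrow> entry t i \<le> even_sum t"
  unfolding even_sum_def by (rule member_le_sum) auto

lemma block_end: "i \<in> {1..length t} \<Longrightarrow> s_sum (i - 1) t + entry t i \<le> s_sum (length t) t"
  using s_sum_pred[of i t] s_sum_mono[of i "length t" t] by simp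

lemma oddpos_first: "t \<noteq> [] \<Longrightarrow> oddpos t = {1..hd t} \<union> blocks {i\<in>{3..length t}. odd i} (\<lambda>i. s_sum (i - 1) t + 1) (entry t)"
proof -
  assume t: "t \<noteq> []"
  have "i \<in> {i\<in>{1..length t}. odd i} \<longleftrightarrow> i \<in> {1} \<union> {i\<in>{3..length t}. odd i}" for i
  proof -
    have "i \<noteq> 2" if "odd i" using that by auto
    then show ?thesis using t by (cases t) auto
  qed
  then have I: "{i\<in>{1..length t}. odd i} = {1} \<union> {i\<in>{3..length t}. odd i}" by blast
  have "blocks {1} (\<lambda>i. s_sum (i - 1) t + 1) (entry t) = {1..hd t}"
    using t by (auto simp: blocks_def entry_def hd_conv_nth)
  then show ?thesis unfolding oddpos_def I blocks_Un by simp
qed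

section \<open>Tiling numbers of the regions\<close>

text \<open>Each of the regions for \<open>K'\<close>, \<open>Q\<close>, \<open>P\<close> and \<open>P'\<close> is a strip without the triangles above some of its
  positions. In the polygon for \<open>P\<close> or \<open>P'\<close> such a triangle, at the right end of the strip, is cut off by
  the side of direction northeast. In the polygon for \<open>P' y (y + 2 b + 1) c\<close> the steps southeast after the
  zigzag cut off half of a triangle, above the first \<open>b + 1\<close> positions.\<close>

lemma dents_cells:
  "cell ` dents (a, b) t = (\<Union>i\<in>{i\<in>{1..length t}. even i}. {v. b \<le> fst v \<and>
     2 * (a + int (s_sum (i - 1) t)) + fst v + 1 \<le> snd v \<and>
     snd v + fst v + 1 \<le> 2 * (a + int (s_sum (i - 1) t) + b + int (entry t i))})"
  unfolding dents_def image_UN shift_east_def fst_conv snd_conv up_triangle_cells ..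

lemma shadow_eq:
  "2 * a = - 1 - b \<Longrightarrow> {v. b \<le> fst v \<and> 2 * (a + s) + fst v + 1 \<le> snd v \<and> snd v + fst v + 1 \<le> 2 * (a + s + b + l)}
    = shadow b s (s + l - 1)"
  by (rule Set.set_eqI) (auto simp: shadow_def)

lemma card_even_blocks: "card (blocks {i\<in>{1..length t}. even i} (\<lambda>i. s_sum (i - 1) t) (entry t)) = even_sum t"
proof -
  have "evenpos t = Suc ` blocks {i\<in>{1..length t}. even i} (\<lambda>i. s_sum (i - 1) t) (entry t)"
    unfolding evenpos_def blocks_def image_UN by (intro SUP_cong refl) (simp add: image_Suc_atLeastLessThan)
  then show ?thesis using card_evenpos[of t] by (simp add: card_image)
qed

lemma K'_formula:
  assumes "even_sum t \<ge> 1"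
  shows "K' t = ucoef (even_sum t - 1) * Dlt (blocks {i\<in>{1..length t}. even i} (\<lambda>i. s_sum (i - 1) t) (entry t))"
proof -
  define m where "m = even_sum t - 1"
  define n where "n = m + odd_sum t"
  let ?b = "- (2 * int m + 1)" and ?I = "{i\<in>{1..length t}. even i}"
  let ?S = "strip 0 ?b (Suc (2 * m)) (2 * int n)"
  have E: "even_sum t = Suc m" using assms m_def by simp
  have L: "s_sum (length t) t = Suc n" using odd_even_sum[of t] E n_def by simp
  have ep: "endpoint (K_zigzag t) = (int m, ?b)"
    by (simp add: endpoint_def K_zigzag_def E)
  have poly: "cell ` polygon (K_zigzag t @ replicate (even_sum t + odd_sum t) East
       @ replicate (2 * even_sum t - 1) NW @ replicate (odd_sum t) West) = ?S"
    by (rule Set.set_eqI) (auto simp: polygon_cells K_zigzag_def E strip_def n_def simp del: replicate_Suc split: if_splits)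
  have dents: "cell ` dents (endpoint (K_zigzag t)) t = shadows ?b ?I (\<lambda>i. s_sum (i - 1) t) (entry t)"
    unfolding ep dents_cells shadows_def by (intro SUP_cong refl shadow_eq) simp
  have cells: "cell ` K_region t = ?S - shadows ?b ?I (\<lambda>i. s_sum (i - 1) t) (entry t)"
    unfolding K_region_def cell_image_Diff poly dents ..
  have "K' t = mw (cell ` K_region t)"
    unfolding K'_def
  proof (rule weighted_count_cells)
    fix l assume l: "l \<subseteq> K_region t" "lozenge l"
    show "half_weight (edges (K_zigzag t)) l = bw (cell ` l)"
    proof (rule half_weight_zigzag[OF _ l(2)])
      show "edges (K_zigzag t) = edges (zigzag m) \<or> edges (K_zigzag t) = edges (zigzag m @ [SW])"
        by (simp add: K_zigzag_def E)
      fix v assume "v \<in> cell ` l"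
      then have "v \<in> ?S" using l(1) cells by blast
      then show "fst v < 0 \<and> (snd v = 0 \<longrightarrow> - (2 * int m + 1) \<le> fst v)" by (auto simp: strip_def)
    qed
  qed
  also have "\<dots> = mw (?S - shadows ?b ?I (\<lambda>i. s_sum (i - 1) t) (entry t) - {?b} \<times> pcols {})"
    by (simp add: cells pcols_def)
  also have "\<dots> = sw 0 ?b (Suc (2 * m)) (2 * int n) (pcols ({} \<union> blocks ?I (\<lambda>i. s_sum (i - 1) t) (entry t)))"
  proof (rule mw_shadows)
    fix i assume "i \<in> ?I"
    then show "0 \<le> int (s_sum (i - 1) t) \<and> s_sum (i - 1) t + entry t i \<le> n + 1 \<and> entry t i \<le> Suc (2 * m)"
      using block_end[of i t] entry_le_even_sum[of i t] L E by simp
  qed auto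
  also have "\<dots> = (if card ({} \<union> blocks ?I (\<lambda>i. s_sum (i - 1) t) (entry t)) = Suc m
      then ucoef m * Dlt ({} \<union> blocks ?I (\<lambda>i. s_sum (i - 1) t) (entry t)) else 0)"
  proof (rule strip_up)
    show "{} \<union> blocks ?I (\<lambda>i. s_sum (i - 1) t) (entry t) \<subseteq> {0..n}"
      using block_end[of _ t] L by (fastforce simp: blocks_def)
  qed (auto simp: n_def)
  also have "card ({} \<union> blocks ?I (\<lambda>i. s_sum (i - 1) t) (entry t)) = Suc m"
    using card_even_blocks[of t] E by simp
  finally show ?thesis by (simp add: m_def)
qed

lemma shift_image_iff: "v \<in> (\<lambda>v :: int \<times> int. (fst v + 1, snd v + 1)) ` A \<longleftrightarrow> (fst v - 1, snd v - 1) \<in> A"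
  by (force simp: image_iff)

lemma shift_image_Diff: "(\<lambda>v :: int \<times> int. (fst v + 1, snd v + 1)) ` (A - B)
    = (\<lambda>v. (fst v + 1, snd v + 1)) ` A - (\<lambda>v. (fst v + 1, snd v + 1)) ` B"
  by (rule image_set_diff) (auto simp: inj_on_def prod_eq_iff)

lemma shadow_eq_shift:
  "2 * a = - b \<Longrightarrow> (\<lambda>v. (fst v + 1, snd v + 1)) `
      {v. b \<le> fst v \<and> 2 * (a + s) + fst v + 1 \<le> snd v \<and> snd v + fst v + 1 \<le> 2 * (a + s + b + l)}
    = shadow (b + 1) (s + 1) (s + 1 + l - 1)"
  by (rule Set.set_eqI) (auto simp: shadow_def shift_image_iff)

lemma Q_formula: "Q t = lcoef (even_sum t) * Dlt1 (evenpos t)"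
proof -
  define m where "m = even_sum t"
  define n where "n = m + odd_sum t"
  let ?b = "1 - 2 * int m" and ?I = "{i\<in>{1..length t}. even i}"
  let ?S = "strip 1 ?b (2 * m) (2 * int n)" and ?f = "\<lambda>v :: int \<times> int. (fst v + 1, snd v + 1)"
  have L: "s_sum (length t) t = n" using odd_even_sum[of t] by (simp add: m_def n_def)
  have ep: "endpoint (zigzag m) = (int m, - 2 * int m)"
    by (simp add: endpoint_def)
  have "cell ` polygon (zigzag m @ replicate (m + odd_sum t) East @ replicate (2 * m) NW @ replicate (odd_sum t) West)
      = strip 0 (- 2 * int m) (2 * m) (2 * int n - 1)"
    by (rule Set.set_eqI) (auto simp: polygon_cells strip_def n_def simp del: replicate_Suc split: if_splits)
  moreover have "?f ` strip 0 (- 2 * int m) (2 * m) (2 * int n - 1) = ?S"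
    by (rule Set.set_eqI) (auto simp: shift_image_iff strip_def)
  moreover have "?f ` cell ` dents (endpoint (zigzag m)) t = shadows ?b ?I (\<lambda>i. s_sum (i - 1) t + 1) (entry t)"
    unfolding ep dents_cells shadows_def image_UN by (intro SUP_cong refl, subst shadow_eq_shift) (auto simp: add_ac)
  ultimately have cells: "?f ` cell ` Q_region t = ?S - shadows ?b ?I (\<lambda>i. s_sum (i - 1) t + 1) (entry t)"
    unfolding Q_region_def cell_image_Diff shift_image_Diff m_def by simp
  have "Q t = mw (?f ` cell ` Q_region t)"
    unfolding Q_def
  proof (rule card_tilings_cells)
    fix v assume "v \<in> cell ` Q_region t"
    then have "?f v \<in> ?S" using cells by blast
    then show "0 \<le> snd v" by (simp add: strip_def)
  qed
  also have "\<dots> = mw (?S - shadows ?b ?I (\<lambda>i. s_sum (i - 1) t + 1) (entry t) - {?b} \<times> pcols {})"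
    by (simp add: cells pcols_def)
  also have "\<dots> = sw 1 ?b (2 * m) (2 * int n) (pcols ({} \<union> blocks ?I (\<lambda>i. s_sum (i - 1) t + 1) (entry t)))"
  proof (rule mw_shadows)
    fix i assume "i \<in> ?I"
    then show "1 \<le> int (s_sum (i - 1) t + 1) \<and> s_sum (i - 1) t + 1 + entry t i \<le> n + 1 \<and> entry t i \<le> 2 * m"
      using block_end[of i t] entry_le_even_sum[of i t] L m_def by simp
  qed auto
  also have "{} \<union> blocks ?I (\<lambda>i. s_sum (i - 1) t + 1) (entry t) = evenpos t" by (simp add: evenpos_def)
  also have "sw 1 ?b (2 * m) (2 * int n) (pcols (evenpos t)) = sw 1 ?b (2 * card (evenpos t)) (2 * int n) (pcols (evenpos t))"
    by (simp add: card_evenpos m_def)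
  also have "\<dots> = lcoef (card (evenpos t)) * Dlt1 (evenpos t)"
  proof (rule strip_low)
    show "evenpos t \<subseteq> {1..n}" using oddpos_Un_evenpos[of t] L by auto
    show "card (evenpos t) \<le> n" by (simp add: card_evenpos n_def m_def)
  qed simp
  finally show ?thesis by (simp add: card_evenpos)
qed

lemma P_formula: "P u u c = lcoef u * Dlt1 {c + 1..c + u}"
proof -
  let ?b = "1 - 2 * int u" and ?n = "c + u"
  let ?S = "strip 1 ?b (2 * u) (2 * int ?n)" and ?f = "\<lambda>v :: int \<times> int. (fst v + 1, snd v + 1)"
  let ?U = "shadows ?b {0} (\<lambda>i. c + 1) (\<lambda>i. u)"
  have blk: "blocks {0} (\<lambda>i. c + 1) (\<lambda>i. u) = {c + 1..c + u}" by (auto simp: blocks_def)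
  have cells: "?f ` cell ` polygon (P_path u u c) = ?S - ?U"
    by (rule Set.set_eqI)
      (auto simp: P_path_def polygon_cells shift_image_iff strip_def shadows_def shadow_def split: if_splits)
  have "P u u c = mw (?f ` cell ` polygon (P_path u u c))"
    unfolding P_def
  proof (rule card_tilings_cells)
    fix v assume "v \<in> cell ` polygon (P_path u u c)"
    then have "?f v \<in> ?S" using cells by blast
    then show "0 \<le> snd v" by (simp add: strip_def)
  qed
  also have "\<dots> = mw (?S - ?U - {?b} \<times> pcols {})" by (simp add: cells pcols_def)
  also have "\<dots> = sw 1 ?b (2 * u) (2 * int ?n) (pcols ({} \<union> blocks {0} (\<lambda>i. c + 1) (\<lambda>i. u)))"
    by (rule mw_shadows) auto
  also have "\<dots> = sw 1 ?b (2 * card {c + 1..c + u}) (2 * int ?n) (pcols {c + 1..c + u})" using blk by simp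
  also have "\<dots> = lcoef (card {c + 1..c + u}) * Dlt1 {c + 1..c + u}"
    by (rule strip_low) auto
  finally show ?thesis by simp
qed

lemma P'_formula: "P' y (y + 2 * b + 1) c = 2 ^ b * ucoef (y + b) * Dlt ({0..b} \<union> {b + c + 1..b + c + y})"
proof -
  let ?m = "y + b"
  let ?n = "?m + c" and ?j = "- (2 * int ?m + 1)"
  let ?S = "strip 0 ?j (Suc (2 * ?m)) (2 * int ?n)"
  let ?I = "{0 :: nat}" and ?p = "\<lambda>i :: nat. b + c + 1" and ?l = "\<lambda>i :: nat. y"
  let ?U = "left_shadow ?j (int b) \<inter> {v. 0 \<le> snd v} \<union> shadows ?j ?I ?p ?l"
  have blk: "blocks ?I ?p ?l \<union> {0..b} = {0..b} \<union> {b + c + 1..b + c + y}" by (auto simp: blocks_def)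
  have cells: "cell ` polygon (P_path y (y + 2 * b + 1) c) = ?S - ?U"
    by (rule Set.set_eqI)
      (auto simp: P_path_def polygon_cells strip_def shadows_def shadow_def left_shadow_def simp del: replicate_Suc split: if_splits)
  have col0: "- (2 * int y + 1) \<le> fst v" if "v \<in> cell ` polygon (P_path y (y + 2 * b + 1) c)" "snd v = 0" for v
    using that unfolding cells by (auto simp: strip_def left_shadow_def)
  have "P' y (y + 2 * b + 1) c = mw (cell ` polygon (P_path y (y + 2 * b + 1) c))"
    unfolding P'_def
  proof (rule weighted_count_cells)
    fix l assume l: "l \<subseteq> polygon (P_path y (y + 2 * b + 1) c)" "lozenge l"
    show "half_weight (edges (zigzag y)) l = bw (cell ` l)"
    proof (rule half_weight_zigzag[OF _ l(2)])
      fix v assume "v \<in> cell ` l"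
      then have v: "v \<in> cell ` polygon (P_path y (y + 2 * b + 1) c)" using l(1) by blast
      then have "v \<in> ?S" using cells by blast
      then show "fst v < 0 \<and> (snd v = 0 \<longrightarrow> - (2 * int y + 1) \<le> fst v)"
        using col0[OF v] by (auto simp: strip_def)
    qed simp
  qed
  also have "\<dots> = mw (?S - ?U - {?j} \<times> pcols {})" unfolding cells by (simp add: pcols_def)
  also have "\<dots> = 2 ^ b * sw 0 ?j (Suc (2 * ?m)) (2 * int ?n) (pcols ({} \<union> (blocks ?I ?p ?l \<union> {0..b})))"
    by (rule mw_left_shadow) auto
  also have "{} \<union> (blocks ?I ?p ?l \<union> {0..b}) = {0..b} \<union> {b + c + 1..b + c + y}" by (simp only: blk Un_empty_left)
  also have "sw 0 ?j (Suc (2 * ?m)) (2 * int ?n) (pcols ({0..b} \<union> {b + c + 1..b + c + y}))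
      = (if card ({0..b} \<union> {b + c + 1..b + c + y}) = Suc ?m then ucoef ?m * Dlt ({0..b} \<union> {b + c + 1..b + c + y}) else 0)"
    by (rule strip_up) auto
  also have "card ({0..b} \<union> {b + c + 1..b + c + y}) = Suc ?m"
    by (subst card_Un_disjoint) auto
  finally show ?thesis by simp
qed

lemma H5_polygon_cells:
  fixes x y z :: nat and as :: "nat list" and i X :: int
  defines "b \<equiv> - (2 * int (y + odd_sum as) + 1)" and "e \<equiv> z + even_sum as"
  shows "(i, X) \<in> cell ` H5_polygon x y z as \<longleftrightarrow> b - 2 * int e \<le> i \<and> i < 0 \<and> (b \<le> i \<longrightarrow> 0 \<le> X) \<and>
    (i < b \<longrightarrow> 1 \<le> X) \<and> X \<le> 2 * int (x + even_sum as) - i - 1 \<and>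
    X \<le> 2 * int (x + odd_sum as) + 1 + (i - (b - 2 * int e))"
proof -
  let ?B = "b - 2 * int e"
  define c where "c = ?B + int (y + z + 2 * even_sum as)"
  have c: "c = - int (y + z + 2 * odd_sum as + 1)" by (simp add: c_def b_def e_def)
  have w: "cwind (i, X) (0, 0) (H5_upper_zigzag y as @ [East] @ zigzag (z + even_sum as)
       @ replicate (x + odd_sum as) East @ replicate (y + z + 2 * even_sum as) NE
       @ replicate (y + z + 2 * odd_sum as + 1) NW @ replicate (x + even_sum as) West)
    = (if b \<le> i \<and> i < 0 \<and> 0 \<le> X then 1 else 0) + (if ?B \<le> i \<and> i < b \<and> 1 \<le> X then 1 else 0)
      + (if ?B \<le> i \<and> i < c \<and> 2 * int (x + odd_sum as) + 1 + (i - ?B) < X then - 1 else 0)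
      + (if c \<le> i \<and> i < 0 \<and> 2 * int (x + even_sum as) - i - 1 < X then - 1 else 0)"
    unfolding H5_upper_zigzag_def c_def
    by (simp add: b_def e_def algebra_simps del: replicate_Suc)
  have ord: "?B \<le> c" "c < 0" "b < 0" "?B \<le> b" using c by (simp_all add: c_def b_def)
  consider "i < ?B \<or> 0 \<le> i" | "b \<le> i" "i < 0" "i < c" | "b \<le> i" "i < 0" "c \<le> i"
    | "?B \<le> i" "i < b" "i < c" | "?B \<le> i" "i < b" "c \<le> i" by linarith
  then show ?thesis
    unfolding H5_polygon_def polygon_cells mem_Collect_eq w
    by cases (use ord c in \<open>auto simp: b_def e_def\<close>)
qed

lemma shadows_base_iff:
  assumes "odd j"
  shows "(j, 2 * int q) \<in> shadows j I p l \<longleftrightarrow> q \<in> blocks I p l"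
proof -
  have "(j, 2 * int q) \<in> shadows j I p l \<longleftrightarrow>
      (j, 2 * int q) \<in> {v \<in> shadows j I p l. fst v = j \<and> odd (snd v + fst v)}"
    using assms by simp
  then show ?thesis unfolding shadows_base[OF assms] mem_Sigma_iff pcols_iff by simp
qed

text \<open>Cutting along the horizontal line through \<open>W\<^sub>0\<close> gives two dented strips, one above the line and
  one, upside down, below it. They share the set \<open>S\<close> of positions at which vertical lozenges cross
  the line to the right of the marked segments. If the eastern corner of the
  polygon lies above (below) the line, then the triangle that is missing at the right end of the
  upper (lower) strip amounts to \<open>\<bar>y - z\<bar>\<close> additional dents. The power of \<open>2\<close> comes from the forced
  lozenges of weight \<open>1/2\<close> in the half triangle above the first segment.\<close>

lemma M_H5_formula:
  fixes x y z :: nat and as :: "nat list"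
  assumes as: "as \<noteq> []"
  defines "n \<equiv> s_sum (length as) as" and "r \<equiv> min y z"
  shows "M_H5 x y z as = 2 ^ hd as * (ucoef (y + odd_sum as) * lcoef (z + even_sum as)) *
    (\<Sum>S | S \<subseteq> {n + 1..n + x + r} \<and> card S = r.
       Dlt (insert 0 (oddpos as) \<union> S \<union> {n + x + z + 1..n + x + y}) *
       Dlt1 (evenpos as \<union> S \<union> {n + x + y + 1..n + x + z}))"
proof -
  define A where "A = hd as"
  define m where "m = y + odd_sum as"
  define e where "e = z + even_sum as"
  define b where "b = - (2 * int m + 1)"
  define M where "M = n + x"
  let ?IO = "{i\<in>{3..length as}. odd i}" and ?IE = "{i\<in>{1..length as}. even i}"
  let ?p = "\<lambda>i. s_sum (i - 1) as + 1" and ?l = "entry as"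
  define pU where "pU = (\<lambda>i. if i = 0 then M + r + 1 else ?p i)"
  define lU where "lU = (\<lambda>i. if i = 0 then y - z else ?l i)"
  define pL where "pL = (\<lambda>i. if i = 0 then M + r + 1 else ?p i)"
  define lL where "lL = (\<lambda>i. if i = 0 then z - y else ?l i)"
  let ?IU = "insert 0 ?IO" and ?IL = "insert 0 ?IE"
  let ?SU = "strip 0 b (Suc (2 * m)) (2 * int (M + y))" and ?SL = "strip 1 b (2 * e) (2 * int (M + z))"
  let ?UU = "left_shadow b (int A) \<inter> {v. 0 \<le> snd v} \<union> shadows b ?IU pU lU"
  let ?UL = "shadows b ?IL pL lL"
  let ?R = "cell ` H5 x y z as" and ?f = "\<lambda>v :: int \<times> int. (2 * b - 1 - fst v, snd v)"
  let ?Z = "{n + 1..M + r}"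
  let ?Z' = "if e = 0 then {} else ?Z"
  let ?DU = "\<lambda>S. Dlt (insert 0 (oddpos as) \<union> S \<union> {M + z + 1..M + y})"
  let ?DL = "\<lambda>S. Dlt1 (evenpos as \<union> S \<union> {M + y + 1..M + z})"
  have ob: "odd b" by (simp add: b_def)
  have r1: "r + (y - z) = y" "r + (z - y) = z" by (simp_all add: r_def min_def)
  have n: "int n = int (odd_sum as) + int (even_sum as)" using odd_even_sum[of as] by (simp add: n_def)
  have L1: "1 \<le> length as" using as by (cases as) auto
  have A1: "A = entry as 1" using as by (simp add: A_def entry_def hd_conv_nth)
  have AO: "A \<le> odd_sum as" using entry_le_odd_sum[of 1 as] L1 A1 by simp
  have s1: "s_sum 1 as = A" using A1 s_sum_pred[of 1 as] by simp
  have pA: "A < ?p i" if "2 \<le> i" for i 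
  proof -
    have "1 \<le> i - 1" using that by simp
    then show ?thesis using s_sum_mono[of 1 "i - 1" as] s1 by simp
  qed
  have pn: "?p i + ?l i \<le> n + 1" if "i \<in> {1..length as}" for i
    using block_end[OF that] by (simp add: n_def)
  have bU: "blocks ?IU pU lU \<union> {0..A} = insert 0 (oddpos as) \<union> {M + z + 1..M + y}"
  proof -
    have "blocks ?IO pU lU = blocks ?IO ?p ?l" by (rule blocks_cong) (auto simp: pU_def lU_def)
    moreover have "blocks {0} pU lU = {M + z + 1..M + y}"
      by (auto simp: blocks_def pU_def lU_def r_def)
    moreover have "insert 0 {1..A} = {0..A}" by auto
    ultimately show ?thesis
      unfolding oddpos_first[OF as] insert_is_Un[of 0 ?IO] blocks_Un A_def by blast
  qed
  have bL: "blocks ?IL pL lL = evenpos as \<union> {M + y + 1..M + z}"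
  proof -
    have "blocks ?IE pL lL = evenpos as"
      unfolding evenpos_def by (rule blocks_cong) (auto simp: pL_def lL_def)
    moreover have "blocks {0} pL lL = {M + y + 1..M + z}"
      by (auto simp: blocks_def pL_def lL_def r_def)
    ultimately show ?thesis unfolding insert_is_Un[of 0 ?IE] blocks_Un by blast
  qed
  have all: "oddpos as \<union> evenpos as = {1..n}" using oddpos_Un_evenpos[of as] by (simp add: n_def)
  have W: "endpoint (H5_upper_zigzag y as) = (int m, b)"
    by (simp add: endpoint_def H5_upper_zigzag_def m_def b_def)
  have poly: "(i, X) \<in> cell ` H5_polygon x y z as \<longleftrightarrow> b - 2 * int e \<le> i \<and> i < 0 \<and> (b \<le> i \<longrightarrow> 0 \<le> X) \<and>
      (i < b \<longrightarrow> 1 \<le> X) \<and> X \<le> 2 * int (M + y) - (i - b) \<and> X \<le> 2 * int (M + z) + 1 + (i - b)" for i X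
    unfolding H5_polygon_cells using n by (auto simp: m_def e_def b_def M_def)
  let ?t = "(hd as + 1) # tl as"
  have lt: "length ?t = length as" using as by simp
  have et: "entry ?t i = ?l i" if "2 \<le> i" for i
    using that as by (cases as) (auto simp: entry_def nth_Cons' split: if_splits)
  have e1: "entry ?t 1 = A + 1" by (simp add: entry_def A_def)
  have st: "s_sum i ?t = s_sum i as + 1" if "1 \<le> i" for i
    using that
  proof (induction i rule: dec_induct)
    case base
    then show ?case using e1 s1 by (simp add: s_sum_def)
  next
    case (step i)
    then show ?case using et[of "Suc i"] by (simp add: s_sum_Suc)
  qed
  have rem: "cell ` H5_removed y as = left_shadow b (int A) \<union> shadows b ?IO ?p ?l
      \<union> (\<Union>i\<in>?IE. {v. fst v < b \<and> snd v \<le> 2 * (int m + int (?p i) + int (?l i)) + fst v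
                        \<and> 2 * (int m + int (?p i) + b) \<le> snd v + fst v})"
  proof -
    have 1: "cell ` left_part (shift_east (entry ?t 1) (int m, b)) = left_shadow b (int A)"
      unfolding e1 shift_east_def fst_conv snd_conv left_part_cells left_shadow_def
      by (rule Set.set_eqI) (auto simp: b_def)
    have 2: "cell ` up_triangle (shift_east (s_sum (i - 1) ?t) (int m, b)) (entry ?t i)
        = shadow b (int (?p i)) (int (?p i) + int (?l i) - 1)" if "i \<in> ?IO" for i
    proof -
      have i: "s_sum (i - 1) ?t = ?p i" "entry ?t i = ?l i" using st[of "i - 1"] et[of i] that by auto
      show ?thesis unfolding i shift_east_def fst_conv snd_conv up_triangle_cells
        by (rule shadow_eq) (simp add: b_def)
    qed
    have 3: "cell ` down_triangle (shift_east (s_sum (i - 1) ?t) (int m, b)) (entry ?t i)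
        = {v. fst v < b \<and> snd v \<le> 2 * (int m + int (?p i) + int (?l i)) + fst v
             \<and> 2 * (int m + int (?p i) + b) \<le> snd v + fst v}" if "i \<in> ?IE" for i
    proof -
      have "2 \<le> i" using that by (cases "i = 1") auto
      then have i: "s_sum (i - 1) ?t = ?p i" "entry ?t i = ?l i" using st[of "i - 1"] et[of i] by auto
      show ?thesis unfolding i shift_east_def fst_conv snd_conv down_triangle_cells ..
    qed
    show ?thesis
      unfolding H5_removed_def Let_def W lt image_Un image_UN 1 shadows_def
      using 2 3 by (intro arg_cong2[of _ _ _ _ "(\<union>)"] SUP_cong refl) simp_all
  qed
  have memR: "v \<in> ?R \<longleftrightarrow> v \<in> cell ` H5_polygon x y z as \<and> v \<notin> cell ` H5_removed y as" for v
    unfolding H5_def cell_image_Diff by simp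
  have upper: "{v\<in>?R. b \<le> fst v} = ?SU - ?UU"
  proof (rule Set.set_eqI)
    fix v :: "int \<times> int"
    obtain i X where v: "v = (i, X)" by (cases v)
    have sh: "v \<in> shadows b ?IU pU lU \<longleftrightarrow> v \<in> shadows b ?IO ?p ?l \<or>
        (b \<le> i \<and> 2 * int (M + r + 1) + (i - b) \<le> X \<and> X \<le> 2 * (int (M + r + 1) + int (y - z) - 1) - (i - b))"
      by (auto simp: shadows_def shadow_def v pU_def lU_def)
    have low: "b \<le> i \<Longrightarrow> v \<notin> (\<Union>i\<in>?IE. {v. fst v < b \<and> snd v \<le> 2 * (int m + int (?p i) + int (?l i)) + fst v
                        \<and> 2 * (int m + int (?p i) + b) \<le> snd v + fst v})" by (auto simp: v)
    show "v \<in> {v\<in>?R. b \<le> fst v} \<longleftrightarrow> v \<in> ?SU - ?UU"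
    proof (cases "b \<le> i")
      case True
      have poly': "v \<in> cell ` H5_polygon x y z as \<longleftrightarrow> v \<in> ?SU \<and> X \<le> 2 * int (M + z) + 1 + (i - b)"
        unfolding v poly using True by (auto simp: strip_def b_def)
      have tri: "v \<in> ?SU \<Longrightarrow> X \<le> 2 * int (M + z) + 1 + (i - b) \<longleftrightarrow>
        \<not> (b \<le> i \<and> 2 * int (M + r + 1) + (i - b) \<le> X \<and> X \<le> 2 * (int (M + r + 1) + int (y - z) - 1) - (i - b))"
        using True by (auto simp: strip_def v r_def)
      have pos: "v \<in> ?SU \<Longrightarrow> v \<in> {v. 0 \<le> snd v}" by (simp add: strip_def)
      show ?thesis
        using True low poly' tri pos unfolding mem_Collect_eq memR rem Diff_iff Un_iff Int_iff sh
        by (simp add: v) blast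
    next
      case False
      then show ?thesis by (simp add: v strip_def)
    qed
  qed
  have finv: "(i, X) \<in> ?f ` B \<longleftrightarrow> (2 * b - 1 - i, X) \<in> B" for i X B
  proof
    assume "(2 * b - 1 - i, X) \<in> B"
    moreover have "(i, X) = ?f (2 * b - 1 - i, X)" by simp
    ultimately show "(i, X) \<in> ?f ` B" by blast
  qed auto
  have lower: "?f ` {v\<in>?R. fst v < b} = ?SL - ?UL"
  proof (rule Set.set_eqI)
    fix v :: "int \<times> int"
    obtain i X where v: "v = (i, X)" by (cases v)
    let ?w = "(2 * b - 1 - i, X)"
    have inv: "v \<in> ?f ` B \<longleftrightarrow> ?w \<in> B" for B unfolding v by (rule finv)
    have sh: "v \<in> shadows b ?IL pL lL \<longleftrightarrow> v \<in> shadows b ?IE ?p ?l \<or>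
        (b \<le> i \<and> 2 * int (M + r + 1) + (i - b) \<le> X \<and> X \<le> 2 * (int (M + r + 1) + int (z - y) - 1) - (i - b))"
      by (auto simp: shadows_def shadow_def v pL_def lL_def)
    show "v \<in> ?f ` {v\<in>?R. fst v < b} \<longleftrightarrow> v \<in> ?SL - ?UL"
    proof (cases "b \<le> i")
      case True
      have poly': "?w \<in> cell ` H5_polygon x y z as \<longleftrightarrow> v \<in> ?SL \<and> X \<le> 2 * int (M + y) + 1 + (i - b)"
        unfolding poly using True by (auto simp: strip_def b_def v)
      have tri: "v \<in> ?SL \<Longrightarrow> X \<le> 2 * int (M + y) + 1 + (i - b) \<longleftrightarrow>
        \<not> (b \<le> i \<and> 2 * int (M + r + 1) + (i - b) \<le> X \<and> X \<le> 2 * (int (M + r + 1) + int (z - y) - 1) - (i - b))"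
        using True by (auto simp: strip_def v r_def)
      have s3: "?w \<in> (\<Union>i\<in>?IE. {v. fst v < b \<and> snd v \<le> 2 * (int m + int (?p i) + int (?l i)) + fst v
                        \<and> 2 * (int m + int (?p i) + b) \<le> snd v + fst v}) \<longleftrightarrow> v \<in> shadows b ?IE ?p ?l"
        using True by (auto simp: shadows_def shadow_def v b_def)
      have s1: "?w \<notin> left_shadow b (int A)" "?w \<notin> shadows b ?IO ?p ?l"
        using True by (auto simp: shadows_def shadow_def left_shadow_def)
      show ?thesis
        using True poly' tri s1 unfolding inv mem_Collect_eq memR rem Diff_iff Un_iff sh s3
        by simp blast
    next
      case False
      then show ?thesis unfolding inv by (simp add: v strip_def)
    qed
  qed
  have finR: "finite ?R"
  proof -
    have "{v\<in>?R. fst v < b} = ?f ` (?SL - ?UL)"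
      unfolding lower[symmetric] by (force simp: image_image)
    then have "finite {v\<in>?R. fst v < b}" using finite_strip by simp
    moreover have "finite {v\<in>?R. b \<le> fst v}" unfolding upper using finite_strip by simp
    ultimately have "finite ({v\<in>?R. b \<le> fst v} \<union> {v\<in>?R. fst v < b})" by simp
    moreover have "?R \<subseteq> {v\<in>?R. b \<le> fst v} \<union> {v\<in>?R. fst v < b}"
    proof
      fix v assume "v \<in> ?R"
      then show "v \<in> {v\<in>?R. b \<le> fst v} \<union> {v\<in>?R. fst v < b}" by (cases "b \<le> fst v") simp_all
    qed
    ultimately show ?thesis by (rule finite_subset[rotated])
  qed
  have colR: "fst v < 0 \<and> (snd v = 0 \<longrightarrow> - (2 * int m + 1) \<le> fst v)" if "v \<in> ?R" for v
  proof -
    obtain i X where v: "v = (i, X)" by (cases v)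
    have "(i, X) \<in> cell ` H5_polygon x y z as" using that memR v by simp
    then show ?thesis unfolding poly by (auto simp: v b_def)
  qed
  have "M_H5 x y z as = mw ?R"
    unfolding M_H5_def
  proof (rule weighted_count_cells)
    fix l assume l: "l \<subseteq> H5 x y z as" "lozenge l"
    show "half_weight (edges (H5_upper_zigzag y as)) l = bw (cell ` l)"
      by (rule half_weight_zigzag[OF _ l(2), of _ m])
        (use l(1) colR in \<open>auto simp: H5_upper_zigzag_def m_def\<close>)
  qed
  also have "mw ?R = (\<Sum>D\<in>Pow {X. (b, X) \<in> ?R \<and> (b - 1, X) \<in> ?R \<and> odd (X + b)}.
    (\<Prod>X\<in>D. colw X) * (mw ({v\<in>?R. b \<le> fst v} - {b} \<times> D) * mw ({v\<in>?R. fst v < b} - {b - 1} \<times> D)))"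
    by (rule mw_cut[OF finR])
  also have "{X. (b, X) \<in> ?R \<and> (b - 1, X) \<in> ?R \<and> odd (X + b)} = pcols ?Z'"
  proof -
    have 1: "(b, 2 * int p) \<in> ?R \<longleftrightarrow> p \<le> M + y \<and> p \<notin> blocks ?IU pU lU \<union> {0..A}" for p
    proof -
      have "(b, 2 * int p) \<in> ?R \<longleftrightarrow> (b, 2 * int p) \<in> ?SU - ?UU" unfolding upper[symmetric] by simp
      moreover have "(b, 2 * int p) \<in> ?SU \<longleftrightarrow> p \<le> M + y" by (auto simp: strip_def)
      moreover have "(b, 2 * int p) \<in> shadows b ?IU pU lU \<longleftrightarrow> p \<in> blocks ?IU pU lU"
        by (rule shadows_base_iff[OF ob])
      moreover have "(b, 2 * int p) \<in> left_shadow b (int A) \<inter> {v. 0 \<le> snd v} \<longleftrightarrow> p \<in> {0..A}"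
        by (auto simp: left_shadow_def)
      ultimately show ?thesis by blast
    qed
    have 2: "(b - 1, 2 * int p) \<in> ?R \<longleftrightarrow> 1 \<le> p \<and> p \<le> M + z \<and> 0 < e \<and> p \<notin> blocks ?IL pL lL" for p
    proof -
      have "(b - 1, 2 * int p) \<in> ?R \<longleftrightarrow> (b, 2 * int p) \<in> ?f ` {v\<in>?R. fst v < b}"
        unfolding finv by simp
      moreover have "(b, 2 * int p) \<in> ?SL \<longleftrightarrow> 1 \<le> p \<and> p \<le> M + z \<and> 0 < e" by (auto simp: strip_def)
      moreover have "(b, 2 * int p) \<in> ?UL \<longleftrightarrow> p \<in> blocks ?IL pL lL"
        by (rule shadows_base_iff[OF ob])
      ultimately show ?thesis unfolding lower by blast
    qed
    have 3: "(b, 2 * int p) \<in> ?R \<and> (b - 1, 2 * int p) \<in> ?R \<longleftrightarrow> p \<in> ?Z'" for p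
    proof -
      have "p \<in> oddpos as \<union> evenpos as \<longleftrightarrow> 1 \<le> p \<and> p \<le> n" unfolding all by simp
      then show ?thesis unfolding 1 2 bU bL by (auto simp: r_def M_def)
    qed
    have 4: "\<exists>p. X = 2 * int p" if "(b, X) \<in> ?R" "odd (X + b)" for X
    proof -
      have "(b, X) \<in> ?SU - ?UU" unfolding upper[symmetric] using that by simp
      then have "0 \<le> X" by (simp add: strip_def)
      moreover have "even X" using that(2) ob by simp
      ultimately have "X = 2 * int (nat (X div 2))" by simp
      then show ?thesis by blast
    qed
    have 5: "odd (2 * int p + b)" for p using ob by simp
    show ?thesis
    proof (intro equalityI subsetI)
      fix X assume X: "X \<in> {X. (b, X) \<in> ?R \<and> (b - 1, X) \<in> ?R \<and> odd (X + b)}"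
      then obtain p where p: "X = 2 * int p" using 4 by blast
      have "(b, 2 * int p) \<in> ?R \<and> (b - 1, 2 * int p) \<in> ?R" using X unfolding p by blast
      then show "X \<in> pcols ?Z'" unfolding 3 p pcols_iff .
    next
      fix X assume "X \<in> pcols ?Z'"
      then obtain p where p: "p \<in> ?Z'" "X = 2 * int p" unfolding pcols_def by blast
      have "(b, 2 * int p) \<in> ?R \<and> (b - 1, 2 * int p) \<in> ?R" unfolding 3 by (rule p(1))
      then show "X \<in> {X. (b, X) \<in> ?R \<and> (b - 1, X) \<in> ?R \<and> odd (X + b)}"
        unfolding p(2) using 5[of p] by blast
    qed
  qed
  also have "Pow (pcols ?Z') = pcols ` Pow ?Z'"
    unfolding pcols_def by (rule image_Pow_surj[OF refl, symmetric])
  also have "(\<Sum>D\<in>pcols ` Pow ?Z'. (\<Prod>X\<in>D. colw X) *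
      (mw ({v\<in>?R. b \<le> fst v} - {b} \<times> D) * mw ({v\<in>?R. fst v < b} - {b - 1} \<times> D)))
    = (\<Sum>S\<in>Pow ?Z'. (\<Prod>X\<in>pcols S. colw X) *
      (mw ({v\<in>?R. b \<le> fst v} - {b} \<times> pcols S) * mw ({v\<in>?R. fst v < b} - {b - 1} \<times> pcols S)))"
  proof (rule sum.reindex_cong[OF _ refl refl])
    show "inj_on pcols (Pow ?Z')"
      unfolding pcols_def by (rule inj_on_image_Pow) (simp add: inj_on_def)
  qed
  also have "\<dots> = (\<Sum>S\<in>Pow ?Z'. if card S = r then 2 ^ A * (ucoef m * lcoef e) * (?DU S * ?DL S) else 0)"
  proof (rule sum.cong[OF refl])
    fix S assume "S \<in> Pow ?Z'"
    then have S: "S \<subseteq> ?Z" by (auto split: if_splits)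
    have finS: "finite S" using S finite_subset by blast
    have Sr: "\<And>s. s \<in> S \<Longrightarrow> n < s \<and> s \<le> M + r" using S by auto
    have oZ: "\<And>s. s \<in> oddpos as \<Longrightarrow> 1 \<le> s \<and> s \<le> n" "\<And>s. s \<in> evenpos as \<Longrightarrow> 1 \<le> s \<and> s \<le> n"
      using all by auto
    have cw: "(\<Prod>X\<in>pcols S. colw X) = 1"
      using S by (intro prod.neutral) (auto simp: pcols_def colw_def)
    have dU: "S \<inter> (insert 0 (oddpos as) \<union> {M + z + 1..M + y}) = {}"
    proof -
      have "s \<notin> insert 0 (oddpos as) \<union> {M + z + 1..M + y}" if "s \<in> S" for s
        using Sr[OF that] oZ(1)[of s] by (auto simp: r_def)
      then show ?thesis by blast
    qed
    have dL: "S \<inter> (evenpos as \<union> {M + y + 1..M + z}) = {}"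
    proof -
      have "s \<notin> evenpos as \<union> {M + y + 1..M + z}" if "s \<in> S" for s
        using Sr[OF that] oZ(2)[of s] by (auto simp: r_def)
      then show ?thesis by blast
    qed
    have cU: "card (S \<union> (insert 0 (oddpos as) \<union> {M + z + 1..M + y})) = card S + (1 + odd_sum as + (y - z))"
    proof -
      have "0 \<notin> oddpos as" "oddpos as \<inter> {M + z + 1..M + y} = {}" using oZ(1) by (fastforce simp: M_def)+
      then have "card (insert 0 (oddpos as) \<union> {M + z + 1..M + y}) = 1 + odd_sum as + (y - z)"
        by (subst card_Un_disjoint) (auto simp: card_oddpos)
      then show ?thesis by (subst card_Un_disjoint[OF finS _ dU]) auto
    qed
    have cL: "card (S \<union> (evenpos as \<union> {M + y + 1..M + z})) = card S + (even_sum as + (z - y))"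
    proof -
      have "evenpos as \<inter> {M + y + 1..M + z} = {}" using oZ(2) by (fastforce simp: M_def)
      then have "card (evenpos as \<union> {M + y + 1..M + z}) = even_sum as + (z - y)"
        by (subst card_Un_disjoint) (auto simp: card_evenpos)
      then show ?thesis by (subst card_Un_disjoint[OF finS _ dL]) auto
    qed
    have "mw ({v\<in>?R. b \<le> fst v} - {b} \<times> pcols S) = 2 ^ A * sw 0 b (Suc (2 * m)) (2 * int (M + y)) (pcols (S \<union> (blocks ?IU pU lU \<union> {0..A})))"
      unfolding upper
    proof (rule mw_left_shadow[OF ob])
      show "S \<inter> (blocks ?IU pU lU \<union> {0..A}) = {}" unfolding bU by (rule dU)
      show "A \<le> M + y" "2 * A < Suc (2 * m)" using AO n by (simp_all add: m_def M_def)
      fix i assume i: "i \<in> ?IU"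
      show "A < pU i \<and> pU i + lU i \<le> M + y + 1 \<and> lU i \<le> Suc (2 * m)"
      proof (cases "i = 0")
        case True
        then show ?thesis using r1(1) AO n by (simp add: pU_def lU_def m_def M_def)
      next
        case False
        then have "i \<in> ?IO" using i by simp
        then show ?thesis using pA[of i] pn[of i] entry_le_odd_sum[of i as] by (simp add: pU_def lU_def m_def M_def)
      qed
    qed
    also have "sw 0 b (Suc (2 * m)) (2 * int (M + y)) (pcols (S \<union> (blocks ?IU pU lU \<union> {0..A})))
        = (if card (S \<union> (blocks ?IU pU lU \<union> {0..A})) = Suc m then ucoef m * Dlt (S \<union> (blocks ?IU pU lU \<union> {0..A})) else 0)"
    proof (rule strip_up[OF _ ob])
      show "S \<union> (blocks ?IU pU lU \<union> {0..A}) \<subseteq> {0..M + y}"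
      proof
        fix s assume "s \<in> S \<union> (blocks ?IU pU lU \<union> {0..A})"
        then consider "s \<in> S" | "s = 0" | "s \<in> oddpos as" | "s \<in> {M + z + 1..M + y}" unfolding bU by blast
        then show "s \<in> {0..M + y}" using Sr[of s] oZ(1)[of s] by cases (auto simp: r_def M_def)
      qed
      show "m \<le> M + y" using n by (simp add: m_def M_def)
    qed
    also have "\<dots> = (if card S = r then ucoef m * ?DU S else 0)"
    proof -
      have "card S + (1 + odd_sum as + (y - z)) = Suc m \<longleftrightarrow> card S = r" using r1(1) unfolding m_def by linarith
      moreover have "S \<union> (insert 0 (oddpos as) \<union> {M + z + 1..M + y}) = insert 0 (oddpos as) \<union> S \<union> {M + z + 1..M + y}"
        by blast
      ultimately show ?thesis unfolding bU cU by simp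
    qed
    finally have up: "mw ({v\<in>?R. b \<le> fst v} - {b} \<times> pcols S) = 2 ^ A * (if card S = r then ucoef m * ?DU S else 0)" .
    have low: "mw ({v\<in>?R. fst v < b} - {b - 1} \<times> pcols S) = lcoef e * ?DL S" if "card S = r"
    proof -
      have "S \<union> (evenpos as \<union> {M + y + 1..M + z}) = evenpos as \<union> S \<union> {M + y + 1..M + z}" by blast
      then have cE: "card (evenpos as \<union> S \<union> {M + y + 1..M + z}) = e"
        using cL that r1(2) by (simp add: e_def)
      have inj: "inj ?f" by (auto simp: inj_on_def prod_eq_iff)
      have "mw ({v\<in>?R. fst v < b} - {b - 1} \<times> pcols S) = mw (?f ` ({v\<in>?R. fst v < b} - {b - 1} \<times> pcols S))"
        by (rule mw_reflect[symmetric]) simp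
      also have "?f ` ({v\<in>?R. fst v < b} - {b - 1} \<times> pcols S) = ?SL - ?UL - {b} \<times> pcols S"
      proof -
        have "?f ` ({b - 1} \<times> pcols S) = {b} \<times> pcols S" by force
        then show ?thesis by (simp only: image_set_diff[OF inj] lower)
      qed
      also have "mw (?SL - ?UL - {b} \<times> pcols S) = sw 1 b (2 * e) (2 * int (M + z)) (pcols (S \<union> blocks ?IL pL lL))"
      proof (rule mw_shadows[OF ob])
        show "S \<inter> blocks ?IL pL lL = {}" unfolding bL by (rule dL)
        fix i assume i: "i \<in> ?IL"
        show "1 \<le> int (pL i) \<and> pL i + lL i \<le> M + z + 1 \<and> lL i \<le> 2 * e"
        proof (cases "i = 0")
          case True
          then show ?thesis using r1(2) by (simp add: pL_def lL_def e_def)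
        next
          case False
          then have "i \<in> ?IE" using i by simp
          then show ?thesis using pn[of i] entry_le_even_sum[of i as] by (simp add: pL_def lL_def e_def M_def)
        qed
      qed simp
      also have "S \<union> blocks ?IL pL lL = evenpos as \<union> S \<union> {M + y + 1..M + z}" unfolding bL by blast
      also have "2 * e = 2 * card (evenpos as \<union> S \<union> {M + y + 1..M + z})"
        unfolding cE ..
      also have "sw 1 b (2 * card (evenpos as \<union> S \<union> {M + y + 1..M + z})) (2 * int (M + z)) (pcols (evenpos as \<union> S \<union> {M + y + 1..M + z}))
          = lcoef (card (evenpos as \<union> S \<union> {M + y + 1..M + z})) * ?DL S"
      proof (rule strip_low[OF _ ob])
        show "evenpos as \<union> S \<union> {M + y + 1..M + z} \<subseteq> {1..M + z}"
        proof
          fix s assume "s \<in> evenpos as \<union> S \<union> {M + y + 1..M + z}"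
          then consider "s \<in> S" | "s \<in> evenpos as" | "s \<in> {M + y + 1..M + z}" by blast
          then show "s \<in> {1..M + z}" using Sr[of s] oZ(2)[of s] by cases (auto simp: r_def M_def)
        qed
        show "card (evenpos as \<union> S \<union> {M + y + 1..M + z}) \<le> M + z"
          unfolding cE using n by (simp add: e_def M_def)
      qed
      also note cE
      finally show ?thesis .
    qed
    show "(\<Prod>X\<in>pcols S. colw X) * (mw ({v\<in>?R. b \<le> fst v} - {b} \<times> pcols S) * mw ({v\<in>?R. fst v < b} - {b - 1} \<times> pcols S))
        = (if card S = r then 2 ^ A * (ucoef m * lcoef e) * (?DU S * ?DL S) else 0)"
      unfolding cw up using low by simp
  qed
  also have "\<dots> = (\<Sum>S | S \<subseteq> ?Z' \<and> card S = r. 2 ^ A * (ucoef m * lcoef e) * (?DU S * ?DL S))"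
    by (subst sum.inter_filter[symmetric]) (auto intro!: sum.cong)
  also have "{S. S \<subseteq> ?Z' \<and> card S = r} = {S. S \<subseteq> ?Z \<and> card S = r}"
  proof (cases "e = 0")
    case True
    then have "r = 0" by (simp add: e_def r_def)
    moreover have "S \<subseteq> ?Z \<and> card S = 0 \<longleftrightarrow> S = {}" for S
      using finite_subset[of S ?Z] by auto
    ultimately show ?thesis using True by auto
  qed simp
  finally show ?thesis unfolding M_def A_def m_def e_def sum_distrib_left .
qed

section \<open>Products over sets of positions\<close>

text \<open>The factors of a Vandermonde product of squares that belong to one element of each set.\<close>

definition crossprod :: "nat set \<Rightarrow> nat set \<Rightarrow> real" where
  "crossprod A B = (\<Prod>a\<in>A. \<Prod>b\<in>B. (real b)\<^sup>2 - (real a)\<^sup>2)"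

lemma crossprod_Un_left: "finite A \<Longrightarrow> finite A' \<Longrightarrow> A \<inter> A' = {} \<Longrightarrow>
    crossprod (A \<union> A') B = crossprod A B * crossprod A' B"
  by (simp add: crossprod_def prod.union_disjoint)

lemma crossprod_Un_right: "finite B \<Longrightarrow> finite B' \<Longrightarrow> B \<inter> B' = {} \<Longrightarrow>
    crossprod A (B \<union> B') = crossprod A B * crossprod A B'"
  by (simp add: crossprod_def prod.union_disjoint prod.distrib)

lemma crossprod_empty [simp]: "crossprod {} B = 1" "crossprod A {} = 1"
  by (simp_all add: crossprod_def)

lemma square_diff_pos: "(a :: nat) < b \<Longrightarrow> 0 < (real b)\<^sup>2 - (real a)\<^sup>2"
  by (simp add: power_strict_mono)

lemma crossprod_pos: "(\<And>a b. a \<in> A \<Longrightarrow> b \<in> B \<Longrightarrow> a < b) \<Longrightarrow> 0 < crossprod A B"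
  unfolding crossprod_def by (intro prod_pos ballI square_diff_pos)

lemma Dlt_pos: "0 < Dlt A"
  unfolding Dlt_def by (intro prod_pos ballI square_diff_pos) auto

lemma Dlt1_pos: "0 \<notin> A \<Longrightarrow> 0 < Dlt1 A"
  unfolding Dlt1_def by (intro mult_pos_pos Dlt_pos prod_pos) (auto intro: gr0I)

lemma Dlt_empty [simp]: "Dlt {} = 1" "Dlt1 {} = 1"
  by (simp_all add: Dlt_def Dlt1_def)

lemma Dlt_Un:
  assumes fin: "finite A" "finite B" and less: "\<And>a b. a \<in> A \<Longrightarrow> b \<in> B \<Longrightarrow> a < b"
  shows "Dlt (A \<union> B) = Dlt A * Dlt B * crossprod A B"
proof -
  have dj: "A \<inter> B = {}" using less by blast
  have 1: "{s \<in> A \<union> B. s < t} = {s \<in> A. s < t}" if "t \<in> A" for t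
    using less[OF that] by (auto dest: less_trans)
  have 2: "(\<Prod>s\<in>{s \<in> A \<union> B. s < t}. (real t)\<^sup>2 - (real s)\<^sup>2)
      = (\<Prod>s\<in>A. (real t)\<^sup>2 - (real s)\<^sup>2) * (\<Prod>s\<in>{s \<in> B. s < t}. (real t)\<^sup>2 - (real s)\<^sup>2)" if "t \<in> B" for t
  proof -
    have "{s \<in> A \<union> B. s < t} = A \<union> {s \<in> B. s < t}" using less[OF _ that] by blast
    then show ?thesis using fin dj by (simp only:) (rule prod.union_disjoint, auto)
  qed
  have "Dlt (A \<union> B) = (\<Prod>t\<in>A. \<Prod>s\<in>{s \<in> A \<union> B. s < t}. (real t)\<^sup>2 - (real s)\<^sup>2)
      * (\<Prod>t\<in>B. \<Prod>s\<in>{s \<in> A \<union> B. s < t}. (real t)\<^sup>2 - (real s)\<^sup>2)"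
    unfolding Dlt_def using fin dj by (rule prod.union_disjoint)
  also have "\<dots> = Dlt A * ((\<Prod>t\<in>B. \<Prod>s\<in>A. (real t)\<^sup>2 - (real s)\<^sup>2) * Dlt B)"
    using 1 2 by (simp add: Dlt_def prod.distrib)
  also have "(\<Prod>t\<in>B. \<Prod>s\<in>A. (real t)\<^sup>2 - (real s)\<^sup>2) = crossprod A B"
    unfolding crossprod_def by (rule prod.swap)
  finally show ?thesis by simp
qed

lemma Dlt1_Un:
  assumes fin: "finite A" "finite B" and less: "\<And>a b. a \<in> A \<Longrightarrow> b \<in> B \<Longrightarrow> a < b"
  shows "Dlt1 (A \<union> B) = Dlt1 A * Dlt1 B * crossprod A B"
proof -
  have "A \<inter> B = {}" using less by blast
  then have "(\<Prod>t\<in>A \<union> B. real t) = (\<Prod>t\<in>A. real t) * (\<Prod>t\<in>B. real t)"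
    using fin by (intro prod.union_disjoint)
  moreover have "Dlt (A \<union> B) = Dlt A * Dlt B * crossprod A B" by (rule Dlt_Un[OF fin less])
  ultimately show ?thesis by (simp add: Dlt1_def)
qed

text \<open>The product over \<open>A\<close> and an interval \<open>{c + 1..d}\<close> to the right of \<open>A\<close> is the quotient of
  \<open>facprod d A\<close> and \<open>facprod c A\<close>.\<close>

definition facprod :: "nat \<Rightarrow> nat set \<Rightarrow> real" where
  "facprod c A = (\<Prod>t\<in>A. fact (c - t) * fact (c + t))"

lemma facprod_pos: "0 < facprod c A"
  unfolding facprod_def by (intro prod_pos) auto

lemma crossprod_interval:
  assumes "\<And>t. t \<in> A \<Longrightarrow> t \<le> c" "c \<le> d"
  shows "crossprod A {c + 1..d} = facprod d A / facprod c A"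
proof -
  have "(\<Prod>b\<in>{c + 1..d}. (real b)\<^sup>2 - (real t)\<^sup>2) = (fact (d - t) * fact (d + t)) / (fact (c - t) * fact (c + t))"
    if t: "t \<in> A" for t
    using assms(2)
  proof (induction d rule: dec_induct)
    case (step d)
    have td: "t \<le> d" using assms(1)[OF t] step by simp
    have "{c + 1..Suc d} = insert (Suc d) {c + 1..d}" using step by auto
    then have "(\<Prod>b\<in>{c + 1..Suc d}. (real b)\<^sup>2 - (real t)\<^sup>2)
        = ((real (Suc d))\<^sup>2 - (real t)\<^sup>2) * ((fact (d - t) * fact (d + t)) / (fact (c - t) * fact (c + t)))"
      using step by simp
    also have "(real (Suc d))\<^sup>2 - (real t)\<^sup>2 = real (Suc d - t) * real (Suc d + t)"
      using td by (simp add: power2_eq_square of_nat_diff algebra_simps)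
    also have "\<dots> * ((fact (d - t) * fact (d + t)) / (fact (c - t) * fact (c + t)))
        = (fact (Suc d - t) * fact (Suc d + t)) / (fact (c - t) * fact (c + t))"
      using td by (simp add: Suc_diff_le)
    finally show ?case .
  qed simp
  then show ?thesis by (simp add: crossprod_def facprod_def prod_dividef)
qed

text \<open>The weight of \<open>S\<close> in the formula for \<open>M_H5\<close> depends on the marked segments only through their
  total length, up to a factor that does not depend on \<open>S\<close>.\<close>

definition common_sum :: "nat \<Rightarrow> nat \<Rightarrow> nat \<Rightarrow> nat \<Rightarrow> real" where
  "common_sum n x y z = (\<Sum>S | S \<subseteq> {n + 1..n + x + min y z} \<and> card S = min y z.
     Dlt S * Dlt1 S * crossprod {0..n} S * crossprod S ({n + x + z + 1..n + x + y} \<union> {n + x + y + 1..n + x + z}))"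

definition fern_factor :: "nat \<Rightarrow> nat \<Rightarrow> nat \<Rightarrow> nat \<Rightarrow> nat set \<Rightarrow> nat set \<Rightarrow> real" where
  "fern_factor n x y z U D = Dlt (insert 0 U) * Dlt1 D *
     crossprod (insert 0 U) {n + x + z + 1..n + x + y} * crossprod D {n + x + y + 1..n + x + z} *
     (Dlt {n + x + z + 1..n + x + y} * Dlt1 {n + x + y + 1..n + x + z})"

lemma M_H5_factored:
  fixes x y z :: nat and as :: "nat list"
  assumes "as \<noteq> []"
  defines "n \<equiv> s_sum (length as) as"
  shows "M_H5 x y z as = 2 ^ hd as * (ucoef (y + odd_sum as) * lcoef (z + even_sum as)) *
    (fern_factor n x y z (oddpos as) (evenpos as) * common_sum n x y z)"
proof -
  let ?U = "insert 0 (oddpos as)" and ?D = "evenpos as"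
  let ?E1 = "{n + x + z + 1..n + x + y}" and ?E2 = "{n + x + y + 1..n + x + z}"
  have all: "oddpos as \<union> evenpos as = {1..n}" using oddpos_Un_evenpos[of as] by (simp add: n_def)
  have bU: "a \<le> n" if "a \<in> ?U" for a using that all by auto
  have bD: "a \<le> n" if "a \<in> ?D" for a using that all by auto
  have UD: "?U \<union> ?D = {0..n}" "?U \<inter> ?D = {}"
    using all oddpos_Int_evenpos[of as] by auto
  have "Dlt (?U \<union> S \<union> ?E1) * Dlt1 (?D \<union> S \<union> ?E2) = fern_factor n x y z (oddpos as) (evenpos as) *
      (Dlt S * Dlt1 S * crossprod {0..n} S * crossprod S (?E1 \<union> ?E2))"
    if "S \<subseteq> {n + 1..n + x + min y z}" for S
  proof -
    have fS: "finite S" using that finite_subset by blast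
    have S: "n < s \<and> s \<le> n + x + min y z" if "s \<in> S" for s using that \<open>S \<subseteq> _\<close> by auto
    have "Dlt (?U \<union> S \<union> ?E1) = Dlt ?U * Dlt S * crossprod ?U S * Dlt ?E1 * (crossprod ?U ?E1 * crossprod S ?E1)"
    proof (subst Dlt_Un)
      show "a < b" if "a \<in> ?U \<union> S" "b \<in> ?E1" for a b using that bU[of a] S[of a] by auto
      have "a < b" if "a \<in> ?U" "b \<in> S" for a b using bU[OF that(1)] S[OF that(2)] by simp
      then have "Dlt (?U \<union> S) = Dlt ?U * Dlt S * crossprod ?U S" by (intro Dlt_Un) (auto simp: fS)
      moreover have "?U \<inter> S = {}" using bU S by (meson disjoint_iff leD)
      then have "crossprod (?U \<union> S) ?E1 = crossprod ?U ?E1 * crossprod S ?E1"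
        by (intro crossprod_Un_left) (auto simp: fS)
      ultimately show "Dlt (?U \<union> S) * Dlt ?E1 * crossprod (?U \<union> S) ?E1
          = Dlt ?U * Dlt S * crossprod ?U S * Dlt ?E1 * (crossprod ?U ?E1 * crossprod S ?E1)" by simp
    qed (auto simp: fS)
    moreover have "Dlt1 (?D \<union> S \<union> ?E2) = Dlt1 ?D * Dlt1 S * crossprod ?D S * Dlt1 ?E2 * (crossprod ?D ?E2 * crossprod S ?E2)"
    proof (subst Dlt1_Un)
      show "a < b" if "a \<in> ?D \<union> S" "b \<in> ?E2" for a b using that bD[of a] S[of a] by auto
      have "a < b" if "a \<in> ?D" "b \<in> S" for a b using bD[OF that(1)] S[OF that(2)] by simp
      then have "Dlt1 (?D \<union> S) = Dlt1 ?D * Dlt1 S * crossprod ?D S" by (intro Dlt1_Un) (auto simp: fS)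
      moreover have "?D \<inter> S = {}" using bD S by (meson disjoint_iff leD)
      then have "crossprod (?D \<union> S) ?E2 = crossprod ?D ?E2 * crossprod S ?E2"
        by (intro crossprod_Un_left) (auto simp: fS)
      ultimately show "Dlt1 (?D \<union> S) * Dlt1 ?E2 * crossprod (?D \<union> S) ?E2
          = Dlt1 ?D * Dlt1 S * crossprod ?D S * Dlt1 ?E2 * (crossprod ?D ?E2 * crossprod S ?E2)" by simp
    qed (auto simp: fS)
    moreover have "crossprod {0..n} S = crossprod ?U S * crossprod ?D S"
      unfolding UD(1)[symmetric] by (intro crossprod_Un_left UD(2)) auto
    moreover have "crossprod S (?E1 \<union> ?E2) = crossprod S ?E1 * crossprod S ?E2"
      by (rule crossprod_Un_right) auto
    ultimately show ?thesis by (simp add: fern_factor_def mult_ac)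
  qed
  then have "(\<Sum>S | S \<subseteq> {n + 1..n + x + min y z} \<and> card S = min y z.
      Dlt (?U \<union> S \<union> ?E1) * Dlt1 (?D \<union> S \<union> ?E2)) = fern_factor n x y z (oddpos as) (evenpos as) * common_sum n x y z"
    unfolding common_sum_def sum_distrib_left by (intro sum.cong) auto
  then show ?thesis unfolding M_H5_formula[OF assms(1)] n_def by simp
qed

text \<open>In the products for \<open>K'\<close>, \<open>Q\<close>, \<open>P\<close> and \<open>P'\<close> the additional dents follow the marked segments
  without a gap. Up to quotients of \<open>facprod\<close>, their dependence on \<open>U\<close> and \<open>D\<close> is that of \<open>fern_factor\<close>:
  the last factor depends on \<open>n\<close>, \<open>x\<close>, \<open>y\<close>, \<open>z\<close> only, and the products over \<open>D\<close> and the additional dents are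
  expressed by those over \<open>U\<close> since \<open>U\<close> and \<open>D\<close> partition \<open>{1..n}\<close>.\<close>

lemma fern_factor_ratio:
  assumes UD: "U \<union> D = {1..n}" "U \<inter> D = {}"
  shows "fern_factor n x y z U D * (facprod (n + y) U * facprod (n + x + z) U)
    = Dlt (insert 0 U \<union> {n + 1..n + y}) * Dlt1 (D \<union> {n + 1..n + z}) *
      (facprod (n + z) U * facprod (n + x + y) U) *
      (crossprod {0} {n + x + z + 1..n + x + y} * crossprod {1..n} {n + x + y + 1..n + x + z} *
        (Dlt {n + x + z + 1..n + x + y} * Dlt1 {n + x + y + 1..n + x + z}) /
       (crossprod {0} {n + 1..n + y} * crossprod {1..n} {n + 1..n + z} * (Dlt {n + 1..n + y} * Dlt1 {n + 1..n + z})))"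
proof -
  let ?M = "n + x"
  let ?E1 = "{?M + z + 1..?M + y}" and ?E2 = "{?M + y + 1..?M + z}"
  let ?Fy = "{n + 1..n + y}" and ?Fz = "{n + 1..n + z}"
  have fin: "finite U" "finite D" using UD(1) by (metis finite_Un finite_atLeastAtMost)+
  have U: "1 \<le> t \<and> t \<le> n" if "t \<in> U" for t using that UD(1) by auto
  have D: "1 \<le> t \<and> t \<le> n" if "t \<in> D" for t using that UD(1) by auto
  have U0: "crossprod (insert 0 U) B = crossprod {0} B * crossprod U B" for B
    using crossprod_Un_left[of "{0}" U B] fin U by fastforce
  have pos: "0 < crossprod U B" "0 < crossprod D B" "0 < crossprod {0} B" "0 < crossprod {1..n} B"
    if "\<And>b. b \<in> B \<Longrightarrow> n < b" for B
    using U D that by (auto intro!: crossprod_pos; force)+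
  have cD: "crossprod D B = crossprod {1..n} B / crossprod U B" if "\<And>b. b \<in> B \<Longrightarrow> n < b" for B
  proof -
    have "0 < crossprod U B" by (rule pos(1)) (rule that)
    then show ?thesis
      using crossprod_Un_left[OF fin UD(2), of B] unfolding UD(1) by (simp add: field_simps)
  qed
  have D1: "Dlt (insert 0 U \<union> ?Fy) = Dlt (insert 0 U) * Dlt ?Fy * (crossprod {0} ?Fy * crossprod U ?Fy)"
  proof -
    have "a < b" if "a \<in> insert 0 U" "b \<in> ?Fy" for a b using that U[of a] by auto
    then show ?thesis unfolding U0[symmetric] using fin by (intro Dlt_Un) auto
  qed
  have D2: "Dlt1 (D \<union> ?Fz) = Dlt1 D * Dlt1 ?Fz * crossprod D ?Fz"
  proof -
    have "a < b" if "a \<in> D" "b \<in> ?Fz" for a b using that D[of a] by auto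
    then show ?thesis using fin by (intro Dlt1_Un) auto
  qed
  have i1: "crossprod U ?Fy = facprod (n + y) U / facprod n U" "crossprod U ?Fz = facprod (n + z) U / facprod n U"
    by (rule crossprod_interval; use U in auto)+
  have i2: "crossprod U ?E1 / crossprod U ?E2 = facprod (?M + y) U / facprod (?M + z) U"
  proof (cases "y \<le> z")
    case True
    then have "crossprod U ?E2 = facprod (?M + z) U / facprod (?M + y) U"
      by (intro crossprod_interval) (use U in force)+
    then show ?thesis using True by simp
  next
    case False
    then have "crossprod U ?E1 = facprod (?M + y) U / facprod (?M + z) U"
      by (intro crossprod_interval) (use U in force)+
    then show ?thesis using False by simp
  qed
  have e1: "crossprod D ?E2 = crossprod {1..n} ?E2 / crossprod U ?E2" by (rule cD) auto
  have e2: "crossprod D ?Fz = crossprod {1..n} ?Fz / crossprod U ?Fz" by (rule cD) auto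
  have p: "0 < crossprod U ?Fz" "0 < crossprod {1..n} ?Fz" "0 < crossprod {0} ?Fy"
    by (rule pos; simp)+
  have q: "0 < Dlt ?Fy" "0 < Dlt1 ?Fz" by (auto intro: Dlt_pos Dlt1_pos)
  have fp: "0 < facprod c U" for c by (rule facprod_pos)
  have "fern_factor n x y z U D = Dlt (insert 0 U) * Dlt1 D * (crossprod {0} ?E1 * crossprod {1..n} ?E2) *
      (crossprod U ?E1 / crossprod U ?E2) * (Dlt ?E1 * Dlt1 ?E2)"
    unfolding fern_factor_def U0 e1 by simp
  also have "\<dots> = Dlt (insert 0 U) * Dlt1 D * (crossprod {0} ?E1 * crossprod {1..n} ?E2) *
      (facprod (?M + y) U / facprod (?M + z) U) * (Dlt ?E1 * Dlt1 ?E2)" by (simp only: i2)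
  finally have F: "fern_factor n x y z U D = \<dots>" .
  show ?thesis
    unfolding F D1 D2 e2 i1 using p q fp[of n] fp[of "n + y"] fp[of "n + z"] fp[of "?M + z"] fp[of "?M + y"]
    by (simp add: divide_simps)
qed

section \<open>Shifted factorials and the comparison of two ferns\<close>

lemma rising_fact:
  fixes v :: nat and k :: int
  assumes "1 \<le> v" "1 \<le> int v + k"
  shows "rising (real v) k = fact (nat (int v + k - 1)) / fact (v - 1)"
proof (cases "0 \<le> k")
  case True
  then obtain l where l: "k = int l" by (rule nonneg_int_cases)
  have "fact (v - 1 + l) = (fact (v - 1) * pochhammer (real v) l :: real)"
    using pochhammer_product[of "v - 1" "v - 1 + l" "1 :: real"] assms(1)
    by (simp add: pochhammer_fact of_nat_diff)
  moreover have "nat (int v + k - 1) = v - 1 + l" using l assms(1) by simp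
  ultimately show ?thesis using True l by (simp add: rising_def)
next
  case False
  then obtain l where l: "k = - int l" by (metis le_cases nonpos_int_cases)
  have "fact (v - 1) = (fact (v - 1 - l) * (\<Prod>i = 1..l. real v - real i))" if "l < v" for l
    using that
  proof (induction l)
    case (Suc l)
    have "fact (v - 1 - l) = real (v - 1 - l) * fact (v - 1 - Suc l)"
      using Suc.prems by (subst fact_reduce) auto
    moreover have "real (v - 1 - l) = real v - real (Suc l)" using Suc.prems by (simp add: of_nat_diff)
    ultimately show ?case using Suc by (simp add: mult_ac)
  qed simp
  then have "fact (v - 1) = (fact (v - 1 - l) * (\<Prod>i = 1..l. real v - real i) :: real)"
    using l assms by simp
  moreover have "nat (int v + k - 1) = v - 1 - l" using l assms by linarith
  moreover have "(\<Prod>i = 1..l. real v - real i) \<noteq> 0" using l assms by auto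
  ultimately show ?thesis using False l by (simp add: rising_def field_simps)
qed

text \<open>All shifted factorials in \<open>T u (a + m - 1) m\<close> are reordered to have length \<open>a\<close>.\<close>

lemma T_fact:
  assumes "1 \<le> u"
  shows "T u (int a + int m - 1) m = (\<Prod>q<m. fact (u + q + a - 1) / fact (u + q - 1))"
proof -
  have "T u (int a + int m - 1) m = (\<Prod>i<m. fact (u + (m - Suc i) + a - 1) / fact (u + i - 1))"
    unfolding T_def
  proof (rule prod.cong[OF refl])
    fix i assume "i \<in> {..<m}"
    then have i: "i < m" by simp
    have "rising (real (u + i)) (int a + int m - 1 - 2 * int i)
        = fact (nat (int (u + i) + (int a + int m - 1 - 2 * int i) - 1)) / fact (u + i - 1)"
      by (rule rising_fact) (use assms i in auto)
    also have "nat (int (u + i) + (int a + int m - 1 - 2 * int i) - 1) = u + (m - Suc i) + a - 1"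
      using assms i by linarith
    finally show "rising (real u + real i) (int a + int m - 1 - 2 * int i)
        = fact (u + (m - Suc i) + a - 1) / fact (u + i - 1)" by simp
  qed
  also have "\<dots> = (\<Prod>i<m. fact (u + (m - Suc i) + a - 1)) / (\<Prod>i<m. fact (u + i - 1))"
    by (rule prod_dividef)
  also have "(\<Prod>i<m. fact (u + (m - Suc i) + a - 1)) = (\<Prod>q<m. fact (u + q + a - 1) :: real)"
    by (rule prod.nat_diff_reindex)
  finally show ?thesis by (simp add: prod_dividef)
qed

lemma T_pos: "1 \<le> u \<Longrightarrow> 0 < T u (int a + int m - 1) m"
  unfolding T_fact by (intro prod_pos) auto

lemma prod_lessThan_add:
  fixes a b :: nat
  shows "(\<Prod>q<a + b. f q :: real) = (\<Prod>q<a. f q) * (\<Prod>q<b. f (a + q))"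
  by (induction b) (simp_all add: mult_ac)

context
  fixes as :: "nat list" and k :: nat
  assumes len: "length as = 2 * k"
begin

lemma o_sum_step: "1 \<le> i \<Longrightarrow> i \<le> k \<Longrightarrow> o_sum i as = entry as (2 * i - 1) + o_sum (Suc i) as"
proof -
  assume i: "1 \<le> i" "i \<le> k"
  have "{j. i \<le> j \<and> 2 * j - 1 \<in> {1..length as}} = insert i {j. Suc i \<le> j \<and> 2 * j - 1 \<in> {1..length as}}"
    using i len by auto
  moreover have "finite {j. Suc i \<le> j \<and> 2 * j - 1 \<in> {1..length as}}"
    by (rule finite_subset[of _ "{0..length as}"]) auto
  ultimately show ?thesis by (simp add: o_sum_def)
qed

lemma e_sum_step: "1 \<le> i \<Longrightarrow> i \<le> k \<Longrightarrow> e_sum i as = entry as (2 * i) + e_sum (Suc i) as"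
proof -
  assume i: "1 \<le> i" "i \<le> k"
  have "{j. i \<le> j \<and> 2 * j \<in> {1..length as}} = insert i {j. Suc i \<le> j \<and> 2 * j \<in> {1..length as}}"
    using i len by auto
  moreover have "finite {j. Suc i \<le> j \<and> 2 * j \<in> {1..length as}}"
    by (rule finite_subset[of _ "{0..length as}"]) auto
  ultimately show ?thesis by (simp add: e_sum_def)
qed

lemma oe_sum_end: "o_sum (Suc k) as = 0" "e_sum (Suc k) as = 0"
proof -
  have "{j. Suc k \<le> j \<and> 2 * j - 1 \<in> {1..length as}} = {}" "{j. Suc k \<le> j \<and> 2 * j \<in> {1..length as}} = {}"
    using len by auto
  then show "o_sum (Suc k) as = 0" "e_sum (Suc k) as = 0" unfolding o_sum_def e_sum_def by (simp_all only: sum.empty)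
qed

lemma o_sum_1: "o_sum 1 as = odd_sum as"
proof -
  have "odd_sum as = sum (entry as) ((\<lambda>i. 2 * i - 1) ` {i. 1 \<le> i \<and> 2 * i - 1 \<in> {1..length as}})"
  proof -
    have "(\<lambda>i. 2 * i - 1) ` {i. 1 \<le> i \<and> 2 * i - 1 \<in> {1..length as}} = {i \<in> {1..length as}. odd i}"
    proof (intro equalityI subsetI)
      fix j assume "j \<in> {i \<in> {1..length as}. odd i}"
      then obtain t where "j = 2 * t + 1" "j \<in> {1..length as}" by (auto elim: oddE)
      then show "j \<in> (\<lambda>i. 2 * i - 1) ` {i. 1 \<le> i \<and> 2 * i - 1 \<in> {1..length as}}"
        by (intro image_eqI[of _ _ "t + 1"]) auto
    qed auto
    then show ?thesis by (simp add: odd_sum_def)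
  qed
  also have "\<dots> = o_sum 1 as" unfolding o_sum_def by (subst sum.reindex) (auto simp: inj_on_def)
  finally show ?thesis ..
qed

lemma oe_sum_total: "1 \<le> i \<Longrightarrow> i \<le> Suc k \<Longrightarrow> s_sum (2 * i - 2) as + o_sum i as + e_sum i as = s_sum (length as) as"
proof (induction i rule: dec_induct)
  case base
  show ?case
  proof -
    have "o_sum 1 as = odd_sum as" by (rule o_sum_1)
    moreover have "e_sum 1 as = even_sum as"
    proof -
      have "e_sum 1 as = sum (entry as) ((\<lambda>i. 2 * i) ` {i. 1 \<le> i \<and> 2 * i \<in> {1..length as}})"
        unfolding e_sum_def by (subst sum.reindex) (auto simp: inj_on_def)
      also have "(\<lambda>i. 2 * i) ` {i. 1 \<le> i \<and> 2 * i \<in> {1..length as}} = {i \<in> {1..length as}. even i}"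
        by (auto elim!: evenE)
      finally show ?thesis by (simp add: even_sum_def)
    qed
    ultimately show ?thesis using odd_even_sum[of as] by simp
  qed
next
  case (step i)
  have "s_sum (2 * i) as = s_sum (2 * i - 1) as + entry as (2 * i)"
    "s_sum (2 * i - 1) as = s_sum (2 * i - 1 - 1) as + entry as (2 * i - 1)"
    using step by (intro s_sum_pred; simp)+
  moreover have "2 * i - 1 - 1 = 2 * i - 2" "2 * Suc i - 2 = 2 * i" by simp_all
  moreover have "o_sum i as = entry as (2 * i - 1) + o_sum (Suc i) as" "e_sum i as = entry as (2 * i) + e_sum (Suc i) as"
    "s_sum (2 * i - 2) as + o_sum i as + e_sum i as = s_sum (length as) as"
    using step o_sum_step[of i] e_sum_step[of i] by simp_all
  ultimately show ?case by (simp only:)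
qed

lemma prod_oddpos:
  fixes g :: "nat \<Rightarrow> real"
  shows "(\<Prod>t\<in>oddpos as. g t) = (\<Prod>i = 1..k. \<Prod>q<entry as (2 * i - 1). g (s_sum (2 * i - 2) as + 1 + q))"
proof -
  let ?B = "\<lambda>i. {s_sum (i - 1) as + 1..<s_sum (i - 1) as + 1 + entry as i}"
  have "(\<Prod>t\<in>oddpos as. g t) = (\<Prod>i\<in>{i\<in>{1..length as}. odd i}. \<Prod>t\<in>?B i. g t)"
    unfolding oddpos_def blocks_def
  proof (rule prod.UNION_disjoint)
    show "\<forall>i\<in>{i\<in>{1..length as}. odd i}. \<forall>j\<in>{i\<in>{1..length as}. odd i}. i \<noteq> j \<longrightarrow> ?B i \<inter> ?B j = {}"
    proof (intro ballI impI)
      fix i j assume ij: "i \<in> {i\<in>{1..length as}. odd i}" "j \<in> {i\<in>{1..length as}. odd i}" "i \<noteq> j"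
      then show "?B i \<inter> ?B j = {}"
        using blocks_disjoint[of i j as] blocks_disjoint[of j i as] by (cases "i < j") (auto simp: Int_commute)
    qed
  qed auto
  also have "{i\<in>{1..length as}. odd i} = (\<lambda>i. 2 * i - 1) ` {1..k}"
  proof (intro equalityI subsetI)
    fix j assume "j \<in> {i \<in> {1..length as}. odd i}"
    then obtain t where "j = 2 * t + 1" "j \<in> {1..length as}" by (auto elim: oddE)
    then show "j \<in> (\<lambda>i. 2 * i - 1) ` {1..k}" using len by (intro image_eqI[of _ _ "t + 1"]) auto
  qed (use len in auto)
  also have "(\<Prod>i\<in>(\<lambda>i. 2 * i - 1) ` {1..k}. \<Prod>t\<in>?B i. g t) = (\<Prod>i = 1..k. \<Prod>t\<in>?B (2 * i - 1). g t)"
  proof -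
    have inj: "inj_on (\<lambda>i :: nat. 2 * i - 1) {1..k}" by (auto simp: inj_on_def)
    show ?thesis by (subst prod.reindex[OF inj]) (simp only: o_def)
  qed
  also have "\<dots> = (\<Prod>i = 1..k. \<Prod>q<entry as (2 * i - 1). g (s_sum (2 * i - 2) as + 1 + q))"
  proof (rule prod.cong[OF refl])
    fix i :: nat
    have "2 * i - 1 - 1 = 2 * i - 2" by simp
    then show "(\<Prod>t\<in>?B (2 * i - 1). g t) = (\<Prod>q<entry as (2 * i - 1). g (s_sum (2 * i - 2) as + 1 + q))"
      by (intro prod.reindex_bij_witness[of _ "\<lambda>q. s_sum (2 * i - 2) as + 1 + q" "\<lambda>t. t - (s_sum (2 * i - 2) as + 1)"]) auto
  qed
  finally show ?thesis .
qed

text \<open>The odd-numbered segments are moved to the left one after the other, so that the segments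
  \<open>2 i - 1, \<dots>, 2 k - 1\<close> form a single block when the gap \<open>a\<^bsub>2 i - 2\<^esub>\<close> is closed.\<close>

lemma prod_oddpos_telescope:
  fixes g :: "nat \<Rightarrow> real"
  assumes g: "\<And>t. g t \<noteq> 0" and k: "1 \<le> k"
  shows "(\<Prod>t\<in>oddpos as. g t) = (\<Prod>t = 1..odd_sum as. g t) *
    (\<Prod>i = 2..k. \<Prod>q<o_sum i as. g (s_sum (2 * i - 2) as + 1 + q) / g (s_sum (2 * i - 3) as + 1 + q))"
proof -
  define B where "B i = (\<Prod>q<o_sum i as. g (s_sum (2 * i - 2) as + 1 + q))" for i
  define C where "C i = (\<Prod>q<o_sum i as. g (s_sum (2 * i - 3) as + 1 + q))" for i
  have C0: "C i \<noteq> 0" for i by (simp add: C_def g)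
  have step: "B i = (\<Prod>q<entry as (2 * i - 1). g (s_sum (2 * i - 2) as + 1 + q)) * C (Suc i)"
    if "i \<in> {1..k}" for i
  proof -
    let ?a = "entry as (2 * i - 1)"
    have s: "s_sum (2 * Suc i - 3) as = s_sum (2 * i - 2) as + ?a"
    proof -
      have "2 * Suc i - 3 = 2 * i - 1" "2 * i - 1 - 1 = 2 * i - 2" by auto
      then show ?thesis using s_sum_pred[of "2 * i - 1" as] that by simp
    qed
    have "B i = (\<Prod>q<?a + o_sum (Suc i) as. g (s_sum (2 * i - 2) as + 1 + q))"
      using o_sum_step[of i] that by (simp add: B_def)
    also have "\<dots> = (\<Prod>q<?a. g (s_sum (2 * i - 2) as + 1 + q)) * (\<Prod>q<o_sum (Suc i) as. g (s_sum (2 * i - 2) as + 1 + (?a + q)))"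
      by (rule prod_lessThan_add)
    finally show ?thesis unfolding C_def s by (simp only: add_ac)
  qed
  have CSk: "C (Suc k) = 1" by (simp add: C_def oe_sum_end)
  have "(\<Prod>t\<in>oddpos as. g t) = (\<Prod>i = 1..k. B i / C (Suc i))"
    unfolding prod_oddpos using step C0 by (intro prod.cong) auto
  also have "\<dots> = (\<Prod>i = 1..k. B i) / (\<Prod>i = Suc 1..Suc k. C i)"
    unfolding prod.shift_bounds_cl_Suc_ivl by (rule prod_dividef)
  also have "(\<Prod>i = 1..k. B i) = B 1 * (\<Prod>i = 2..k. B i)"
    using k by (simp add: prod.atLeast_Suc_atMost numeral_2_eq_2)
  also have "(\<Prod>i = Suc 1..Suc k. C i) = (\<Prod>i = 2..k. C i)"
    using k CSk by (simp add: numeral_2_eq_2)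
  also have "B 1 * (\<Prod>i = 2..k. B i) / (\<Prod>i = 2..k. C i) = B 1 * (\<Prod>i = 2..k. B i / C i)"
    by (simp add: prod_dividef)
  also have "B 1 = (\<Prod>t = 1..odd_sum as. g t)"
    unfolding B_def o_sum_1[unfolded One_nat_def] using o_sum_1
    by (intro prod.reindex_bij_witness[of _ "\<lambda>t. t - 1" Suc]) auto
  finally show ?thesis by (simp add: B_def C_def prod_dividef)
qed

lemma facprod_oddpos:
  assumes k: "1 \<le> k"
  defines "n \<equiv> s_sum (length as) as"
  shows "facprod (n + w) (oddpos as) = facprod (n + w) {1..odd_sum as} *
    (\<Prod>i = 2..k. T (w + sigma as i + 2) (int (entry as (2 * i - 2)) + int (o_sum i as) - 1) (o_sum i as)
       / T (w + e_sum i as + 1) (int (entry as (2 * i - 2)) + int (o_sum i as) - 1) (o_sum i as))"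
proof -
  let ?g = "\<lambda>t. fact (n + w - t) * fact (n + w + t) :: real"
  have "(\<Prod>q<o_sum i as. ?g (s_sum (2 * i - 2) as + 1 + q) / ?g (s_sum (2 * i - 3) as + 1 + q))
      = T (w + sigma as i + 2) (int (entry as (2 * i - 2)) + int (o_sum i as) - 1) (o_sum i as)
       / T (w + e_sum i as + 1) (int (entry as (2 * i - 2)) + int (o_sum i as) - 1) (o_sum i as)"
    if i: "i \<in> {2..k}" for i
  proof -
    let ?a = "entry as (2 * i - 2)" and ?o = "o_sum i as" and ?e = "e_sum i as" and ?s = "s_sum (2 * i - 3) as"
    have s2: "s_sum (2 * i - 2) as = ?s + ?a"
    proof -
      have "2 * i - 2 - 1 = 2 * i - 3" by simp
      then show ?thesis using s_sum_pred[of "2 * i - 2" as] i by simp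
    qed
    have n: "n = ?s + ?a + ?o + ?e" using oe_sum_total[of i] i s2 by (simp add: n_def)
    have "(\<Prod>q<?o. ?g (?s + ?a + 1 + q) / ?g (?s + 1 + q))
        = (\<Prod>q<?o. fact (w + ?e + (?o - Suc q)) / fact (w + ?e + (?o - Suc q) + ?a)) *
          (\<Prod>q<?o. fact (w + n + ?s + 1 + q + ?a) / fact (w + n + ?s + 1 + q))"
      unfolding prod.distrib[symmetric]
    proof (rule prod.cong[OF refl])
      fix q assume "q \<in> {..<?o}"
      then have e1: "n + w - (?s + ?a + 1 + q) = w + ?e + (?o - Suc q)"
        "n + w - (?s + 1 + q) = w + ?e + (?o - Suc q) + ?a" using n by auto
      have e2: "n + w + (?s + ?a + 1 + q) = w + n + ?s + 1 + q + ?a" "n + w + (?s + 1 + q) = w + n + ?s + 1 + q"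
        by simp_all
      show "?g (?s + ?a + 1 + q) / ?g (?s + 1 + q) =
          fact (w + ?e + (?o - Suc q)) / fact (w + ?e + (?o - Suc q) + ?a) *
          (fact (w + n + ?s + 1 + q + ?a) / fact (w + n + ?s + 1 + q))"
        unfolding e1 e2 by (rule times_divide_times_eq[symmetric])
    qed
    also have "(\<Prod>q<?o. fact (w + ?e + (?o - Suc q)) / fact (w + ?e + (?o - Suc q) + ?a))
        = (\<Prod>q<?o. fact (w + ?e + q) / fact (w + ?e + q + ?a) :: real)"
      by (rule prod.nat_diff_reindex[of "\<lambda>q. fact (w + ?e + q) / fact (w + ?e + q + ?a)"])
    also have "\<dots> = 1 / T (w + ?e + 1) (int ?a + int ?o - 1) ?o"
      by (subst T_fact) (simp_all add: prod_dividef add_ac)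
    also have "(\<Prod>q<?o. fact (w + n + ?s + 1 + q + ?a) / fact (w + n + ?s + 1 + q))
        = T (w + sigma as i + 2) (int ?a + int ?o - 1) ?o"
      by (subst T_fact) (simp_all add: sigma_def n_def add_ac)
    finally show ?thesis unfolding s2 by simp
  qed
  then show ?thesis
    unfolding facprod_def by (subst prod_oddpos_telescope[OF _ k]) auto
qed

end

section \<open>The second product formula\<close>

lemma pair_sums: "odd_sum [a, b] = a" "even_sum [a, b] = b" "s_sum (length [a, b]) [a, b] = a + b"
proof -
  have "{i. i \<in> {1..length [a, b]} \<and> odd i} = {1}" "{i. i \<in> {1..length [a, b]} \<and> even i} = {2}"
    by (auto simp: le_Suc_eq)
  then show "odd_sum [a, b] = a" "even_sum [a, b] = b"
    unfolding odd_sum_def even_sum_def by (simp_all add: entry_def)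
  then show "s_sum (length [a, b]) [a, b] = a + b" using odd_even_sum[of "[a, b]"] by simp
qed

lemma pair_positions: "oddpos [a, b] = {1..a}" "evenpos [a, b] = {a + 1..a + b}"
proof -
  have "{i \<in> {1..length [a, b]}. odd i} = {1}" "{i \<in> {1..length [a, b]}. even i} = {2}"
    by (auto simp: le_Suc_eq)
  moreover have "entry [a, b] 1 = a" "entry [a, b] 2 = b" "s_sum (1 - 1) [a, b] = 0" "s_sum (2 - 1) [a, b] = a"
    by (simp_all add: entry_def s_sum_def)
  ultimately have "oddpos [a, b] = {0 + 1..<0 + 1 + a}" "evenpos [a, b] = {a + 1..<a + 1 + b}"
    unfolding oddpos_def evenpos_def blocks_def by (simp_all only: UN_insert UN_empty Un_empty_right)
  then show "oddpos [a, b] = {1..a}" "evenpos [a, b] = {a + 1..a + b}" by auto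
qed

lemma blocks_image: "blocks (f ` I) p l = blocks I (\<lambda>i. p (f i)) (\<lambda>i. l (f i))"
  by (simp add: blocks_def)

lemma K_positions:
  fixes as :: "nat list" and k y :: nat
  assumes len: "length as = 2 * k" and k: "1 \<le> k"
  defines "t \<equiv> 0 # (entry as 1 + 1) # tl as @ [y]" and "n \<equiv> s_sum (length as) as"
  shows "blocks {i\<in>{1..length t}. even i} (\<lambda>i. s_sum (i - 1) t) (entry t) = insert 0 (oddpos as) \<union> {n + 1..n + y}"
    and "even_sum t = Suc (y + odd_sum as)"
proof -
  have ne: "as \<noteq> []" using len k by auto
  then obtain a l where as: "as = a # l" by (cases as) auto
  have ll: "length l = 2 * k - 1" using len as by simp
  have lt: "length t = 2 * k + 2" using ll k by (simp add: t_def as)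
  have e1: "entry t 1 = 0" "entry t 2 = hd as + 1" by (simp_all add: t_def entry_def as)
  have e: "entry t (Suc i) = entry as i" if i: "2 \<le> i" "i \<le> 2 * k" for i
  proof -
    have "i = Suc (Suc (i - 2))" using i(1) by simp
    then obtain j where j: "i = Suc (Suc j)" by blast
    moreover have "j < length l" using i(2) j ll by linarith
    ultimately show ?thesis by (simp add: t_def as entry_def nth_append)
  qed
  have ey: "entry t (2 * k + 2) = y"
  proof -
    obtain j where j: "k = Suc j" using k by (cases k) auto
    then show ?thesis using ll by (simp add: t_def as entry_def nth_append)
  qed
  have s: "s_sum (Suc i) t = s_sum i as + 1" if "1 \<le> i" "i \<le> 2 * k" for i
    using that
  proof (induction i rule: dec_induct)
    case base
    have "s_sum (Suc 1) t = entry t 1 + entry t 2" by (simp add: s_sum_def numeral_2_eq_2)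
    then show ?case using e1 ne by (simp add: s_sum_def entry_def hd_conv_nth)
  next
    case (step i)
    then show ?case using e[of "Suc i"] by (simp add: s_sum_Suc)
  qed
  let ?p = "\<lambda>i. s_sum (i - 1) t"
  let ?O = "{i\<in>{3..length as}. odd i}"
  have I: "{i\<in>{1..length t}. even i} = {2} \<union> (Suc ` ?O \<union> {2 * k + 2})"
  proof (rule Set.set_eqI)
    fix i
    have "i \<in> Suc ` ?O \<longleftrightarrow> 4 \<le> i \<and> i \<le> 2 * k + 1 \<and> even i"
    proof
      assume "4 \<le> i \<and> i \<le> 2 * k + 1 \<and> even i"
      then have "i - 1 \<in> ?O" "i = Suc (i - 1)" using len by auto
      then show "i \<in> Suc ` ?O" by (rule rev_image_eqI)
    qed (use len in auto)
    moreover have "i \<noteq> 1" "i \<noteq> 3" "i \<noteq> 2 * k + 1" if "even i" using that by auto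
    ultimately show "i \<in> {i\<in>{1..length t}. even i} \<longleftrightarrow> i \<in> {2} \<union> (Suc ` ?O \<union> {2 * k + 2})"
      using lt k by (simp only: mem_Collect_eq Un_iff singleton_iff atLeastAtMost_iff) force
  qed
  have b1: "blocks {2} ?p (entry t) = insert 0 {1..hd as}"
    using e1 by (auto simp: blocks_def s_sum_def)
  have b2: "blocks (Suc ` ?O) ?p (entry t) = blocks ?O (\<lambda>i. s_sum (i - 1) as + 1) (entry as)"
    unfolding blocks_image
  proof (rule blocks_cong)
    fix i assume i: "i \<in> ?O"
    then have "s_sum (Suc (i - 1)) t = s_sum (i - 1) as + 1" using len by (intro s) auto
    moreover have "entry t (Suc i) = entry as i" using i len by (intro e) auto
    ultimately show "s_sum (Suc i - 1) t = s_sum (i - 1) as + 1 \<and> entry t (Suc i) = entry as i"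
      using i by simp
  qed
  have b3: "blocks {2 * k + 2} ?p (entry t) = {n + 1..n + y}"
  proof -
    have "s_sum (2 * k + 2 - 1) t = n + 1" using s[of "2 * k"] k len by (simp add: n_def)
    then show ?thesis using ey by (auto simp: blocks_def)
  qed
  show pos: "blocks {i\<in>{1..length t}. even i} ?p (entry t) = insert 0 (oddpos as) \<union> {n + 1..n + y}"
    unfolding I blocks_Un b1 b2 b3 oddpos_first[OF ne] by blast
  have "even_sum t = card (blocks {i\<in>{1..length t}. even i} ?p (entry t))"
    by (rule card_even_blocks[symmetric])
  also have "\<dots> = Suc (y + odd_sum as)"
  proof -
    have o: "1 \<le> q \<and> q \<le> n" if "q \<in> oddpos as" for q
      using that oddpos_Un_evenpos[of as] by (auto simp: n_def)
    then have "insert 0 (oddpos as) \<inter> {n + 1..n + y} = {}" "0 \<notin> oddpos as" by fastforce+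
    then show ?thesis unfolding pos by (subst card_Un_disjoint) (auto simp: card_oddpos)
  qed
  finally show "even_sum t = Suc (y + odd_sum as)" .
qed

lemma Q_positions:
  fixes as :: "nat list" and k z :: nat
  assumes len: "length as = 2 * k" and k: "1 \<le> k"
  defines "t \<equiv> butlast as @ [entry as (2 * k) + z]" and "n \<equiv> s_sum (length as) as"
  shows "evenpos t = evenpos as \<union> {n + 1..n + z}" and "even_sum t = z + even_sum as"
proof -
  have lt: "length t = 2 * k" using len k by (simp add: t_def)
  have e: "entry t i = entry as i" if "1 \<le> i" "i < 2 * k" for i
    using that len by (simp add: t_def entry_def nth_append nth_butlast)
  have ek: "entry t (2 * k) = entry as (2 * k) + z"
    using len k by (simp add: t_def entry_def nth_append)
  have s: "s_sum i t = s_sum i as" if "i < 2 * k" for i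
    using that unfolding s_sum_def by (intro sum.cong e) auto
  let ?I = "{i\<in>{1..2 * k - 1}. even i}" and ?p = "\<lambda>i. s_sum (i - 1) t + 1"
  have I: "{i\<in>{1..2 * k}. even i} = ?I \<union> {2 * k}" using k by (auto simp: le_less)
  have "blocks ?I ?p (entry t) = blocks ?I (\<lambda>i. s_sum (i - 1) as + 1) (entry as)"
    by (rule blocks_cong) (auto simp: s e)
  moreover have "blocks {2 * k} ?p (entry t) = blocks {2 * k} (\<lambda>i. s_sum (i - 1) as + 1) (entry as) \<union> {n + 1..n + z}"
    using s_sum_pred[of "2 * k" as] k s[of "2 * k - 1"] ek len by (auto simp: blocks_def n_def)
  ultimately show pos: "evenpos t = evenpos as \<union> {n + 1..n + z}"
    unfolding evenpos_def lt len I blocks_Un by blast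
  have "q \<le> n" if "q \<in> evenpos as" for q
    using that oddpos_Un_evenpos[of as] by (auto simp: n_def)
  then have "evenpos as \<inter> {n + 1..n + z} = {}" by fastforce
  then show "even_sum t = z + even_sum as"
    unfolding card_evenpos[symmetric] pos by (subst card_Un_disjoint) auto
qed

lemma second_formula:
  fixes x y z k :: nat and as :: "nat list"
  assumes len: "length as = 2 * k" and k: "2 \<le> k"
  defines "\<tau> \<equiv> \<lambda>i u. T u (int (entry as (2 * i - 2)) + int (o_sum i as) - 1) (o_sum i as)"
  shows "M_H5 x y z as = 2 ^ entry as 1 * M_H5 x y z [odd_sum as, even_sum as]
    * (K' (0 # (entry as 1 + 1) # tl as @ [y]) * Q (butlast as @ [entry as (2 * k) + z])
       / (P' y (y + 2 * odd_sum as + 1) (even_sum as) * P (z + even_sum as) (z + even_sum as) (odd_sum as)))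
    * (\<Prod>i = 2..k. (\<tau> i (x + z + e_sum i as + 1) * \<tau> i (y + e_sum i as + 1))
          / (\<tau> i (x + y + e_sum i as + 1) * \<tau> i (z + e_sum i as + 1))
          * ((\<tau> i (x + y + sigma as i + 2) * \<tau> i (z + sigma as i + 2))
             / (\<tau> i (x + z + sigma as i + 2) * \<tau> i (y + sigma as i + 2))))"
proof -
  let ?o = "odd_sum as" and ?e = "even_sum as"
  define n where "n = s_sum (length as) as"
  let ?U = "oddpos as" and ?D = "evenpos as" and ?Uo = "{1..?o}" and ?Do = "{?o + 1..?o + ?e}"
  let ?Fy = "{n + 1..n + y}" and ?Fz = "{n + 1..n + z}"
  have k1: "1 \<le> k" using k by simp
  have ne: "as \<noteq> []" using len k by auto
  have n: "n = ?o + ?e" using odd_even_sum[of as] by (simp add: n_def)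
  have hd: "hd as = entry as 1" using ne by (simp add: entry_def hd_conv_nth)
  define \<rho> where "\<rho> w = (\<Prod>i = 2..k. \<tau> i (w + sigma as i + 2) / \<tau> i (w + e_sum i as + 1))" for w
  have \<rho>_pos: "0 < \<rho> w" for w
    unfolding \<rho>_def \<tau>_def by (intro prod_pos ballI divide_pos_pos T_pos) auto
  have fac: "facprod (n + w) ?U = facprod (n + w) ?Uo * \<rho> w" for w
    unfolding \<rho>_def \<tau>_def n_def by (rule facprod_oddpos[OF len k1])
  have UD: "?U \<union> ?D = {1..n}" "?U \<inter> ?D = {}"
    using oddpos_Un_evenpos[of as] oddpos_Int_evenpos[of as] by (simp_all add: n_def)
  have UD0: "?Uo \<union> ?Do = {1..n}" "?Uo \<inter> ?Do = {}" by (auto simp: n)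
  define u where "u = ucoef (y + ?o)"
  define l where "l = lcoef (z + ?e)"
  define Z where "Z = common_sum n x y z"
  define \<kappa> where "\<kappa> = crossprod {0} {n + x + z + 1..n + x + y} * crossprod {1..n} {n + x + y + 1..n + x + z} *
        (Dlt {n + x + z + 1..n + x + y} * Dlt1 {n + x + y + 1..n + x + z}) /
       (crossprod {0} ?Fy * crossprod {1..n} ?Fz * (Dlt ?Fy * Dlt1 ?Fz))"
  have ul: "0 < u" "0 < l" by (simp_all add: u_def l_def ucoef_pos lcoef_pos)
  define kk where "kk = K' (0 # (entry as 1 + 1) # tl as @ [y])"
  define qq where "qq = Q (butlast as @ [entry as (2 * k) + z])"
  define pp' where "pp' = P' y (y + 2 * ?o + 1) ?e"
  define pp where "pp = P (z + ?e) (z + ?e) ?o"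
  have K: "kk = u * Dlt (insert 0 ?U \<union> ?Fy)"
    unfolding kk_def using K'_formula[of "0 # (entry as 1 + 1) # tl as @ [y]"]
    by (simp only: K_positions[OF len k1] n_def u_def) simp
  have Q: "qq = l * Dlt1 (?D \<union> ?Fz)"
    unfolding qq_def Q_formula by (simp only: Q_positions[OF len k1] n_def l_def)
  have P': "pp' = 2 ^ ?o * (u * Dlt (insert 0 ?Uo \<union> ?Fy))"
  proof -
    have "insert 0 ?Uo = {0..?o}" by auto
    then show ?thesis unfolding pp'_def P'_formula by (simp add: u_def n)
  qed
  have P: "pp = l * Dlt1 (?Do \<union> ?Fz)"
  proof -
    have "{?o + 1..?o + (z + ?e)} = ?Do \<union> ?Fz" by (auto simp: n)
    then show ?thesis unfolding pp_def P_formula by (simp add: l_def)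
  qed
  have pp_pos: "0 < pp'" "0 < pp"
    unfolding P' P using ul by (auto intro!: mult_pos_pos Dlt_pos Dlt1_pos)
  have M: "M_H5 x y z as = 2 ^ entry as 1 * (u * l) * (fern_factor n x y z ?U ?D * Z)"
    using M_H5_factored[OF ne, of x y z] by (simp add: hd u_def l_def Z_def n_def)
  have M0: "M_H5 x y z [?o, ?e] = 2 ^ ?o * (u * l) * (fern_factor n x y z ?Uo ?Do * Z)"
    using M_H5_factored[of "[?o, ?e]" x y z] unfolding pair_sums pair_positions by (simp add: u_def l_def Z_def n)
  let ?f = "\<lambda>w. facprod (n + w) ?Uo"
  have f_pos: "0 < ?f w" for w by (rule facprod_pos)
  have F: "fern_factor n x y z ?U ?D * (?f y * \<rho> y * (?f (x + z) * \<rho> (x + z)))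
      = Dlt (insert 0 ?U \<union> ?Fy) * Dlt1 (?D \<union> ?Fz) * (?f z * \<rho> z * (?f (x + y) * \<rho> (x + y))) * \<kappa>"
    using fern_factor_ratio[OF UD, of x y z] unfolding add.assoc[of n x] fac \<kappa>_def by (simp add: add.assoc)
  have F0: "fern_factor n x y z ?Uo ?Do * (?f y * ?f (x + z))
      = Dlt (insert 0 ?Uo \<union> ?Fy) * Dlt1 (?Do \<union> ?Fz) * (?f z * ?f (x + y)) * \<kappa>"
    using fern_factor_ratio[OF UD0, of x y z] unfolding \<kappa>_def by (simp add: add.assoc)
  have prod: "(\<Prod>i = 2..k. (\<tau> i (x + z + e_sum i as + 1) * \<tau> i (y + e_sum i as + 1))
          / (\<tau> i (x + y + e_sum i as + 1) * \<tau> i (z + e_sum i as + 1))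
          * ((\<tau> i (x + y + sigma as i + 2) * \<tau> i (z + sigma as i + 2))
             / (\<tau> i (x + z + sigma as i + 2) * \<tau> i (y + sigma as i + 2))))
      = \<rho> z * \<rho> (x + y) / (\<rho> y * \<rho> (x + z))"
    by (simp add: \<rho>_def prod_dividef[symmetric] prod.distrib[symmetric] mult_ac)
  have F': "fern_factor n x y z ?U ?D = Dlt (insert 0 ?U \<union> ?Fy) * Dlt1 (?D \<union> ?Fz) *
      (?f z * \<rho> z * (?f (x + y) * \<rho> (x + y))) * \<kappa> / (?f y * \<rho> y * (?f (x + z) * \<rho> (x + z)))"
    unfolding F[symmetric] using f_pos[of y] f_pos[of "x + z"] \<rho>_pos[of y] \<rho>_pos[of "x + z"] by simp
  have F0': "fern_factor n x y z ?Uo ?Do = Dlt (insert 0 ?Uo \<union> ?Fy) * Dlt1 (?Do \<union> ?Fz) *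
      (?f z * ?f (x + y)) * \<kappa> / (?f y * ?f (x + z))"
    unfolding F0[symmetric] using f_pos[of y] f_pos[of "x + z"] by simp
  have M0': "M_H5 x y z [?o, ?e] = pp' * pp * (Z * \<kappa> * (?f z * ?f (x + y)) / (?f y * ?f (x + z)))"
    unfolding M0 F0' P' P by simp
  have "M_H5 x y z as = 2 ^ entry as 1 * (kk * qq) * (Z * \<kappa> * (?f z * ?f (x + y)) / (?f y * ?f (x + z)))
      * (\<rho> z * \<rho> (x + y) / (\<rho> y * \<rho> (x + z)))"
    unfolding M F' K Q by (simp add: mult_ac)
  also have "\<dots> = 2 ^ entry as 1 * M_H5 x y z [?o, ?e] * (kk * qq / (pp' * pp)) * (\<rho> z * \<rho> (x + y) / (\<rho> y * \<rho> (x + z)))"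
    unfolding M0' using pp_pos by simp
  finally show ?thesis unfolding prod kk_def qq_def pp'_def pp_def .
qed

section \<open>The Racah-type sum\<close>

text \<open>The sum over the position \<open>s\<close> of a single lozenge that crosses the line. The factors are the
  interactions with the positions up to \<open>N\<close> and with those from \<open>m + 1\<close> to \<open>w\<close>; they vanish unless
  \<open>N < s \<le> m\<close>. In terms of \<open>u = s\<^sup>2\<close>, an increase of \<open>N\<close> multiplies the summand by
  \<open>u - (N + 1)\<^sup>2\<close> and a decrease of \<open>m\<close> multiplies it by \<open>m\<^sup>2 - u\<close>. The sum of the two multipliers does
  not depend on \<open>u\<close>, which gives a recursion.\<close>

definition inner_fac :: "nat \<Rightarrow> nat \<Rightarrow> real" where
  "inner_fac N s = real s * (\<Prod>a\<le>N. (real s)\<^sup>2 - (real a)\<^sup>2)"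

definition outer_fac :: "nat \<Rightarrow> nat \<Rightarrow> nat \<Rightarrow> real" where
  "outer_fac m w s = (\<Prod>e = m + 1..w. (real e)\<^sup>2 - (real s)\<^sup>2)"

definition racah1 :: "nat \<Rightarrow> nat \<Rightarrow> nat \<Rightarrow> real" where
  "racah1 N m w = (\<Sum>s\<le>w. inner_fac N s * outer_fac m w s)"

lemma inner_fac_Suc: "inner_fac (Suc N) s = inner_fac N s * ((real s)\<^sup>2 - (real (Suc N))\<^sup>2)"
  by (simp add: inner_fac_def)

lemma outer_fac_step: "Suc m \<le> w \<Longrightarrow> outer_fac m w s = ((real (Suc m))\<^sup>2 - (real s)\<^sup>2) * outer_fac (Suc m) w s"
  by (simp add: outer_fac_def prod.atLeast_Suc_atMost)

lemma inner_fac_0: "s \<le> N \<Longrightarrow> inner_fac N s = 0"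
  by (auto simp: inner_fac_def)

lemma outer_fac_0: "m < s \<Longrightarrow> s \<le> w \<Longrightarrow> outer_fac m w s = 0"
  by (auto simp: outer_fac_def)

lemma racah1_rec:
  assumes "Suc m \<le> w"
  shows "racah1 (Suc N) (Suc m) w + racah1 N m w = ((real (Suc m))\<^sup>2 - (real (Suc N))\<^sup>2) * racah1 N (Suc m) w"
  unfolding racah1_def sum.distrib[symmetric] sum_distrib_left inner_fac_Suc outer_fac_step[OF assms]
  by (intro sum.cong) (simp_all add: algebra_simps)

lemma racah1_0: "m \<le> N \<Longrightarrow> racah1 N m w = 0"
  unfolding racah1_def
proof (rule sum.neutral, rule ballI)
  fix s assume "m \<le> N" "s \<in> {..w}"
  then show "inner_fac N s * outer_fac m w s = 0"
    using inner_fac_0[of s N] outer_fac_0[of m s w] by (cases "s \<le> N") auto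
qed

lemma inner_fac_fact: "N < s \<Longrightarrow> inner_fac N s = (real s)\<^sup>2 * fact (s + N) / fact (s - N - 1)"
proof (induction N)
  case 0
  then have "fact s = real s * fact (s - 1)" by (simp add: fact_reduce)
  then show ?case by (simp add: inner_fac_def power2_eq_square)
next
  case (Suc N)
  have 1: "fact (s - N - 1) = real (s - Suc N) * fact (s - Suc N - 1)"
    using Suc.prems by (subst fact_reduce) auto
  have 2: "fact (s + Suc N) = real (s + Suc N) * fact (s + N)" by simp
  have 3: "(real s)\<^sup>2 - (real (Suc N))\<^sup>2 = real (s - Suc N) * real (s + Suc N)"
    using Suc.prems by (simp add: of_nat_diff power2_eq_square algebra_simps)
  have d: "real (s - Suc N) \<noteq> 0" using Suc.prems by simp
  have frac: "A * B / (d * C) * (d * t) = A * (t * B) / C" if "d \<noteq> 0" for A B C d t :: real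
    using that by simp
  have "inner_fac N s = (real s)\<^sup>2 * fact (s + N) / fact (s - N - 1)" using Suc by simp
  then show ?case unfolding inner_fac_Suc 2 3 1 by (simp only: frac[OF d])
qed

lemma outer_fac_fact: "s \<le> m \<Longrightarrow> m \<le> w \<Longrightarrow> outer_fac m w s = (fact (w - s) * fact (w + s)) / (fact (m - s) * fact (m + s))"
  using crossprod_interval[of "{s}" m w] by (simp add: crossprod_def outer_fac_def facprod_def)

lemma racah1_formula:
  "Suc (N + k) \<le> w \<Longrightarrow> racah1 N (Suc (N + k)) w =
    fact (N + 1) * fact (w + 1) * fact (N + w + 1) * fact (w - Suc (N + k))
      / (2 * fact (w + 1 - k) * fact (N + k) * fact k)"
proof (induction k arbitrary: N)
  case 0
  have "inner_fac N s * outer_fac (Suc N) w s = 0" if "s \<in> {..w} - {Suc N}" for s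
  proof (cases "s \<le> N")
    case False
    then have "Suc N < s" "s \<le> w" using that by auto
    then show ?thesis by (simp add: outer_fac_0)
  qed (simp add: inner_fac_0)
  then have "racah1 N (Suc N) w = (\<Sum>s\<in>{Suc N}. inner_fac N s * outer_fac (Suc N) w s)"
    unfolding racah1_def using 0 by (intro sum.mono_neutral_right) auto
  also have "\<dots> = (real (Suc N))\<^sup>2 * fact (Suc N + N) * ((fact (w - Suc N) * fact (w + Suc N)) / fact (Suc N + Suc N))"
    using 0 inner_fac_fact[of N "Suc N"] outer_fac_fact[of "Suc N" "Suc N" w] by (simp del: fact_Suc)
  also have "fact (Suc N + Suc N) = 2 * real (Suc N) * fact (Suc N + N)" by simp
  also have "(real (Suc N))\<^sup>2 * fact (Suc N + N) * ((fact (w - Suc N) * fact (w + Suc N)) / (2 * real (Suc N) * fact (Suc N + N)))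
      = (real (Suc N) * fact N) * fact (w + 1) * fact (w + Suc N) * fact (w - Suc N) / (2 * fact (w + 1) * fact N * 1)"
  proof -
    have "n\<^sup>2 * X * ((Y * Z) / (2 * n * X)) = (n * F) * W * Z * Y / (2 * W * F * 1)"
      if "n \<noteq> 0" "X \<noteq> 0" "W \<noteq> 0" "F \<noteq> 0" for n X Y Z F W :: real
      using that by (simp add: field_simps power2_eq_square)
    then show ?thesis by (simp only: fact_nonzero of_nat_eq_0_iff nat.distinct simp_thms)
  qed
  finally have r: "racah1 N (Suc N) w = \<dots>" .
  have f: "fact (N + 1) = real (Suc N) * fact N" "w + Suc N = N + w + 1" by simp_all
  show ?case unfolding add_0_right diff_zero fact_0 r f ..
next
  case (Suc k)
  let ?m = "Suc (N + k)"
  have w: "Suc (Suc (N + k)) \<le> w" using Suc.prems by simp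
  define c where "c = real w + 1 - real k"
  have cpos: "0 < c" using w by (simp add: c_def)
  have r1: "racah1 (Suc N) (Suc ?m) w = fact (N + 2) * fact (w + 1) * fact (N + w + 2) * fact (w - Suc ?m)
      / (2 * fact (w + 1 - k) * fact (Suc N + k) * fact k)"
    using Suc.IH[of "Suc N"] w by simp
  have r2: "racah1 N ?m w = fact (N + 1) * fact (w + 1) * fact (N + w + 1) * fact (w - ?m)
      / (2 * fact (w + 1 - k) * fact (N + k) * fact k)"
    using Suc.IH[of N] w by simp
  have f1: "fact (w - ?m) = (real w - real ?m) * fact (w - Suc ?m)"
    using w by (subst fact_reduce) (auto simp: of_nat_diff)
  have f2: "fact (w + 1 - k) = c * fact (w - k)"
    using w by (subst fact_reduce) (auto simp: of_nat_diff c_def)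
  have f3: "fact (N + 2) = real (N + 2) * fact (N + 1)" "fact (N + w + 2) = real (N + w + 2) * fact (N + w + 1)"
    "fact (Suc N + k) = real (Suc N + k) * fact (N + k)" "fact (Suc k) = real (Suc k) * fact k" by simp_all
  have pol: "real (N + 2) * real (N + w + 2) + (real w - real ?m) * real ?m = c * (real (Suc ?m) + real (Suc N))"
    by (simp add: c_def algebra_simps)
  have d: "(real (Suc ?m))\<^sup>2 - (real (Suc N))\<^sup>2 = real (Suc k) * (real (Suc ?m) + real (Suc N))"
    by (simp add: power2_eq_square algebra_simps)
  let ?F = "fact (N + 1) * fact (w + 1) * fact (N + w + 1) * fact (w - Suc ?m) / (2 * fact (w - k) * fact (N + k) * fact k) :: real"
  have "racah1 (Suc N) (Suc ?m) w = ?F * (real (N + 2) * real (N + w + 2) / (c * real ?m))"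
    unfolding r1 f2 f3 using cpos by (simp add: field_simps)
  moreover have "racah1 N ?m w = ?F * ((real w - real ?m) / c)"
    unfolding r2 f2 f1 using cpos by (simp add: field_simps)
  ultimately have "real (Suc k) * (real (Suc ?m) + real (Suc N)) * racah1 N (Suc ?m) w
      = ?F * (real (N + 2) * real (N + w + 2) / (c * real ?m) + (real w - real ?m) / c)"
    using racah1_rec[OF w, of N] unfolding d by (simp add: distrib_left)
  also have "real (N + 2) * real (N + w + 2) / (c * real ?m) + (real w - real ?m) / c
      = (real (N + 2) * real (N + w + 2) + (real w - real ?m) * real ?m) / (c * real ?m)"
    using cpos by (simp add: add_divide_distrib)
  also have "\<dots> = (real (Suc ?m) + real (Suc N)) / real ?m" unfolding pol using cpos by simp
  finally have "(real (Suc ?m) + real (Suc N)) * (real (Suc k) * racah1 N (Suc ?m) w)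
      = (real (Suc ?m) + real (Suc N)) * (?F / real ?m)" by (simp add: mult_ac)
  then have "real (Suc k) * racah1 N (Suc ?m) w = ?F / real ?m"
    by (rule mult_left_cancel[THEN iffD1, rotated]) linarith
  then have "racah1 N (Suc ?m) w = ?F / real ?m / real (Suc k)"
    by (metis nonzero_mult_div_cancel_left of_nat_neq_0)
  then have "racah1 N (Suc ?m) w = ?F / (real ?m * real (Suc k))"
    by (simp only: divide_divide_eq_left)
  moreover have "N + Suc k = ?m" "w + 1 - Suc k = w - k" by simp_all
  moreover have "fact ?m = real ?m * (fact (N + k) :: real)" by simp
  ultimately show ?case unfolding f3(4) by (simp add: mult_ac)
qed

lemma dt_permute_rows:
  assumes "p permutes {..<m}"
  shows "dt m (\<lambda>i k. f (p i) k) = signof p * dt m f"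
proof -
  have p: "p permutes {0..<m}" using assms by (simp add: lessThan_atLeast0)
  have "det (mat m m (\<lambda>(i, j). mat m m (\<lambda>(i, k). f i k) $$ (p i, j))) = signof p * det (mat m m (\<lambda>(i, k). f i k))"
    by (rule det_permute_rows) (auto simp: p)
  moreover have "mat m m (\<lambda>(i, j). mat m m (\<lambda>(i, k). f i k) $$ (p i, j)) = mat m m (\<lambda>(i, k). f (p i) k)"
    using permutes_in_image[OF p] by (intro eq_matI) auto
  ultimately show ?thesis by (simp add: dt_def)
qed

lemma dt_transpose: "dt m (\<lambda>i k. f k i) = dt m f"
proof -
  have "transpose_mat (mat m m (\<lambda>(i, k). f i k)) = mat m m (\<lambda>(i, k). f k i)" by (rule eq_matI) auto
  then show ?thesis using det_transpose[of "mat m m (\<lambda>(i, k). f i k)" m] by (simp add: dt_def)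
qed

lemma dt_equal_rows:
  assumes "i < m" "j < m" "i \<noteq> j" "\<And>k. k < m \<Longrightarrow> f i k = f j k"
  shows "dt m f = 0"
  unfolding dt_def
  by (rule det_identical_rows[of _ m i j]) (use assms in \<open>auto intro!: eq_vecI\<close>)

text \<open>Andreief's identity, the continuous form of the formula of Cauchy and Binet. The elements of each
  set \<open>S\<close> may be enumerated in an arbitrary order, as both determinants change their sign with it.\<close>

lemma andreief:
  fixes C :: "nat set" and w :: "nat \<Rightarrow> real" and \<phi> \<psi> :: "nat \<Rightarrow> nat \<Rightarrow> real"
  assumes C: "finite C"
    and e: "\<And>S. S \<subseteq> C \<Longrightarrow> card S = r \<Longrightarrow> inj_on (e S) {..<r} \<and> e S ` {..<r} = S"
  shows "dt r (\<lambda>i k. \<Sum>s\<in>C. w s * \<phi> i s * \<psi> k s) = (\<Sum>S | S \<subseteq> C \<and> card S = r.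
    (\<Prod>s\<in>S. w s) * dt r (\<lambda>i k. \<phi> k (e S i)) * dt r (\<lambda>i k. \<psi> k (e S i)))"
proof -
  let ?X = "PiE {..<r} (\<lambda>_. C)"
  let ?F = "\<lambda>g. (\<Prod>i<r. w (g i) * \<phi> i (g i)) * dt r (\<lambda>i k. \<psi> k (g i))"
  let ?T = "{S. S \<subseteq> C \<and> card S = r}"
  let ?G = "{g\<in>?X. inj_on g {..<r}}"
  have finX: "finite ?X" using C by (simp add: finite_PiE)
  have finT: "finite ?T" by (rule finite_subset[of _ "Pow C"]) (auto simp: C)
  have "dt r (\<lambda>i k. \<Sum>s\<in>C. w s * \<phi> i s * \<psi> k s) = (\<Sum>g\<in>?X. dt r (\<lambda>i k. w (g i) * \<phi> i (g i) * \<psi> k (g i)))"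
    by (rule dt_sum_rows[symmetric]) (rule C)
  also have "\<dots> = (\<Sum>g\<in>?X. ?F g)" by (simp only: dt_scale_rows)
  also have "\<dots> = (\<Sum>g\<in>?G. ?F g)"
  proof (rule sum.mono_neutral_right[OF finX])
    show "\<forall>g\<in>?X - ?G. ?F g = 0"
    proof
      fix g assume "g \<in> ?X - ?G"
      then obtain i j where "i < r" "j < r" "i \<noteq> j" "g i = g j" by (auto simp: inj_on_def)
      then have "dt r (\<lambda>i k. \<psi> k (g i)) = 0" by (intro dt_equal_rows[of i r j]) auto
      then show "?F g = 0" by simp
    qed
  qed auto
  also have "\<dots> = (\<Sum>S\<in>?T. \<Sum>g | g \<in> ?G \<and> g ` {..<r} = S. ?F g)"
  proof (rule sum.group[symmetric])
    show "finite ?G" using finX by simp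
    show "(\<lambda>g. g ` {..<r}) ` ?G \<subseteq> ?T"
    proof
      fix S assume "S \<in> (\<lambda>g. g ` {..<r}) ` ?G"
      then obtain g where "g \<in> ?X" "inj_on g {..<r}" "S = g ` {..<r}" by blast
      then show "S \<in> ?T" by (auto simp: card_image)
    qed
  qed (rule finT)
  also have "\<dots> = (\<Sum>S\<in>?T. (\<Prod>s\<in>S. w s) * dt r (\<lambda>i k. \<phi> k (e S i)) * dt r (\<lambda>i k. \<psi> k (e S i)))"
  proof (rule sum.cong[OF refl])
    fix S assume S: "S \<in> ?T"
    let ?e = "e S"
    have inj: "inj_on ?e {..<r}" and im: "?e ` {..<r} = S" using e S by auto
    let ?H = "\<lambda>p. signof p * (\<Prod>i<r. \<phi> i (?e (p i)))"
    have "(\<Sum>g | g \<in> ?G \<and> g ` {..<r} = S. ?F g)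
        = (\<Sum>p | p permutes {..<r}. (\<Prod>s\<in>S. w s) * ?H p * dt r (\<lambda>i k. \<psi> k (?e i)))"
    proof (rule sum.reindex_bij_witness[where i = "\<lambda>p. \<lambda>i\<in>{..<r}. ?e (p i)"
          and j = "\<lambda>g i. if i < r then inv_into {..<r} ?e (g i) else i"])
      fix g assume "g \<in> {g. g \<in> ?G \<and> g ` {..<r} = S}"
      then have g: "g \<in> ?X" "inj_on g {..<r}" "g ` {..<r} = S" by auto
      let ?p = "\<lambda>i. if i < r then inv_into {..<r} ?e (g i) else i"
      have gi: "g i \<in> ?e ` {..<r}" if "i < r" for i using g(3) im that by blast
      have ep: "?e (?p i) = g i" if "i < r" for i using that gi[OF that] by (simp add: f_inv_into_f)
      show "(\<lambda>i\<in>{..<r}. ?e (?p i)) = g"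
        using g(1) ep by (intro ext) (auto simp: PiE_def extensional_def restrict_def)
      have bij: "bij_betw ?p {..<r} {..<r}"
      proof (rule bij_betw_imageI)
        show injp: "inj_on ?p {..<r}"
          using g(2) ep unfolding inj_on_def by (metis lessThan_iff)
        have "?p ` {..<r} \<subseteq> {..<r}" using gi inv_into_into[of _ ?e "{..<r}"] by fastforce
        then show "?p ` {..<r} = {..<r}" by (rule endo_inj_surj[OF finite_lessThan _ injp])
      qed
      show "?p \<in> {p. p permutes {..<r}}" by (intro CollectI bij_imp_permutes[OF bij]) simp
      then have perm: "?p permutes {..<r}" by simp
      have "(\<Prod>i<r. w (g i)) = (\<Prod>s\<in>S. w s)"
        using prod.reindex[OF g(2), of w] g(3) by simp
      moreover have "(\<Prod>i<r. \<phi> i (?e (?p i))) = (\<Prod>i<r. \<phi> i (g i))" using ep by (intro prod.cong) auto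
      moreover have "dt r (\<lambda>i k. \<psi> k (g i)) = signof ?p * dt r (\<lambda>i k. \<psi> k (?e i))"
        unfolding dt_permute_rows[OF perm, of "\<lambda>i k. \<psi> k (?e i)", symmetric] using ep by (intro dt_cong) auto
      ultimately show "(\<Prod>s\<in>S. w s) * ?H ?p * dt r (\<lambda>i k. \<psi> k (?e i)) = ?F g"
        by (simp add: prod.distrib)
    next
      fix p assume "p \<in> {p. p permutes {..<r}}"
      then have p: "p permutes {..<r}" by simp
      let ?g = "\<lambda>i\<in>{..<r}. ?e (p i)"
      have pi: "p i < r" if "i < r" for i using permutes_in_image[OF p, of i] that by simp
      show "(\<lambda>i. if i < r then inv_into {..<r} ?e (?g i) else i) = p"
      proof
        fix i show "(if i < r then inv_into {..<r} ?e (?g i) else i) = p i"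
          using pi[of i] inj permutes_not_in[OF p, of i] by (auto simp: inv_into_f_f)
      qed
      have "?g ` {..<r} = ?e ` (p ` {..<r})" by auto
      then have im': "?g ` {..<r} = S" using permutes_image[OF p] im by simp
      moreover have "inj_on ?g {..<r}"
      proof (rule inj_onI)
        fix i j assume ij: "i \<in> {..<r}" "j \<in> {..<r}" "?g i = ?g j"
        then have "?e (p i) = ?e (p j)" by simp
        then have "p i = p j" using inj_onD[OF inj, of "p i" "p j"] pi ij(1,2) by simp
        then show "i = j" using injD[OF permutes_inj[OF p]] by blast
      qed
      moreover have "?g \<in> ?X" using im' S by (intro PiE_I) (blast, simp)
      ultimately show "?g \<in> {g. g \<in> ?G \<and> g ` {..<r} = S}" by simp
    qed
    also have "\<dots> = (\<Prod>s\<in>S. w s) * (\<Sum>p | p permutes {..<r}. ?H p) * dt r (\<lambda>i k. \<psi> k (?e i))"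
      by (simp add: sum_distrib_left sum_distrib_right)
    also have "(\<Sum>p | p permutes {..<r}. ?H p) = dt r (\<lambda>i k. \<phi> i (?e k))" by (simp only: dt_expand)
    also have "\<dots> = dt r (\<lambda>i k. \<phi> k (?e i))" by (rule dt_transpose[symmetric])
    finally show "(\<Sum>g | g \<in> ?G \<and> g ` {..<r} = S. ?F g)
      = (\<Prod>s\<in>S. w s) * dt r (\<lambda>i k. \<phi> k (?e i)) * dt r (\<lambda>i k. \<psi> k (?e i))" .
  qed
  finally show ?thesis .
qed

lemma inner_fac_add: "inner_fac (n + i) s = inner_fac n s * (\<Prod>k<i. (real s)\<^sup>2 - (real (n + 1 + k))\<^sup>2)"
  by (induction i) (simp_all add: inner_fac_Suc mult_ac)

lemma outer_fac_diff:
  "k \<le> m \<Longrightarrow> m \<le> w \<Longrightarrow> outer_fac (m - k) w s = (\<Prod>l<k. (real (m - l))\<^sup>2 - (real s)\<^sup>2) * outer_fac m w s"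
proof (induction k)
  case (Suc k)
  have e: "Suc (m - Suc k) = m - k" using Suc.prems by simp
  have "outer_fac (m - Suc k) w s = ((real (m - k))\<^sup>2 - (real s)\<^sup>2) * outer_fac (m - k) w s"
    using outer_fac_step[of "m - Suc k" w s] Suc.prems unfolding e by simp
  then show ?case using Suc by (simp add: mult_ac)
qed simp

lemma prod_minus_flip: "(\<Prod>l<k. \<beta> l - v) = (- 1) ^ k * (\<Prod>l<k. v - \<beta> l :: real)"
  by (induction k) (simp_all add: algebra_simps)

text \<open>Both Vandermonde products of squares in the summand become determinants, one with factors
  \<open>s\<^sup>2 - (n + 1 + k)\<^sup>2\<close> and one with factors \<open>(M + r - l)\<^sup>2 - s\<^sup>2\<close>. These extend the interactions with the
  positions to the left and to the right, so that Andreief's identity leads to sums with one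
  position.\<close>

lemma common_sum_dt:
  fixes n x y z :: nat
  defines "r \<equiv> min y z" and "w \<equiv> max y z" and "M \<equiv> n + x"
  shows "common_sum n x y z = (\<Prod>j<r. (- 1) ^ j) * dt r (\<lambda>i j. racah1 (n + i) (M + r - j) (M + w))"
proof -
  let ?C = "{..M + w}" and ?sgn = "\<Prod>j<r. (- 1 :: real) ^ j"
  let ?wt = "\<lambda>s. inner_fac n s * outer_fac (M + r) (M + w) s"
  let ?\<phi> = "\<lambda>i s. \<Prod>k<i. (real s)\<^sup>2 - (real (n + 1 + k))\<^sup>2"
  let ?\<psi> = "\<lambda>k s. \<Prod>l<k. (real (M + r - l))\<^sup>2 - (real s)\<^sup>2"
  have rw: "r \<le> w" by (simp add: r_def w_def)
  have "\<exists>e. strict_mono_on {..<r} e \<and> e ` {..<r} = S" if "S \<subseteq> ?C \<and> card S = r" for S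
  proof -
    have "finite S" using that finite_subset by blast
    then show ?thesis using that by (metis sorted_enumeration)
  qed
  then obtain e where e: "\<And>S. S \<subseteq> ?C \<and> card S = r \<Longrightarrow> strict_mono_on {..<r} (e S) \<and> e S ` {..<r} = S"
    by metis
  have dphi: "dt r (\<lambda>i k. ?\<phi> k (e S i)) = Dlt S" if "S \<subseteq> ?C \<and> card S = r" for S
    using e[OF that] Dlt_enumeration[of r "e S"] by (simp add: dt_newton)
  have dpsi: "dt r (\<lambda>i k. ?\<psi> k (e S i)) = ?sgn * Dlt S" if "S \<subseteq> ?C \<and> card S = r" for S
    unfolding prod_minus_flip dt_scale_cols[where c = "\<lambda>k. (- 1) ^ k"] dt_newton
    using e[OF that] Dlt_enumeration[of r "e S"] by simp
  have "dt r (\<lambda>i j. racah1 (n + i) (M + r - j) (M + w)) = dt r (\<lambda>i j. \<Sum>s\<in>?C. ?wt s * ?\<phi> i s * ?\<psi> j s)"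
    unfolding racah1_def using rw
    by (intro dt_cong sum.cong refl) (simp add: inner_fac_add outer_fac_diff mult_ac)
  also have "\<dots> = (\<Sum>S | S \<subseteq> ?C \<and> card S = r.
      (\<Prod>s\<in>S. ?wt s) * dt r (\<lambda>i k. ?\<phi> k (e S i)) * dt r (\<lambda>i k. ?\<psi> k (e S i)))"
    by (rule andreief) (use e in \<open>auto intro: strict_mono_on_imp_inj_on\<close>)
  also have "\<dots> = ?sgn * (\<Sum>S | S \<subseteq> ?C \<and> card S = r. (\<Prod>s\<in>S. ?wt s) * (Dlt S * Dlt S))"
    unfolding sum_distrib_left
  proof (rule sum.cong[OF refl])
    fix S assume "S \<in> {S. S \<subseteq> ?C \<and> card S = r}"
    then have S: "S \<subseteq> ?C \<and> card S = r" by simp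
    show "(\<Prod>s\<in>S. ?wt s) * dt r (\<lambda>i k. ?\<phi> k (e S i)) * dt r (\<lambda>i k. ?\<psi> k (e S i))
        = ?sgn * ((\<Prod>s\<in>S. ?wt s) * (Dlt S * Dlt S))"
      unfolding dphi[OF S] dpsi[OF S] by (simp only: mult_ac)
  qed
  also have "(\<Sum>S | S \<subseteq> ?C \<and> card S = r. (\<Prod>s\<in>S. ?wt s) * (Dlt S * Dlt S))
      = (\<Sum>S | S \<subseteq> {n + 1..M + r} \<and> card S = r. (\<Prod>s\<in>S. ?wt s) * (Dlt S * Dlt S))"
  proof (rule sum.mono_neutral_right)
    show "finite {S. S \<subseteq> ?C \<and> card S = r}" by (rule finite_subset[of _ "Pow ?C"]) auto
    show "{S. S \<subseteq> {n + 1..M + r} \<and> card S = r} \<subseteq> {S. S \<subseteq> ?C \<and> card S = r}" using rw by fastforce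
    show "\<forall>S\<in>{S. S \<subseteq> ?C \<and> card S = r} - {S. S \<subseteq> {n + 1..M + r} \<and> card S = r}. (\<Prod>s\<in>S. ?wt s) * (Dlt S * Dlt S) = 0"
    proof
      fix S assume S: "S \<in> {S. S \<subseteq> ?C \<and> card S = r} - {S. S \<subseteq> {n + 1..M + r} \<and> card S = r}"
      then obtain s where s: "s \<in> S" "s \<notin> {n + 1..M + r}" by blast
      have "s \<le> M + w" using S s by auto
      then have "?wt s = 0"
        using s inner_fac_0[of s n] outer_fac_0[of "M + r" s "M + w"] by (cases "s \<le> n") auto
      moreover have "finite S" using S finite_subset[of S ?C] by auto
      ultimately have "(\<Prod>s\<in>S. ?wt s) = 0" using s(1) by (intro prod_zero) auto
      then show "(\<Prod>s\<in>S. ?wt s) * (Dlt S * Dlt S) = 0" by simp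
    qed
  qed
  also have "\<dots> = common_sum n x y z"
  proof -
    have E: "{n + x + z + 1..n + x + y} \<union> {n + x + y + 1..n + x + z} = {M + r + 1..M + w}"
      by (auto simp: M_def r_def w_def)
    have "(\<Prod>s\<in>S. ?wt s) * (Dlt S * Dlt S) = Dlt S * Dlt1 S * crossprod {0..n} S * crossprod S {M + r + 1..M + w}" for S
    proof -
      have "crossprod {0..n} S = (\<Prod>s\<in>S. \<Prod>a\<le>n. (real s)\<^sup>2 - (real a)\<^sup>2)"
        unfolding crossprod_def atLeast0AtMost by (rule prod.swap)
      then show ?thesis
        by (simp add: inner_fac_def outer_fac_def Dlt1_def crossprod_def prod.distrib mult_ac)
    qed
    then show ?thesis
      unfolding common_sum_def E unfolding r_def[symmetric] M_def[symmetric] by (intro sum.cong refl)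
  qed
  finally have "dt r (\<lambda>i j. racah1 (n + i) (M + r - j) (M + w)) = ?sgn * common_sum n x y z" .
  moreover have "?sgn * ?sgn = 1"
    by (simp add: prod.distrib[symmetric] power_mult_distrib[symmetric])
  ultimately show ?thesis by (metis mult.assoc mult_1)
qed

text \<open>Up to the order of the columns, this is MacMahon's determinant for plane partitions in a box.\<close>

lemma dt_binomial:
  fixes x A r :: nat
  assumes xA: "x \<le> A"
  shows "dt r (\<lambda>i j. if i + j < x + r then real (A choose (x + r - 1 - (i + j))) else 0)
    = dt r (\<lambda>l k. if l + k + 1 = r then 1 else 0) * vdm r real *
      (\<Prod>j<r. fact (A + j) / (fact (x + j) * fact (A - x + j)))"
proof -
  let ?B = "\<lambda>i j. if i \<le> x + j then real (A choose (x + j - i)) else 0"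
  let ?J = "\<lambda>l k. if l + k + 1 = r then 1 else 0 :: real"
  have "dt r (\<lambda>i j. if i + j < x + r then real (A choose (x + r - 1 - (i + j))) else 0)
      = dt r (\<lambda>i j. \<Sum>l<r. ?B i l * ?J l j)"
  proof (rule dt_cong)
    fix i j assume ij: "i < r" "j < r"
    have "(\<Sum>l<r. ?B i l * ?J l j) = (\<Sum>l<r. if l = r - 1 - j then ?B i l else 0)"
      using ij by (intro sum.cong) auto
    also have "\<dots> = ?B i (r - 1 - j)" using ij by simp
    also have "\<dots> = (if i + j < x + r then real (A choose (x + r - 1 - (i + j))) else 0)"
    proof -
      have "x + (r - 1 - j) - i = x + r - 1 - (i + j)" "i \<le> x + (r - 1 - j) \<longleftrightarrow> i + j < x + r" using ij by auto
      then show ?thesis by (simp only:)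
    qed
    finally show "(if i + j < x + r then real (A choose (x + r - 1 - (i + j))) else 0) = (\<Sum>l<r. ?B i l * ?J l j)" ..
  qed
  also have "\<dots> = dt r ?B * dt r ?J" by (rule dt_mult)
  also have "dt r ?B = dt r (\<lambda>i j. if i \<le> x + j then real ((A + j) choose (x + j - i)) else 0)"
  proof -
    let ?U = "\<lambda>l j. real (j choose l)"
    have "(\<Sum>l<r. ?B i l * ?U l j) = (if i \<le> x + j then real ((A + j) choose (x + j - i)) else 0)"
      if ij: "i < r" "j < r" for i j
    proof (cases "i \<le> x + j")
      case True
      \<comment> \<open>Vandermonde's convolution; its summation index is \<open>j - l\<close>.\<close>
      have "(\<Sum>l<r. ?B i l * ?U l j) = (\<Sum>l\<in>{l. l \<le> j \<and> i \<le> x + l}. real (j choose (j - l)) * real (A choose (x + l - i)))"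
        using ij by (intro sum.mono_neutral_cong_right)
          (auto simp: binomial_symmetric[symmetric] binomial_eq_0 not_le mult.commute)
      also have "\<dots> = (\<Sum>k\<in>{k. k \<le> j \<and> k \<le> x + j - i}. real (j choose k) * real (A choose (x + j - i - k)))"
        using True by (intro sum.reindex_bij_witness[where i = "\<lambda>k. j - k" and j = "\<lambda>l. j - l"]) auto
      also have "\<dots> = (\<Sum>k\<le>x + j - i. real (j choose k) * real (A choose (x + j - i - k)))"
        by (intro sum.mono_neutral_left) (auto simp: binomial_eq_0 not_le)
      also have "\<dots> = real ((j + A) choose (x + j - i))"
        unfolding vandermonde[symmetric] by simp
      finally show ?thesis using True by (simp add: add.commute)
    next
      case False
      have "?B i l * ?U l j = 0" for l using False by (cases "l \<le> j") (auto simp: binomial_eq_0 not_le)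
      then have "(\<Sum>l<r. ?B i l * ?U l j) = 0" by (intro sum.neutral) blast
      then show ?thesis using False by simp
    qed
    then have "dt r (\<lambda>i j. if i \<le> x + j then real ((A + j) choose (x + j - i)) else 0) = dt r (\<lambda>i j. \<Sum>l<r. ?B i l * ?U l j)"
      by (intro dt_cong) simp
    also have "\<dots> = dt r ?B * dt r ?U" by (rule dt_mult)
    also have "dt r ?U = 1" by (subst dt_upper) (auto simp: binomial_eq_0)
    finally show ?thesis by simp
  qed
  also have "\<dots> = dt r (\<lambda>i j. (1 / fact (A - x + i)) * ((fact (A + j) / fact (x + j)) * (\<Prod>l<i. real (x + j) - real l)))"
  proof (rule dt_cong)
    fix i j assume "i < r" "j < r"
    show "(if i \<le> x + j then real ((A + j) choose (x + j - i)) else 0)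
        = (1 / fact (A - x + i)) * ((fact (A + j) / fact (x + j)) * (\<Prod>l<i. real (x + j) - real l))"
    proof (cases "i \<le> x + j")
      case True
      have "fact (x + j) = fact (x + j - i) * (\<Prod>l<i. real (x + j) - real l)"
        using True
      proof (induction i)
        case (Suc i)
        have "fact (x + j - i) = real (x + j - i) * fact (x + j - Suc i)"
          using Suc.prems by (subst fact_reduce) auto
        then show ?case using Suc by (simp add: of_nat_diff mult_ac)
      qed simp
      moreover have "real ((A + j) choose (x + j - i)) = fact (A + j) / (fact (x + j - i) * fact (A - x + i))"
      proof -
        have "A + j - (x + j - i) = A - x + i" "x + j - i \<le> A + j" using True xA by auto
        then show ?thesis by (subst binomial_fact) auto
      qed
      moreover have "(\<Prod>l<i. real (x + j) - real l) \<noteq> 0" using True by auto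
      ultimately show ?thesis using True by (simp add: field_simps)
    next
      case False
      then have "(\<Prod>l<i. real (x + j) - real l) = 0" by (intro prod_zero bexI[of _ "x + j"]) auto
      then show ?thesis using False by simp
    qed
  qed
  also have "\<dots> = (\<Prod>i<r. 1 / fact (A - x + i)) * ((\<Prod>j<r. fact (A + j) / fact (x + j)) *
      dt r (\<lambda>i j. \<Prod>l<i. real (x + j) - real l))"
    by (simp only: dt_scale_rows dt_scale_cols[where c = "\<lambda>j. fact (A + j) / fact (x + j)"])
  also have "dt r (\<lambda>i j. \<Prod>l<i. real (x + j) - real l) = dt r (\<lambda>j i. \<Prod>l<i. real (x + j) - real l)"
    by (rule dt_transpose)
  also have "\<dots> = vdm r real" unfolding dt_newton by (simp add: vdm_def)
  finally show ?thesis by (simp add: prod_dividef prod.distrib mult_ac)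
qed

text \<open>The constant \<open>\<kappa>\<close> does not depend on \<open>x\<close>.\<close>

lemma common_sum_formula:
  fixes n y z :: nat
  defines "r \<equiv> min y z" and "w \<equiv> max y z"
  obtains \<kappa> where "\<And>x. common_sum n x y z =
    \<kappa> * (\<Prod>i<r. fact (2 * n + x + w + 1 + i) * fact (n + x + w + 1 + i) / (fact (n + x + i) * fact (x + i)))"
proof -
  define \<kappa> where "\<kappa> = (\<Prod>j<r. (- 1) ^ j) * (dt r (\<lambda>l k. if l + k + 1 = r then 1 else 0) * vdm r real *
    (\<Prod>i<r. fact (n + i + 1) * fact (w - r + i) / (2 * fact (n + w + 1 + i))))"
  have rw: "r \<le> w" by (simp add: r_def w_def)
  have "common_sum n x y z = \<kappa> * (\<Prod>i<r. fact (2 * n + x + w + 1 + i) * fact (n + x + w + 1 + i) / (fact (n + x + i) * fact (x + i)))" for x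
  proof -
    let ?M = "n + x"
    let ?A = "?M + w + 1"
    let ?B = "\<lambda>i j. if i + j < x + r then real (?A choose (x + r - 1 - (i + j))) else 0"
    have entry: "racah1 (n + i) (?M + r - j) (?M + w)
        = (fact (n + i + 1) * fact (n + i + ?M + w + 1)) * ((fact (w - r + j) / (2 * fact (?M + (r - Suc j)))) * ?B i j)"
      if ij: "i < r" "j < r" for i j
    proof (cases "i + j < x + r")
      case True
      define k where "k = x + r - 1 - (i + j)"
      have m: "?M + r - j = Suc (n + i + k)" using True ij by (simp add: k_def)
      have e: "?M + w - Suc (n + i + k) = w - r + j" "n + i + k = ?M + (r - Suc j)" "k \<le> ?A" "?A - k = ?M + w + 1 - k"
        using True ij rw by (auto simp: k_def)
      have "racah1 (n + i) (?M + r - j) (?M + w) = fact (n + i + 1) * fact ?A * fact (n + i + (?M + w) + 1) *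
          fact (w - r + j) / (2 * fact (?A - k) * fact (?M + (r - Suc j)) * fact k)"
        unfolding m using racah1_formula[of "n + i" k "?M + w"] True ij rw unfolding e(1,2)[symmetric]
        by (simp add: k_def)
      moreover have "?B i j = fact ?A / (fact k * fact (?A - k))"
        using True e(3) by (simp only: if_True k_def[symmetric] binomial_fact)
      ultimately show ?thesis by (simp add: add.assoc mult_ac)
    next
      case False
      then have "?M + r - j \<le> n + i" using ij by simp
      then show ?thesis using False by (simp add: racah1_0)
    qed
    have "dt r (\<lambda>i j. racah1 (n + i) (?M + r - j) (?M + w)) = dt r (\<lambda>i j. (fact (n + i + 1) * fact (n + i + ?M + w + 1)) *
        ((fact (w - r + j) / (2 * fact (?M + (r - Suc j)))) * ?B i j))"
      by (rule dt_cong) (rule entry)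
    also have "\<dots> = (\<Prod>i<r. fact (n + i + 1) * fact (n + i + ?M + w + 1)) *
        ((\<Prod>j<r. fact (w - r + j) / (2 * fact (?M + (r - Suc j)))) * dt r ?B)"
      by (simp only: dt_scale_rows dt_scale_cols[where c = "\<lambda>j. fact (w - r + j) / (2 * fact (?M + (r - Suc j)))"])
    also have "(\<Prod>j<r. fact (w - r + j) / (2 * fact (?M + (r - Suc j)))) = (\<Prod>j<r. fact (w - r + j) / 2 :: real) / (\<Prod>j<r. fact (?M + (r - Suc j)))"
      unfolding prod_dividef[symmetric] by (simp add: divide_divide_eq_left)
    also have "(\<Prod>j<r. fact (?M + (r - Suc j))) = (\<Prod>j<r. fact (?M + j) :: real)"
      by (rule prod.nat_diff_reindex)
    also have "dt r ?B = dt r (\<lambda>l k. if l + k + 1 = r then 1 else 0) * vdm r real *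
        (\<Prod>j<r. fact (?A + j) / (fact (x + j) * fact (?A - x + j)))"
      by (rule dt_binomial) simp
    also note D = calculation
    have ax: "?A - x + j = n + w + 1 + j" "n + j + ?M + w + 1 = 2 * n + x + w + 1 + j" for j by simp_all
    show ?thesis
      unfolding common_sum_dt r_def[symmetric] w_def[symmetric] D ax \<kappa>_def
      by (simp add: prod_dividef prod.distrib add_ac mult_ac)
  qed
  then show ?thesis by (rule that)
qed

section \<open>The first product formula\<close>

lemma fact_prod_shift: "(\<Prod>i<r. fact (Suc c + i)) * fact c = (\<Prod>i<r. fact (c + i)) * (fact (c + r) :: real)"
  by (induction r) (simp_all add: mult_ac)

lemma fact_prod_shift': "(\<Prod>i<r. fact (Suc c + i)) = (\<Prod>i<r. fact (c + i)) * (fact (c + r) / fact c :: real)"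
  using fact_prod_shift[of c r] by (simp add: field_simps del: fact_Suc)

lemma crossprod_top: "crossprod {c + 1..c + k} {c + k + 1} = fact k * fact (2 * c + 2 * k + 1) / fact (2 * c + k + 1)"
proof -
  let ?t = "c + k + 1"
  have aux: "(\<Prod>j = 1..l. real j * (2 * real t - real j)) = fact l * fact (2 * t - 1) / fact (2 * t - 1 - l)"
    if "l \<le> 2 * t - 1" for l t :: nat
    using that
  proof (induction l)
    case (Suc l)
    have "fact (2 * t - 1 - l) = real (2 * t - 1 - l) * fact (2 * t - 1 - Suc l)"
      using Suc.prems by (subst fact_reduce) auto
    moreover have "real (2 * t - 1 - l) = 2 * real t - real (Suc l)" using Suc.prems by (simp add: of_nat_diff)
    moreover have "2 * real t - real (Suc l) \<noteq> 0" using Suc.prems by linarith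
    moreover have "fact l * F / (d * G) * (e * d) = e * fact l * F / G" if "d \<noteq> 0" for d e F G :: real
      using that by simp
    ultimately show ?case using Suc by simp
  qed simp
  have "crossprod {c + 1..c + k} {?t} = (\<Prod>j = 1..k. real j * (2 * real ?t - real j))"
    unfolding crossprod_def
    by (rule prod.reindex_bij_witness[where i = "\<lambda>j. ?t - j" and j = "\<lambda>s. ?t - s"])
      (auto simp: of_nat_diff power2_eq_square algebra_simps)
  also have "\<dots> = fact k * fact (2 * ?t - 1) / fact (2 * ?t - 1 - k)" by (rule aux) simp
  also have "2 * ?t - 1 - k = 2 * c + k + 1" by simp
  also have "2 * ?t - 1 = 2 * c + 2 * k + 1" by simp
  finally show ?thesis .
qed

lemma Dlt1_interval_shift:
  "Dlt1 {c + 2..c + 1 + k} = Dlt1 {c + 1..c + k} *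
     (fact (2 * c + 2 * k + 2) * fact (2 * c + 1) / (fact (2 * c + k + 2) * fact (2 * c + k + 1)))"
proof (induction k)
  case (Suc k)
  have s: "Dlt1 {d + 1..d + Suc k} = Dlt1 {d + 1..d + k} * (real (d + k + 1) * (fact k * fact (2 * d + 2 * k + 1) / fact (2 * d + k + 1)))" for d
  proof -
    have "{d + 1..d + Suc k} = {d + 1..d + k} \<union> {d + k + 1}" by auto
    moreover have "Dlt1 ({d + 1..d + k} \<union> {d + k + 1}) = Dlt1 {d + 1..d + k} * Dlt1 {d + k + 1} * crossprod {d + 1..d + k} {d + k + 1}"
      by (rule Dlt1_Un) auto
    moreover have "Dlt {t} = 1" for t
      unfolding Dlt_def by (intro prod.neutral ballI) auto
    then have "Dlt1 {t} = real t" for t by (simp add: Dlt1_def)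
    ultimately show ?thesis using crossprod_top[of d k] by simp
  qed
  have r: "{c + 2..c + 1 + Suc k} = {Suc c + 1..Suc c + Suc k}" "{c + 2..c + 1 + k} = {Suc c + 1..Suc c + k}" by auto
  let ?X = "fact (2 * c + 2 * k + 1) :: real" and ?Y = "fact (2 * c + k + 1) :: real" and ?W = "fact (2 * c + 1) :: real"
  have f: "fact (2 * Suc c + 2 * k + 1) = real (2 * c + 2 * k + 3) * real (2 * c + 2 * k + 2) * ?X"
    "fact (2 * Suc c + k + 1) = real (2 * c + k + 3) * real (2 * c + k + 2) * ?Y"
    "fact (2 * c + 2 * k + 2) = real (2 * c + 2 * k + 2) * ?X" "fact (2 * c + k + 2) = real (2 * c + k + 2) * ?Y"
    "fact (2 * c + 2 * Suc k + 2) = real (2 * c + 2 * k + 4) * real (2 * c + 2 * k + 3) * real (2 * c + 2 * k + 2) * ?X"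
    "fact (2 * c + Suc k + 2) = real (2 * c + k + 3) * real (2 * c + k + 2) * ?Y"
    "fact (2 * c + Suc k + 1) = real (2 * c + k + 2) * ?Y" by (simp_all add: fact_Suc algebra_simps)
  define D where "D = Dlt1 {c + 1..c + k}"
  have IH: "Dlt1 {Suc c + 1..Suc c + k} = D * (real (2 * c + 2 * k + 2) * ?X * ?W / (real (2 * c + k + 2) * ?Y * ?Y))"
    using Suc unfolding r f(3,4) D_def by simp
  have gen: "D * (A * X * W / (B * Y * Y)) * (m2 * (K * (C * A * X) / (E * B * Y)))
      = D * (m1 * (K * X / Y)) * (G * C * A * X * W / (E * B * Y * (B * Y)))"
    if "m2 * A = m1 * G" "A \<noteq> 0" "B \<noteq> 0" "E \<noteq> 0" "Y \<noteq> 0" for D A X W B Y m1 m2 K C E G :: real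
  proof -
    have "D * (A * X * W / (B * Y * Y)) * (m2 * (K * (C * A * X) / (E * B * Y)))
        = (m2 * A) * (D * X * W * K * C * A * X) / (B * Y * Y * E * B * Y)" using that by (simp add: field_simps)
    also have "\<dots> = D * (m1 * (K * X / Y)) * (G * C * A * X * W / (E * B * Y * (B * Y)))"
      unfolding that(1) using that(2-) by (simp add: field_simps)
    finally show ?thesis .
  qed
  show ?case
    unfolding r s IH f D_def[symmetric]
    by (rule gen; (simp; fail | simp add: algebra_simps))
qed (simp add: Dlt1_def Dlt_def)

lemma prod_interval_fact: "(\<Prod>t\<in>{c + 1..c + k}. real t) = fact (c + k) / fact c"
proof (induction k)
  case (Suc k)
  have "{c + 1..c + Suc k} = insert (c + Suc k) {c + 1..c + k}" by auto
  then show ?case using Suc by simp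
qed simp

lemma Dlt_interval: "Dlt {c + 1..c + k} = Dlt1 {c + 1..c + k} * (fact c / fact (c + k))"
  by (simp only: Dlt1_def prod_interval_fact) simp

lemma facprod_shift:
  assumes "a \<le> n" "n \<le> c"
  shows "facprod (Suc c) {a + 1..n} = facprod c {a + 1..n} * (fact (c - a) / fact (c - n) * (fact (c + 1 + n) / fact (c + 1 + a)))"
  using assms
proof (induction n rule: dec_induct)
  case (step n)
  have i: "{a + 1..Suc n} = insert (Suc n) {a + 1..n}" using step by auto
  have f: "fact (Suc c - Suc n) = real (c - n) * fact (c - Suc n)" "fact (c - n) = real (c - n) * fact (c - Suc n)"
    "fact (Suc c + Suc n) = real (c + n + 2) * fact (c + Suc n)" "fact (c + 1 + Suc n) = real (c + n + 2) * fact (c + 1 + n)"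
    using step by (subst fact_reduce; simp add: algebra_simps)+
  have "c - n \<noteq> 0" using step by simp
  have "facprod (Suc c) {a + 1..Suc n} = (fact (Suc c - Suc n) * fact (Suc c + Suc n)) * facprod (Suc c) {a + 1..n}"
    unfolding i by (simp add: facprod_def)
  moreover have "facprod c {a + 1..Suc n} = (fact (c - Suc n) * fact (c + Suc n)) * facprod c {a + 1..n}"
    unfolding i by (simp add: facprod_def)
  moreover have "facprod (Suc c) {a + 1..n} = facprod c {a + 1..n} * (fact (c - a) / fact (c - n) * (fact (c + 1 + n) / fact (c + 1 + a)))"
    using step by simp
  moreover have "(d * p) * (e * q) * (X * (A / (d * p) * (g / B))) = p * q * X * (A / p * (e * g / B))"
    if "d \<noteq> 0" for d p e q X A g B :: real using that by simp
  ultimately show ?case unfolding f using \<open>c - n \<noteq> 0\<close> by simp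
qed (simp add: facprod_def)

lemma facprod_shift_0:
  assumes "a \<le> c"
  shows "facprod (Suc c) {0..a} = facprod c {0..a} * (real (Suc c) * fact (c + 1 + a) / fact (c - a))"
  using assms
proof (induction a)
  case 0
  show ?case by (simp add: facprod_def)
next
  case (Suc a)
  have f: "fact (Suc c - Suc a) = real (c - a) * fact (c - Suc a)" "fact (c - a) = real (c - a) * fact (c - Suc a)"
    "fact (Suc c + Suc a) = real (c + a + 2) * fact (c + Suc a)" "fact (c + 1 + Suc a) = real (c + a + 2) * fact (c + 1 + a)"
    using Suc.prems by (subst fact_reduce; simp add: algebra_simps)+
  have i: "{0..Suc a} = insert (Suc a) {0..a}" by auto
  have "facprod (Suc c) {0..Suc a} = (fact (Suc c - Suc a) * fact (Suc c + Suc a)) * facprod (Suc c) {0..a}"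
    unfolding i by (simp add: facprod_def)
  moreover have "facprod c {0..Suc a} = (fact (c - Suc a) * fact (c + Suc a)) * facprod c {0..a}"
    unfolding i by (simp add: facprod_def)
  moreover have "facprod (Suc c) {0..a} = facprod c {0..a} * (real (Suc c) * fact (c + 1 + a) / fact (c - a))"
    using Suc by simp
  moreover have "c - a \<noteq> 0" using Suc.prems by simp
  moreover have "(d * p) * (e * q) * (X * (s * g / (d * p))) = p * q * X * (s * (e * g) / p)"
    if "d \<noteq> 0" for d p e q X s g :: real using that by simp
  ultimately show ?case unfolding f by simp
qed

lemma T_shift:
  assumes "1 \<le> u"
  shows "T (Suc u) (int a + int m - 1) m = T u (int a + int m - 1) m *
    (fact (u + m + a - 1) / fact (u + a - 1) * (fact (u - 1) / fact (u + m - 1)))"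
proof -
  obtain v where v: "u = Suc v" using assms by (cases u) auto
  have "T (Suc u) (int a + int m - 1) m = (\<Prod>q<m. fact (Suc (v + a) + q)) / (\<Prod>q<m. fact (Suc v + q))"
    unfolding prod_dividef[symmetric] by (subst T_fact) (simp_all add: v add_ac)
  also have "\<dots> = (\<Prod>q<m. fact (v + a + q)) / (\<Prod>q<m. fact (v + q)) *
      (fact (v + a + m) / fact (v + a) * (fact v / fact (v + m)))"
    unfolding fact_prod_shift' by (simp add: mult_ac)
  also have "(\<Prod>q<m. fact (v + a + q)) / (\<Prod>q<m. fact (v + q)) = T u (int a + int m - 1) m"
    unfolding prod_dividef[symmetric] by (subst T_fact) (simp_all add: v add_ac)
  finally show ?thesis by (simp add: v add_ac)
qed

lemma rising2_shift:
  assumes u: "odd u"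
  shows "rising2 (real u + 2) n * real u = rising2 (real u) n * (real u + 2 * of_int n)"
proof (cases "0 \<le> n")
  case True
  then obtain l where l: "n = int l" by (rule nonneg_int_cases)
  have "(\<Prod>i<l. real u + 2 + 2 * real i) * real u = (\<Prod>i<l. real u + 2 * real i) * (real u + 2 * real l)"
  proof (induction l)
    case (Suc l)
    have "(\<Prod>i<Suc l. real u + 2 + 2 * real i) * real u
        = ((\<Prod>i<l. real u + 2 + 2 * real i) * real u) * (real u + 2 * real (Suc l))" by simp
    then show ?case unfolding Suc by (simp add: mult_ac)
  qed simp
  then show ?thesis using l by (simp add: rising2_def)
next
  case False
  then obtain l where l: "n = - int l" by (metis le_cases nonpos_int_cases)
  have nz: "real u - 2 * real i \<noteq> 0" for i
  proof
    assume "real u - 2 * real i = 0"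
    then have "real u = real (2 * i)" by simp
    then have "u = 2 * i" by (simp only: of_nat_eq_iff)
    then show False using u by simp
  qed
  have nz2: "real u + 2 - 2 * real i \<noteq> 0" if "i \<in> {1..l}" for i
    using nz[of "i - 1"] that by (simp add: of_nat_diff)
  have "(\<Prod>i = 1..l. real u - 2 * real i) * real u = (\<Prod>i = 1..l. real u + 2 - 2 * real i) * (real u - 2 * real l)"
  proof (induction l)
    case (Suc l)
    have "(\<Prod>i = 1..Suc l. real u - 2 * real i) * real u
        = ((\<Prod>i = 1..l. real u - 2 * real i) * real u) * (real u - 2 * real (Suc l))" by simp
    then show ?case unfolding Suc by (simp add: algebra_simps)
  qed simp
  moreover have "(\<Prod>i = 1..l. real u - 2 * real i) \<noteq> 0" "(\<Prod>i = 1..l. real u + 2 - 2 * real i) \<noteq> 0"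
    using nz nz2 by auto
  ultimately show ?thesis using False l by (simp add: rising2_def field_simps)
qed

lemma rising2_nonzero:
  assumes "odd u"
  shows "rising2 (real u) n \<noteq> 0"
proof -
  have "real u - 2 * real i \<noteq> 0" "real u + 2 * real i \<noteq> 0" for i
  proof -
    have "u \<noteq> 2 * i" "u \<noteq> 0" using assms odd_pos[OF assms] by auto
    then have "real u \<noteq> real (2 * i)" by (simp only: of_nat_eq_iff) simp
    then show "real u - 2 * real i \<noteq> 0" by simp
    show "real u + 2 * real i \<noteq> 0" using \<open>u \<noteq> 0\<close> by (simp add: add_nonneg_eq_0_iff)
  qed
  then show ?thesis by (auto simp: rising2_def)
qed

lemma V_nonzero: "odd u \<Longrightarrow> V u n m \<noteq> 0"
  using rising2_nonzero[of "u + 2 * i" for i] by (auto simp: V_def)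

lemma odd_prod_fact: "(\<Prod>i<y. 2 * real c + 3 + 2 * real i) = fact (2 * c + 2 * y + 1) * fact c / (fact (2 * c + 1) * fact (c + y) * 2 ^ y)"
proof (induction y)
  case (Suc y)
  have f: "fact (2 * c + 2 * Suc y + 1) = (2 * real c + 3 + 2 * real y) * (2 * real (c + y + 1)) * fact (2 * c + 2 * y + 1)"
    "fact (c + Suc y) = real (c + y + 1) * fact (c + y)" by (simp_all add: algebra_simps)
  have "p * (N * C / (O1 * K * t)) = p * (2 * s) * N * C / (O1 * (s * K) * (2 * t))" if "s \<noteq> 0" for p N C O1 K t s :: real
    using that by simp
  then show ?case unfolding prod.lessThan_Suc Suc f power_Suc
    by (subst mult.commute) (simp only: of_nat_eq_0_iff add_is_0 one_neq_zero simp_thms)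
qed simp

lemma V_shift:
  fixes c y z :: nat
  shows "V (2 * c + 5) (int y + int z - 1) y = V (2 * c + 3) (int y + int z - 1) y *
    (fact (2 * c + 2 * y + 2 * z + 1) * fact (c + z) * fact (2 * c + 1) * fact (c + y)
      / (fact (2 * c + 2 * z + 1) * fact (c + y + z) * fact (2 * c + 2 * y + 1) * fact c))"
proof -
  let ?n = "int y + int z - 1"
  have e: "V (2 * c + 5) ?n y = (\<Prod>i<y. rising2 (real (2 * c + 3 + 2 * i) + 2) (?n - 2 * int i))"
    "V (2 * c + 3) ?n y = (\<Prod>i<y. rising2 (real (2 * c + 3 + 2 * i)) (?n - 2 * int i))"
    by (simp_all add: V_def algebra_simps)
  have "V (2 * c + 5) ?n y * (\<Prod>i<y. 2 * real c + 3 + 2 * real i)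
      = (\<Prod>i<y. rising2 (real (2 * c + 3 + 2 * i) + 2) (?n - 2 * int i) * real (2 * c + 3 + 2 * i))"
    unfolding e prod.distrib by simp
  also have "\<dots> = (\<Prod>i<y. rising2 (real (2 * c + 3 + 2 * i)) (?n - 2 * int i) * (2 * real (c + z) + 3 + 2 * real (y - Suc i)))"
  proof (rule prod.cong[OF refl])
    fix i assume "i \<in> {..<y}"
    then have eq: "real (2 * c + 3 + 2 * i) + 2 * of_int (?n - 2 * int i) = 2 * real (c + z) + 3 + 2 * real (y - Suc i)"
      by (simp add: of_nat_diff algebra_simps)
    have "odd (2 * c + 3 + 2 * i)" by simp
    then show "rising2 (real (2 * c + 3 + 2 * i) + 2) (?n - 2 * int i) * real (2 * c + 3 + 2 * i)
        = rising2 (real (2 * c + 3 + 2 * i)) (?n - 2 * int i) * (2 * real (c + z) + 3 + 2 * real (y - Suc i))"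
      unfolding eq[symmetric] by (rule rising2_shift)
  qed
  also have "\<dots> = V (2 * c + 3) ?n y * (\<Prod>i<y. 2 * real (c + z) + 3 + 2 * real (y - Suc i))"
    unfolding e prod.distrib ..
  also have "(\<Prod>i<y. 2 * real (c + z) + 3 + 2 * real (y - Suc i)) = (\<Prod>i<y. 2 * real (c + z) + 3 + 2 * real i)"
    by (rule prod.nat_diff_reindex[of "\<lambda>i. 2 * real (c + z) + 3 + 2 * real i"])
  finally have m: "V (2 * c + 5) ?n y * (fact (2 * c + 2 * y + 1) * fact c / (fact (2 * c + 1) * fact (c + y) * 2 ^ y))
    = V (2 * c + 3) ?n y * (fact (2 * (c + z) + 2 * y + 1) * fact (c + z) / (fact (2 * (c + z) + 1) * fact (c + z + y) * 2 ^ y))"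
    unfolding odd_prod_fact .
  have gen: "v = v' * (A * B * C' * D' / (C * D * A' * B'))"
    if "v * (A' * B' / (C' * D' * t)) = v' * (A * B / (C * D * t))" "A' \<noteq> 0" "B' \<noteq> 0" "C' \<noteq> 0" "D' \<noteq> 0" "C \<noteq> 0" "D \<noteq> 0" "t \<noteq> 0"
    for v v' A B C D A' B' C' D' t :: real
  proof -
    have "v = (v * (A' * B' / (C' * D' * t))) * (C' * D' * t / (A' * B'))" using that(2-) by simp
    also have "\<dots> = v' * (A * B / (C * D * t)) * (C' * D' * t / (A' * B'))" unfolding that(1) ..
    also have "\<dots> = v' * (A * B * C' * D' / (C * D * A' * B'))" using that(8) by simp
    finally show ?thesis .
  qed
  have i: "2 * (c + z) + 2 * y + 1 = 2 * c + 2 * y + 2 * z + 1" "2 * (c + z) + 1 = 2 * c + 2 * z + 1" "c + z + y = c + y + z"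
    by simp_all
  show ?thesis by (rule gen[OF m[unfolded i]]) simp_all
qed

lemma Dlt1_shift:
  assumes "c \<le> d"
  shows "Dlt1 {c + 2..d + 1} = Dlt1 {c + 1..d} *
    (fact (2 * d + 2) * fact (2 * c + 1) / (fact (c + d + 2) * fact (c + d + 1)))"
proof -
  obtain k where d: "d = c + k" using assms le_Suc_ex by blast
  have i: "c + 1 + k = c + k + 1" "2 * c + 2 * k + 2 = 2 * (c + k) + 2" "2 * c + k + 2 = c + (c + k) + 2"
    "2 * c + k + 1 = c + (c + k) + 1" by simp_all
  show ?thesis using Dlt1_interval_shift[of c k] unfolding d i .
qed

lemma Dlt_shift:
  assumes "c \<le> d"
  shows "Dlt {c + 2..d + 1} = Dlt {c + 1..d} *
    (fact (2 * d + 2) * fact (2 * c + 1) / (fact (c + d + 2) * fact (c + d + 1)) * (real (c + 1) / real (d + 1)))"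
proof -
  obtain k where d: "d = c + k" using assms le_Suc_ex by blast
  have i: "c + 1 + 1 = c + 2" "c + 1 + k = d + 1" by (simp_all add: d)
  have "Dlt {c + 2..d + 1} = Dlt1 {c + 2..d + 1} * (fact (c + 1) / fact (d + 1))"
    using Dlt_interval[of "c + 1" k] unfolding i .
  moreover have "Dlt {c + 1..d} = Dlt1 {c + 1..d} * (fact c / fact d)"
    using Dlt_interval[of c k] unfolding d .
  moreover have "fact (e + 1) = real (e + 1) * fact e" for e by simp
  moreover have "D * K * ((u * f) / (v * g)) = D * (f / g) * (K * (u / v))" for D K u v f g :: real
    by (simp add: mult_ac)
  ultimately show ?thesis by (simp only: Dlt1_shift[OF assms])
qed

lemma crossprod_shift:
  assumes "a \<le> n" "n \<le> c" "c \<le> d"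
  shows "crossprod {a + 1..n} {c + 2..d + 1} = crossprod {a + 1..n} {c + 1..d} *
    ((fact (d - a) / fact (d - n) * (fact (d + 1 + n) / fact (d + 1 + a)))
      / (fact (c - a) / fact (c - n) * (fact (c + 1 + n) / fact (c + 1 + a))))"
proof -
  have "crossprod {a + 1..n} {Suc c + 1..Suc d} = facprod (Suc d) {a + 1..n} / facprod (Suc c) {a + 1..n}"
    "crossprod {a + 1..n} {c + 1..d} = facprod d {a + 1..n} / facprod c {a + 1..n}"
    using assms by (intro crossprod_interval; auto)+
  moreover have "{Suc c + 1..Suc d} = {c + 2..d + 1}" by simp
  moreover have "n \<le> d" using assms by simp
  ultimately show ?thesis
    by (simp only: facprod_shift[OF assms(1,2)] facprod_shift[OF assms(1) \<open>n \<le> d\<close>] times_divide_times_eq)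
qed

lemma crossprod_shift_0:
  assumes "a \<le> c" "c \<le> d"
  shows "crossprod {0..a} {c + 2..d + 1} = crossprod {0..a} {c + 1..d} *
    ((real (Suc d) * fact (d + 1 + a) / fact (d - a)) / (real (Suc c) * fact (c + 1 + a) / fact (c - a)))"
proof -
  have "crossprod {0..a} {Suc c + 1..Suc d} = facprod (Suc d) {0..a} / facprod (Suc c) {0..a}"
    "crossprod {0..a} {c + 1..d} = facprod d {0..a} / facprod c {0..a}"
    using assms by (intro crossprod_interval; auto)+
  moreover have "{Suc c + 1..Suc d} = {c + 2..d + 1}" by simp
  moreover have "a \<le> d" using assms by simp
  ultimately show ?thesis
    by (simp only: facprod_shift_0[OF assms(1)] facprod_shift_0[OF \<open>a \<le> d\<close>] times_divide_times_eq)
qed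

lemma common_sum_shift:
  fixes n x y z :: nat
  defines "r \<equiv> min y z" and "w \<equiv> max y z"
  shows "common_sum n (Suc x) y z = common_sum n x y z *
    (fact (2 * n + x + y + z + 1) / fact (2 * n + x + w + 1) * (fact (n + x + y + z + 1) / fact (n + x + w + 1))
      * (fact (n + x) / fact (n + x + r) * (fact x / fact (x + r))))"
proof -
  obtain \<kappa> where \<kappa>: "\<And>x. common_sum n x y z =
    \<kappa> * (\<Prod>i<r. fact (2 * n + x + w + 1 + i) * fact (n + x + w + 1 + i) / (fact (n + x + i) * fact (x + i)))"
    using common_sum_formula[of n y z] unfolding r_def w_def by blast
  have \<kappa>': "common_sum n x y z = \<kappa> * ((\<Prod>i<r. fact (2 * n + x + w + 1 + i)) * (\<Prod>i<r. fact (n + x + w + 1 + i))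
      / ((\<Prod>i<r. fact (n + x + i)) * (\<Prod>i<r. fact (x + i))))" for x
    unfolding \<kappa> prod_dividef prod.distrib ..
  have rw: "r + w = y + z" by (simp add: r_def w_def)
  have i: "2 * n + Suc x + w + 1 = Suc (2 * n + x + w + 1)" "n + Suc x = Suc (n + x)" "Suc (n + x) + w + 1 = Suc (n + x + w + 1)"
    "2 * n + x + w + 1 + r = 2 * n + x + y + z + 1" "n + x + w + 1 + r = n + x + y + z + 1"
    using rw by simp_all
  show ?thesis
    unfolding \<kappa>'[of "Suc x"] \<kappa>'[of x] i(1-3) fact_prod_shift' i(4,5)
    by (simp add: mult_ac del: fact_Suc)
qed

text \<open>The factor by which both sides of the product formula for \<open>M_H5 x y z [a, b]\<close> grow when \<open>x\<close>
  is replaced by \<open>x + 1\<close>.\<close>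

definition growth :: "nat \<Rightarrow> nat \<Rightarrow> nat \<Rightarrow> nat \<Rightarrow> nat \<Rightarrow> real" where
  "growth a b x y z = (let M = a + b + x; c = M + y; d = M + z in
     2 * fact (2 * (a + b) + x + y + z + 1) * fact (M + y + z + 1) * fact M * fact x
       * fact (2 * c + 1) * fact (2 * d + 1) * fact (c + 1 + a) * fact (d - a)
     / (fact (c + 1 + (a + b)) * fact c * fact d * fact (x + z) * fact (c + d + 2) * fact (c + d + 1)
       * fact (d + 1 + a) * fact (c - a)))"

lemma M_H5_growth: "M_H5 (Suc x) y z [a, b] = M_H5 x y z [a, b] * growth a b x y z"
proof -
  define n where "n = a + b"
  define M where "M = n + x"
  define c where "c = M + y"
  define d where "d = M + z"
  have M: "M_H5 u y z [a, b] = 2 ^ a * (ucoef (y + a) * lcoef (z + b)) * (fern_factor n u y z {1..a} {a + 1..n} * common_sum n u y z)" for u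
    using M_H5_factored[of "[a, b]" u y z] unfolding pair_sums pair_positions n_def by simp
  have ins: "insert 0 {1..a} = {0..a}" by auto
  have set: "{n + Suc x + z + 1..n + Suc x + y} = {d + 2..c + 1}" "{n + Suc x + y + 1..n + Suc x + z} = {c + 2..d + 1}"
    "{n + x + z + 1..n + x + y} = {d + 1..c}" "{n + x + y + 1..n + x + z} = {c + 1..d}"
    by (simp_all add: M_def c_def d_def)
  define p1 q1 m0 x0 d1 d2 ay bz p2 p2' qy qz xz xy g1 g2 az by' :: real
    where "p1 = fact (2 * n + x + y + z + 1)" and "q1 = fact (M + y + z + 1)" and "m0 = fact M" and "x0 = fact x"
    and "d1 = fact (2 * d + 1)" and "d2 = fact (2 * c + 1)" and "ay = fact (c + 1 + a)" and "bz = fact (d - a)"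
    and "p2 = fact (d + 1 + n)" and "p2' = fact (c + 1 + n)" and "qy = fact c" and "qz = fact d"
    and "xz = fact (x + z)" and "xy = fact (x + y)" and "g1 = fact (c + d + 2)" and "g2 = fact (c + d + 1)"
    and "az = fact (d + 1 + a)" and "by' = fact (c - a)"
  note defs = p1_def q1_def m0_def x0_def d1_def d2_def ay_def bz_def p2_def p2'_def qy_def qz_def xz_def xy_def g1_def g2_def az_def by'_def
  have nz: "p1 \<noteq> 0" "q1 \<noteq> 0" "m0 \<noteq> 0" "x0 \<noteq> 0" "d1 \<noteq> 0" "d2 \<noteq> 0" "ay \<noteq> 0" "bz \<noteq> 0" "p2 \<noteq> 0" "p2' \<noteq> 0"
    "qy \<noteq> 0" "qz \<noteq> 0" "xz \<noteq> 0" "xy \<noteq> 0" "g1 \<noteq> 0" "g2 \<noteq> 0" "az \<noteq> 0" "by' \<noteq> 0"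
    unfolding defs by (rule fact_nonzero)+
  have gr: "growth a b x y z = 2 * p1 * q1 * m0 * x0 * d2 * d1 * ay * bz / (p2' * qy * qz * xz * g1 * g2 * az * by')"
    unfolding growth_def Let_def n_def[symmetric] M_def[symmetric] c_def[symmetric] d_def[symmetric] defs ..
  have dn: "d - n = x + z" "c - n = x + y" by (simp_all add: c_def d_def M_def)
  have le: "a \<le> n" "n \<le> c" "n \<le> d" "a \<le> c" "a \<le> d" by (simp_all add: c_def d_def M_def n_def)
  have s: "real (Suc c) \<noteq> 0" "real (Suc d) \<noteq> 0" by simp_all
  have top: "fact (2 * e + 2) = 2 * real (Suc e) * fact (2 * e + 1)" "fact (Suc e) = real (Suc e) * fact e" for e
    by (simp_all add: algebra_simps)
  have "fern_factor n (Suc x) y z {1..a} {a + 1..n} * common_sum n (Suc x) y z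
      = fern_factor n x y z {1..a} {a + 1..n} * common_sum n x y z * growth a b x y z"
  proof (cases "y \<le> z")
    case True
    then have e: "{d + 2..c + 1} = {}" "{d + 1..c} = {}" and cd: "c \<le> d" by (auto simp: c_def d_def)
    have w: "max y z = z" "min y z = y" "2 * n + x + z + 1 = d + 1 + n" "n + x = M" "M + z + 1 = Suc d" "M + y = c"
      using True by (simp_all add: d_def M_def c_def)
    have i: "n + x + y + z + 1 = M + y + z + 1" by (simp add: M_def)
    have cs: "common_sum n (Suc x) y z = common_sum n x y z * (p1 / p2 * (q1 / (real (Suc d) * qz)) * (m0 / qy * (x0 / xy)))"
      using common_sum_shift[of n x y z] unfolding w i top defs .
    have D1: "Dlt1 {c + 2..d + 1} = Dlt1 {c + 1..d} * (2 * real (Suc d) * d1 * d2 / (g1 * g2))"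
      using Dlt1_shift[OF cd] unfolding top defs .
    have cp: "crossprod {a + 1..n} {c + 2..d + 1} = crossprod {a + 1..n} {c + 1..d} * (bz / xz * (p2 / az) / (by' / xy * (p2' / ay)))"
      using crossprod_shift[OF le(1,2) cd] unfolding dn defs .
    define A B C D where "A = Dlt {0..a} * Dlt1 {a + 1..n}" and "B = crossprod {a + 1..n} {c + 1..d}"
      and "C = Dlt1 {c + 1..d}" and "D = common_sum n x y z"
    show ?thesis
      unfolding fern_factor_def ins set e crossprod_empty Dlt_empty cs D1 cp gr
      unfolding A_def[symmetric] B_def[symmetric] C_def[symmetric] D_def[symmetric]
      using nz s by (simp add: field_simps del: of_nat_Suc)
  next
    case False
    then have e: "{c + 2..d + 1} = {}" "{c + 1..d} = {}" and dc: "d \<le> c" by (auto simp: c_def d_def)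
    have w: "max y z = y" "min y z = z" "2 * n + x + y + 1 = c + 1 + n" "n + x = M" "M + y + 1 = Suc c" "M + z = d"
      using False by (simp_all add: d_def M_def c_def)
    have i: "n + x + y + z + 1 = M + y + z + 1" by (simp add: M_def)
    have cs: "common_sum n (Suc x) y z = common_sum n x y z * (p1 / p2' * (q1 / (real (Suc c) * qy)) * (m0 / qz * (x0 / xz)))"
      using common_sum_shift[of n x y z] unfolding w i top defs .
    have j: "d + c + 2 = c + d + 2" "d + c + 1 = c + d + 1" "c + 1 = Suc c" "d + 1 = Suc d" by simp_all
    have D1: "Dlt {d + 2..Suc c} = Dlt {Suc d..c} * (2 * real (Suc c) * d2 * d1 / (g1 * g2) * (real (Suc d) / real (Suc c)))"
      using Dlt_shift[OF dc] unfolding top defs j .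
    have cp: "crossprod {0..a} {d + 2..c + 1} = crossprod {0..a} {d + 1..c} * (real (Suc c) * ay / by' / (real (Suc d) * az / bz))"
      using crossprod_shift_0[OF le(5) dc] unfolding defs .
    define A B C D where "A = Dlt {0..a} * Dlt1 {a + 1..n}" and "B = crossprod {0..a} {Suc d..c}"
      and "C = Dlt {Suc d..c}" and "D = common_sum n x y z"
    show ?thesis
      unfolding fern_factor_def ins set e crossprod_empty Dlt_empty cs cp gr
      unfolding j D1
      unfolding A_def[symmetric] B_def[symmetric] C_def[symmetric] D_def[symmetric]
      using nz s by (simp add: field_simps del: of_nat_Suc)
  qed
  then show ?thesis unfolding M by simp
qed

lemma quadruple_positions: "evenpos [a, b, x, w] = {a + 1..a + b} \<union> {a + b + x + 1..a + b + x + w}"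
  and quadruple_even_sum: "even_sum [a, b, x, w] = b + w"
proof -
  have "{i \<in> {1..length [a, b, x, w]}. even i} = {2, 4}" by (auto simp: le_Suc_eq)
  moreover have "entry [a, b, x, w] 2 = b" "entry [a, b, x, w] 4 = w" by (simp_all add: entry_def)
  moreover have "s_sum (2 - 1) [a, b, x, w] = a" "s_sum (4 - 1) [a, b, x, w] = a + b + x"
    by (simp_all add: entry_def s_sum_def numeral_eq_Suc)
  ultimately have "evenpos [a, b, x, w] = {a + 1..<a + 1 + b} \<union> {a + b + x + 1..<a + b + x + 1 + w}"
    unfolding evenpos_def blocks_def by (simp only: UN_insert UN_empty Un_empty_right)
  moreover have "{k + 1..<k + 1 + l} = {k + 1..k + l}" for k l :: nat by auto
  ultimately show e: "evenpos [a, b, x, w] = {a + 1..a + b} \<union> {a + b + x + 1..a + b + x + w}"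
    by (simp only:)
  have "card ({a + 1..a + b} \<union> {a + b + x + 1..a + b + x + w}) = b + w"
    by (subst card_Un_disjoint) auto
  then show "even_sum [a, b, x, w] = b + w" using card_evenpos[of "[a, b, x, w]"] unfolding e by simp
qed

lemma Q_quadruple:
  "Q [a, b, x, w] = lcoef (b + w) *
    (Dlt1 {a + 1..a + b} * Dlt1 {a + b + x + 1..a + b + x + w} * crossprod {a + 1..a + b} {a + b + x + 1..a + b + x + w})"
proof -
  have "Dlt1 ({a + 1..a + b} \<union> {a + b + x + 1..a + b + x + w})
      = Dlt1 {a + 1..a + b} * Dlt1 {a + b + x + 1..a + b + x + w} * crossprod {a + 1..a + b} {a + b + x + 1..a + b + x + w}"
    by (rule Dlt1_Un) auto
  then show ?thesis unfolding Q_formula quadruple_positions quadruple_even_sum by simp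
qed

text \<open>The part of the product formula for \<open>M_H5 x y z [a, b]\<close> that depends on \<open>x\<close>.\<close>

definition variable_part :: "nat \<Rightarrow> nat \<Rightarrow> nat \<Rightarrow> nat \<Rightarrow> nat \<Rightarrow> real" where
  "variable_part a b x y z =
     Q [a, b, x, y + z] / V (2 * x + 2 * a + 2 * b + 3) (int y + int z - 1) y
     * (T (x + b + 1) (int y + int z + 2 * int a) y
        / (T (x + 2 * a + b + 2) (int y + int b - 1) b * T (x + z + 1) (int y + int b - 1) b))"

lemma variable_part_growth: "variable_part a b (Suc x) y z = variable_part a b x y z * growth a b x y z"
proof -
  define n where "n = a + b"
  define M where "M = n + x"
  define c where "c = M + y"
  define d where "d = M + z"
  define e where "e = M + (y + z)"
  define p1 q1 m0 x0 d1 d2 ay bz p2' qy qz xz g1 g2 az by' e0 e1 b2 xyz h1 b0 n0 a0 :: real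
    where "p1 = fact (2 * n + x + y + z + 1)" and "q1 = fact e" and "m0 = fact M" and "x0 = fact x"
    and "d1 = fact (2 * d + 1)" and "d2 = fact (2 * c + 1)" and "ay = fact (c + 1 + a)" and "bz = fact (d - a)"
    and "p2' = fact (c + 1 + n)" and "qy = fact c" and "qz = fact d"
    and "xz = fact (x + z)" and "g1 = fact (c + d + 2)" and "g2 = fact (c + d + 1)"
    and "az = fact (d + 1 + a)" and "by' = fact (c - a)"
    and "e0 = fact (2 * M + 1)" and "e1 = fact (2 * e + 1)" and "b2 = fact (e - a)" and "xyz = fact (e - n)"
    and "h1 = fact (e + 1 + a)" and "b0 = fact (M - a)" and "n0 = fact (M + 1 + n)" and "a0 = fact (M + 1 + a)"
  note defs = p1_def q1_def m0_def x0_def d1_def d2_def ay_def bz_def p2'_def qy_def qz_def xz_def g1_def g2_def az_def by'_def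
    e0_def e1_def b2_def xyz_def h1_def b0_def n0_def a0_def
  have nz: "p1 \<noteq> 0" "q1 \<noteq> 0" "m0 \<noteq> 0" "x0 \<noteq> 0" "d1 \<noteq> 0" "d2 \<noteq> 0" "ay \<noteq> 0" "bz \<noteq> 0" "p2' \<noteq> 0"
    "qy \<noteq> 0" "qz \<noteq> 0" "xz \<noteq> 0" "g1 \<noteq> 0" "g2 \<noteq> 0" "az \<noteq> 0" "by' \<noteq> 0"
    "e0 \<noteq> 0" "e1 \<noteq> 0" "b2 \<noteq> 0" "xyz \<noteq> 0" "h1 \<noteq> 0" "b0 \<noteq> 0" "n0 \<noteq> 0" "a0 \<noteq> 0"
    unfolding defs by (rule fact_nonzero)+
  have M1: "c + z + 1 = Suc e" by (simp add: c_def e_def)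
  have top: "fact (2 * e + 2) = 2 * real (Suc e) * fact (2 * e + 1)" "fact (Suc e) = real (Suc e) * fact e" for e
    by (simp_all add: algebra_simps)
  have gr: "growth a b x y z = 2 * p1 * (real (Suc e) * q1) * m0 * x0 * d2 * d1 * ay * bz / (p2' * qy * qz * xz * g1 * g2 * az * by')"
    unfolding growth_def Let_def n_def[symmetric] M_def[symmetric] c_def[symmetric] d_def[symmetric] M1 top(2) defs ..
  have s: "real (Suc e) \<noteq> 0" by simp
  have le: "a \<le> n" "n \<le> M" "M \<le> e" by (simp_all add: M_def n_def e_def)
  have lcoef: "Q [a, b, Suc x, y + z] / V (2 * M + 5) (int y + int z - 1) y
      = Q [a, b, x, y + z] / V (2 * M + 3) (int y + int z - 1) y *
        (2 * real (Suc e) * e1 * e0 / (g1 * g2) * (b2 / xyz * (p1 / h1) / (b0 / x0 * (n0 / a0)))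
          / (e1 * qz * e0 * qy / (d1 * q1 * d2 * m0)))"
  proof -
    have i: "a + b = n" "n + Suc x + 1 = M + 2" "n + Suc x + (y + z) = e + 1" "n + x + 1 = M + 1" "n + x + (y + z) = e"
      by (simp_all add: M_def n_def e_def)
    have j: "M + e + 2 = c + d + 2" "M + e + 1 = c + d + 1" "M - n = x" "e + 1 + n = 2 * n + x + y + z + 1"
      by (simp_all add: M_def e_def c_def d_def)
    have q: "Dlt1 {M + 2..e + 1} = Dlt1 {M + 1..e} * (2 * real (Suc e) * e1 * e0 / (g1 * g2))"
      using Dlt1_shift[OF le(3)] unfolding top(1) j defs .
    have cr: "crossprod {a + 1..n} {M + 2..e + 1} = crossprod {a + 1..n} {M + 1..e} * (b2 / xyz * (p1 / h1) / (b0 / x0 * (n0 / a0)))"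
      using crossprod_shift[OF le] unfolding j defs .
    have k: "2 * M + 2 * y + 2 * z + 1 = 2 * e + 1" "M + z = d" "M + y = c" "2 * M + 2 * z + 1 = 2 * d + 1" "c + z = e"
      "2 * M + 2 * y + 1 = 2 * c + 1" by (simp_all add: e_def c_def d_def)
    have v: "V (2 * M + 5) (int y + int z - 1) y = V (2 * M + 3) (int y + int z - 1) y * (e1 * qz * e0 * qy / (d1 * q1 * d2 * m0))"
      using V_shift[of M y z] unfolding k defs .
    have gen: "(l * (A * (B * r1) * (C * r2))) / (W * r3) = l * (A * B * C) / W * (r1 * r2 / r3)" for l A B C W r1 r2 r3 :: real
      by simp
    show ?thesis unfolding Q_quadruple i q cr v by (rule gen)
  qed
  have ix: "2 * Suc x + 2 * a + 2 * b + 3 = 2 * M + 5" "2 * x + 2 * a + 2 * b + 3 = 2 * M + 3" by (simp_all add: M_def n_def)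
  have t1: "T (Suc x + b + 1) (int y + int z + 2 * int a) y = T (x + b + 1) (int y + int z + 2 * int a) y * (h1 / az * (b0 / by'))"
  proof -
    have i: "int (z + 2 * a + 1) + int y - 1 = int y + int z + 2 * int a" "Suc (x + b + 1) = Suc x + b + 1"
      "x + b + 1 + y + (z + 2 * a + 1) - 1 = e + 1 + a" "x + b + 1 + (z + 2 * a + 1) - 1 = d + 1 + a"
      "x + b + 1 - 1 = M - a" "x + b + 1 + y - 1 = c - a"
      by (simp_all add: e_def c_def d_def M_def n_def)
    show ?thesis using T_shift[of "x + b + 1" "z + 2 * a + 1" y] unfolding i defs by simp
  qed
  have t2: "T (Suc x + 2 * a + b + 2) (int y + int b - 1) b = T (x + 2 * a + b + 2) (int y + int b - 1) b * (p2' / ay * (a0 / n0))"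
  proof -
    have i: "Suc (x + 2 * a + b + 2) = Suc x + 2 * a + b + 2"
      "x + 2 * a + b + 2 + b + y - 1 = c + 1 + n" "x + 2 * a + b + 2 + y - 1 = c + 1 + a"
      "x + 2 * a + b + 2 - 1 = M + 1 + a" "x + 2 * a + b + 2 + b - 1 = M + 1 + n"
      by (simp_all add: c_def M_def n_def)
    show ?thesis using T_shift[of "x + 2 * a + b + 2" y b] unfolding i defs by simp
  qed
  have t3: "T (Suc x + z + 1) (int y + int b - 1) b = T (x + z + 1) (int y + int b - 1) b * (b2 / xyz * (xz / bz))"
  proof -
    have i: "Suc (x + z + 1) = Suc x + z + 1"
      "x + z + 1 + b + y - 1 = e - a" "x + z + 1 + y - 1 = e - n"
      "x + z + 1 - 1 = x + z" "x + z + 1 + b - 1 = d - a"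
      by (simp_all add: e_def d_def M_def n_def)
    show ?thesis using T_shift[of "x + z + 1" y b] unfolding i defs by simp
  qed
  have gen: "q * rq * (t * r1 / (u * r2 * (v * r3))) = q * (t / (u * v)) * (rq * r1 / (r2 * r3))" for q rq t r1 u r2 v r3 :: real
    by (simp add: mult_ac)
  have ratio: "(2 * real (Suc e) * e1 * e0 / (g1 * g2) * (b2 / xyz * (p1 / h1) / (b0 / x0 * (n0 / a0)))
          / (e1 * qz * e0 * qy / (d1 * q1 * d2 * m0))) * (h1 / az * (b0 / by'))
        / ((p2' / ay * (a0 / n0)) * (b2 / xyz * (xz / bz))) = growth a b x y z"
    unfolding gr using nz s by (simp add: field_simps del: of_nat_Suc)
  show ?thesis unfolding variable_part_def ix lcoef t1 t2 t3 gen ratio ..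
qed

text \<open>For \<open>x = 0\<close> only one set \<open>S\<close> of crossing lozenges is possible.\<close>

lemma first_formula_0: "M_H5 0 y z [a, b] = P' y (y + 2 * a + 1) b * P (z + b) (z + b) a"
proof -
  let ?n = "a + b" and ?r = "min y z"
  have S: "{S. S \<subseteq> {?n + 1..?n + 0 + ?r} \<and> card S = ?r} = {{?n + 1..?n + ?r}}"
  proof -
    have "S = {?n + 1..?n + ?r}" if "S \<subseteq> {?n + 1..?n + ?r}" "card S = ?r" for S
      using that by (intro card_subset_eq) auto
    then show ?thesis by auto
  qed
  have "insert 0 {1..a} \<union> {?n + 1..?n + ?r} \<union> {?n + 0 + z + 1..?n + 0 + y} = {0..a} \<union> {a + b + 1..a + b + y}"
    "{a + 1..?n} \<union> {?n + 1..?n + ?r} \<union> {?n + 0 + y + 1..?n + 0 + z} = {a + 1..a + (z + b)}"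
    by auto
  then show ?thesis
    using M_H5_formula[of "[a, b]" 0 y z]
    unfolding pair_sums pair_positions S P'_formula P_formula by (simp add: add_ac)
qed

lemma first_formula:
  "M_H5 x y z [a, b] =
     P' y (y + 2 * a + 1) b * P (z + b) (z + b) a * Q [a, b, x, y + z]
       / P (y + z + b) (y + z + b) a
     * (V (2 * a + 2 * b + 3) (int y + int z - 1) y
        / V (2 * x + 2 * a + 2 * b + 3) (int y + int z - 1) y)
     * ((T (x + b + 1) (int y + int z + 2 * int a) y
         * T (2 * a + b + 2) (int y + int b - 1) b
         * T (z + 1) (int y + int b - 1) b)
        / (T (b + 1) (int y + int z + 2 * int a) y
         * T (x + 2 * a + b + 2) (int y + int b - 1) b
         * T (x + z + 1) (int y + int b - 1) b))"
proof -
  have Q0: "Q [a, b, 0, y + z] = P (y + z + b) (y + z + b) a"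
  proof -
    have "{a + 1..a + b} \<union> {a + b + 0 + 1..a + b + 0 + (y + z)} = {a + 1..a + (y + z + b)}" by auto
    then show ?thesis unfolding Q_formula quadruple_positions quadruple_even_sum P_formula by (simp add: add_ac)
  qed
  have P0: "P (y + z + b) (y + z + b) a \<noteq> 0"
    unfolding P_formula using lcoef_pos[of "y + z + b"] Dlt1_pos[of "{a + 1..a + (y + z + b)}"] by simp
  have V0: "V (2 * a + 2 * b + 3) (int y + int z - 1) y \<noteq> 0" by (rule V_nonzero) simp
  have T0: "T (b + 1) (int y + int z + 2 * int a) y \<noteq> 0"
    "T (2 * a + b + 2) (int y + int b - 1) b \<noteq> 0" "T (z + 1) (int y + int b - 1) b \<noteq> 0"
  proof -
    have i: "int (z + 2 * a + 1) + int y - 1 = int y + int z + 2 * int a" by simp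
    show "T (b + 1) (int y + int z + 2 * int a) y \<noteq> 0"
      using T_pos[of "b + 1" "z + 2 * a + 1" y] unfolding i by simp
    show "T (2 * a + b + 2) (int y + int b - 1) b \<noteq> 0" "T (z + 1) (int y + int b - 1) b \<noteq> 0"
      using T_pos[of "2 * a + b + 2" y b] T_pos[of "z + 1" y b] by simp_all
  qed
  define V1 where "V1 = V (2 * a + 2 * b + 3) (int y + int z - 1) y"
  define T1 where "T1 = T (b + 1) (int y + int z + 2 * int a) y"
  define T2 where "T2 = T (2 * a + b + 2) (int y + int b - 1) b"
  define T3 where "T3 = T (z + 1) (int y + int b - 1) b"
  define P1 where "P1 = P (y + z + b) (y + z + b) a"
  have nz: "V1 \<noteq> 0" "T1 \<noteq> 0" "T2 \<noteq> 0" "T3 \<noteq> 0" "P1 \<noteq> 0"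
    unfolding V1_def T1_def T2_def T3_def P1_def by (rule V0 T0 P0)+
  define K where "K = P' y (y + 2 * a + 1) b * P (z + b) (z + b) a"
  have "M_H5 x y z [a, b] = K * (V1 * T2 * T3 / (P1 * T1)) * variable_part a b x y z"
  proof (induction x)
    case 0
    have "variable_part a b 0 y z = P1 / V1 * (T1 / (T2 * T3))"
      unfolding variable_part_def Q0 V1_def T1_def T2_def T3_def P1_def by simp
    then show ?case unfolding first_formula_0 K_def[symmetric] using nz by simp
  next
    case (Suc x)
    then show ?case unfolding M_H5_growth variable_part_growth by simp
  qed
  then show ?thesis
    unfolding variable_part_def K_def[symmetric] V1_def[symmetric] T1_def[symmetric] T2_def[symmetric] T3_def[symmetric] P1_def[symmetric]
    by (simp add: mult_ac)
qed

theorem theorem2p6: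
  fixes x y z :: nat
  shows
    "(\<forall>a b :: nat.
        M_H5 x y z [a, b] =
          P' y (y + 2 * a + 1) b * P (z + b) (z + b) a * Q [a, b, x, y + z]
            / P (y + z + b) (y + z + b) a
          * (V (2 * a + 2 * b + 3) (int y + int z - 1) y
             / V (2 * x + 2 * a + 2 * b + 3) (int y + int z - 1) y)
          * ((T (x + b + 1) (int y + int z + 2 * int a) y
              * T (2 * a + b + 2) (int y + int b - 1) b
              * T (z + 1) (int y + int b - 1) b)
             / (T (b + 1) (int y + int z + 2 * int a) y
              * T (x + 2 * a + b + 2) (int y + int b - 1) b
              * T (x + z + 1) (int y + int b - 1) b)))
     \<and> (\<forall>k \<ge> 2. \<forall>as :: nat list. length as = 2 * k \<longrightarrow>
         (let so = odd_sum as; se = even_sum as;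
              e = (\<lambda>i. e_sum i as); \<sigma> = sigma as;
              T' = (\<lambda>i u. T u (int (entry as (2 * i - 2)) + int (o_sum i as) - 1) (o_sum i as))
          in M_H5 x y z as =
               2 ^ (entry as 1) * M_H5 x y z [so, se]
               * (K' (0 # (entry as 1 + 1) # tl as @ [y])
                  * Q (butlast as @ [entry as (2 * k) + z])
                  / (P' y (y + 2 * so + 1) se * P (z + se) (z + se) so))
               * (\<Prod>i = 2..k.
                    (T' i (x + z + e i + 1) * T' i (y + e i + 1))
                    / (T' i (x + y + e i + 1) * T' i (z + e i + 1))
                    * ((T' i (x + y + \<sigma> i + 2) * T' i (z + \<sigma> i + 2))
                       / (T' i (x + z + \<sigma> i + 2) * T' i (y + \<sigma> i + 2))))))"
proof (intro conjI allI impI)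
  fix a b :: nat
  show "M_H5 x y z [a, b] =
          P' y (y + 2 * a + 1) b * P (z + b) (z + b) a * Q [a, b, x, y + z]
            / P (y + z + b) (y + z + b) a
          * (V (2 * a + 2 * b + 3) (int y + int z - 1) y
             / V (2 * x + 2 * a + 2 * b + 3) (int y + int z - 1) y)
          * ((T (x + b + 1) (int y + int z + 2 * int a) y
              * T (2 * a + b + 2) (int y + int b - 1) b
              * T (z + 1) (int y + int b - 1) b)
             / (T (b + 1) (int y + int z + 2 * int a) y
              * T (x + 2 * a + b + 2) (int y + int b - 1) b
              * T (x + z + 1) (int y + int b - 1) b))"
    by (rule first_formula)
qed (unfold Let_def, erule (1) second_formula)

end
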